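(* Let $\lambda,\mu \vdash n$ be partitions with $\ell(\lambda)\leq 2$, $\ell(\mu)\leq 3$, and $\mu_1\geq \lambda_1$. Then $s_\lambda * s_\mu(x_1,\ldots,x_k)$ has a saturated Newton polytope for every $k\in\mathbb{N}$.
   Context: For a partition $\lambda$, $\ell(\lambda)$ is its number of nonzero parts, and $\lambda\vdash n$ means $\lambda$ is a partition of $n$. For partitions $\lambda,\mu,\nu\vdash n$, the Kronecker coefficient $g(\lambda,\mu,\nu)$ is the multiplicity of the irreducible (Specht) $S_n$-module $\mathbb{S}_\nu$ in $\mathbb{S}_\lambda\otimes\mathbb{S}_\mu$ (over $\mathbb{C}$). The Kronecker product of Schur functions is $s_\lambda * s_\mu := \sum_{\nu\vdash n} g(\lambda,\mu,\nu)s_\nu$. For a symmetric function $f$, $f(x_1,\ldots,x_k)$ is the specialization $x_m=0$ for all $m\geq k+1$. A polynomial $f(x_1,\ldots,x_k)=\sum_\alpha c_\alpha x^\alpha$ with nonnegative coefficients has a saturated Newton polytope if the set $M_k(f)=\{\alpha\in\mathbb{Z}_{\ge0}^k : c_\alpha>0\}$ equals the set of integer points of its convex hull, i.e. $M_k(f)=\mathrm{conv}(M_k(f))\cap\mathbb{Z}^k$. *)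

theory Defs
  imports
    "HOL-Analysis.Analysis"
    "HOL-Analysis.Finite_Function_Topology"
    "HOL-Combinatorics.Permutations"
    "HOL-Library.Function_Algebras"
begin

section \<open>Partitions and Young diagrams\<close>

text \<open>A partition is the list of its nonzero parts in weakly decreasing order, so that its number
  of nonzero parts is the length of the list.\<close>

definition partitions :: "nat \<Rightarrow> nat list set" where
  "partitions n = {p. sorted_wrt (\<ge>) p \<and> (\<forall>x\<in>set p. 0 < x) \<and> sum_list p = n}"

text \<open>Parts are numbered from 0 on, like the rows and columns of the diagram: the first part is
  \<open>nth_part p 0\<close>. Missing parts are 0.\<close>

definition nth_part :: "nat list \<Rightarrow> nat \<Rightarrow> nat" where
  "nth_part p i = (if i < length p then p ! i else 0)"

definition diagram :: "nat list \<Rightarrow> (nat \<times> nat) set" where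
  "diagram p = {(r, c). c < nth_part p r}"


section \<open>Complex representations on spaces of functions\<close>

text \<open>All representations below live on a subspace \<open>V\<close> of the complex vector space of functions
  on some type \<open>'x\<close>. A representation of a group \<open>G\<close> is given by \<open>V\<close> and the operators
  \<open>\<rho> g\<close> on \<open>V\<close>.\<close>

definition fscale :: "complex \<Rightarrow> ('x \<Rightarrow> complex) \<Rightarrow> 'x \<Rightarrow> complex" where
  "fscale c f = (\<lambda>x. c * f x)"

global_interpretation cfun: vector_space "fscale :: complex \<Rightarrow> ('x \<Rightarrow> complex) \<Rightarrow> 'x \<Rightarrow> complex"
  by standard (simp_all add: fscale_def fun_eq_iff algebra_simps)

definition invariant_subspace ::
  "'g set \<Rightarrow> ('g \<Rightarrow> ('x \<Rightarrow> complex) \<Rightarrow> 'x \<Rightarrow> complex) \<Rightarrow> ('x \<Rightarrow> complex) set \<Rightarrow> bool" where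
  "invariant_subspace G \<rho> W \<longleftrightarrow> cfun.subspace W \<and> (\<forall>g\<in>G. \<forall>w\<in>W. \<rho> g w \<in> W)"

definition irreducible_rep ::
  "'g set \<Rightarrow> ('g \<Rightarrow> ('x \<Rightarrow> complex) \<Rightarrow> 'x \<Rightarrow> complex) \<Rightarrow> ('x \<Rightarrow> complex) set \<Rightarrow> bool" where
  "irreducible_rep G \<rho> W \<longleftrightarrow> invariant_subspace G \<rho> W \<and> W \<noteq> {0} \<and>
     (\<forall>U. invariant_subspace G \<rho> U \<and> U \<subseteq> W \<longrightarrow> U = {0} \<or> U = W)"

definition isomorphic_reps ::
  "'g set \<Rightarrow> ('g \<Rightarrow> ('x \<Rightarrow> complex) \<Rightarrow> 'x \<Rightarrow> complex) \<Rightarrow> ('x \<Rightarrow> complex) set \<Rightarrow>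
   ('g \<Rightarrow> ('y \<Rightarrow> complex) \<Rightarrow> 'y \<Rightarrow> complex) \<Rightarrow> ('y \<Rightarrow> complex) set \<Rightarrow> bool" where
  "isomorphic_reps G \<rho> V \<rho>' W \<longleftrightarrow> (\<exists>f. bij_betw f V W \<and>
     (\<forall>u\<in>V. \<forall>v\<in>V. f (u + v) = f u + f v) \<and>
     (\<forall>c. \<forall>v\<in>V. f (fscale c v) = fscale c (f v)) \<and>
     (\<forall>g\<in>G. \<forall>v\<in>V. f (\<rho> g v) = \<rho>' g (f v)))"

text \<open>\<open>V\<close> is the internal direct sum of \<open>W 0, \<dots>, W (d - 1)\<close>, each of them irreducible.\<close>

definition irreducible_decomposition ::
  "'g set \<Rightarrow> ('g \<Rightarrow> ('x \<Rightarrow> complex) \<Rightarrow> 'x \<Rightarrow> complex) \<Rightarrow> ('x \<Rightarrow> complex) set \<Rightarrow>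
   nat \<Rightarrow> (nat \<Rightarrow> ('x \<Rightarrow> complex) set) \<Rightarrow> bool" where
  "irreducible_decomposition G \<rho> V d W \<longleftrightarrow> (\<forall>i<d. irreducible_rep G \<rho> (W i)) \<and>
     bij_betw (\<lambda>w. \<Sum>i<d. w i) (PiE {..<d} W) V"

text \<open>The multiplicity of the irreducible representation \<open>U\<close> in \<open>V\<close>. The description is unique
  for finite \<open>G\<close> and finite-dimensional \<open>V\<close>, by Maschke's theorem and the Krull-Schmidt theorem.\<close>

definition multiplicity_in ::
  "'g set \<Rightarrow> ('g \<Rightarrow> ('y \<Rightarrow> complex) \<Rightarrow> 'y \<Rightarrow> complex) \<Rightarrow> ('y \<Rightarrow> complex) set \<Rightarrow>
   ('g \<Rightarrow> ('x \<Rightarrow> complex) \<Rightarrow> 'x \<Rightarrow> complex) \<Rightarrow> ('x \<Rightarrow> complex) set \<Rightarrow> nat" where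
  "multiplicity_in G \<rho>' U \<rho> V = (THE m. \<exists>d W. irreducible_decomposition G \<rho> V d W \<and>
     m = card {i. i < d \<and> isomorphic_reps G \<rho>' U \<rho> (W i)})"

text \<open>The representation on functions that is induced by an action \<open>a\<close> of permutations on points.\<close>

definition function_rep ::
  "((nat \<Rightarrow> nat) \<Rightarrow> 'x \<Rightarrow> 'x) \<Rightarrow> (nat \<Rightarrow> nat) \<Rightarrow> ('x \<Rightarrow> complex) \<Rightarrow> 'x \<Rightarrow> complex" where
  "function_rep a \<sigma> f = (\<lambda>x. f (a (inv \<sigma>) x))"

text \<open>The tensor product of two spaces of functions is realised as a space of functions of two
  variables, \<open>u \<otimes> v\<close> being the function \<open>(x, y) \<mapsto> u x * v y\<close>. If permutations act by
  \<open>function_rep a\<close> and \<open>function_rep b\<close> on the factors, then the diagonal action, which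
  sends \<open>u \<otimes> v\<close> to \<open>\<sigma> u \<otimes> \<sigma> v\<close>, is \<open>function_rep (pair_action a b)\<close>.\<close>

definition tensor :: "('x \<Rightarrow> complex) \<Rightarrow> ('y \<Rightarrow> complex) \<Rightarrow> 'x \<times> 'y \<Rightarrow> complex" where
  "tensor u v = (\<lambda>(x, y). u x * v y)"

definition tensor_space ::
  "('x \<Rightarrow> complex) set \<Rightarrow> ('y \<Rightarrow> complex) set \<Rightarrow> ('x \<times> 'y \<Rightarrow> complex) set" where
  "tensor_space V W = cfun.span {tensor u v | u v. u \<in> V \<and> v \<in> W}"

definition pair_action ::
  "((nat \<Rightarrow> nat) \<Rightarrow> 'x \<Rightarrow> 'x) \<Rightarrow> ((nat \<Rightarrow> nat) \<Rightarrow> 'y \<Rightarrow> 'y) \<Rightarrow> (nat \<Rightarrow> nat) \<Rightarrow> 'x \<times> 'y \<Rightarrow> 'x \<times> 'y" where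
  "pair_action a b \<sigma> = (\<lambda>(x, y). (a \<sigma> x, b \<sigma> y))"


section \<open>Specht modules and Kronecker coefficients\<close>

text \<open>The symmetric group on \<open>n\<close> letters acts on \<open>{..<n}\<close>. The letters also serve as the
  entries of tableaux.\<close>

definition sym_perms :: "nat \<Rightarrow> (nat \<Rightarrow> nat) set" where
  "sym_perms n = {\<sigma>. \<sigma> permutes {..<n}}"

definition tableau :: "nat \<Rightarrow> nat list \<Rightarrow> (nat \<times> nat \<Rightarrow> nat) \<Rightarrow> bool" where
  "tableau n p T \<longleftrightarrow> bij_betw T (diagram p) {..<n}"

text \<open>A tabloid (row equivalence class of tableaux) is represented by the sequence of the sets of
  entries of its rows.\<close>

definition tabloid :: "nat list \<Rightarrow> (nat \<times> nat \<Rightarrow> nat) \<Rightarrow> nat \<Rightarrow> nat set" where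
  "tabloid p T = (\<lambda>r. {T (r, c) | c. (r, c) \<in> diagram p})"

definition tabloid_action :: "(nat \<Rightarrow> nat) \<Rightarrow> (nat \<Rightarrow> nat set) \<Rightarrow> nat \<Rightarrow> nat set" where
  "tabloid_action \<sigma> t = (\<lambda>r. \<sigma> ` t r)"

definition column_stabilizer :: "nat \<Rightarrow> nat list \<Rightarrow> (nat \<times> nat \<Rightarrow> nat) \<Rightarrow> (nat \<Rightarrow> nat) set" where
  "column_stabilizer n p T =
     {\<sigma> \<in> sym_perms n. \<forall>r c. (r, c) \<in> diagram p \<longrightarrow> (\<exists>r'. (r', c) \<in> diagram p \<and> \<sigma> (T (r, c)) = T (r', c))}"

text \<open>The polytabloid of \<open>T\<close> is the signed sum of the tabloids \<open>\<sigma> {T}\<close>, for \<open>\<sigma>\<close> in the column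
  stabilizer of \<open>T\<close>; the Specht module is the span of all polytabloids, as in James's
  construction. A formal linear combination of tabloids is the function of its coefficients.\<close>

definition polytabloid ::
  "nat \<Rightarrow> nat list \<Rightarrow> (nat \<times> nat \<Rightarrow> nat) \<Rightarrow> (nat \<Rightarrow> nat set) \<Rightarrow> complex" where
  "polytabloid n p T = (\<lambda>t. \<Sum>\<sigma>\<in>column_stabilizer n p T.
     if t = tabloid_action \<sigma> (tabloid p T) then of_int (sign \<sigma>) else 0)"

definition specht_module :: "nat \<Rightarrow> nat list \<Rightarrow> ((nat \<Rightarrow> nat set) \<Rightarrow> complex) set" where
  "specht_module n p = cfun.span {polytabloid n p T | T. tableau n p T}"

definition kronecker_coeff :: "nat \<Rightarrow> nat list \<Rightarrow> nat list \<Rightarrow> nat list \<Rightarrow> nat" where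
  "kronecker_coeff n p q s = multiplicity_in (sym_perms n)
     (function_rep tabloid_action) (specht_module n s)
     (function_rep (pair_action tabloid_action tabloid_action))
     (tensor_space (specht_module n p) (specht_module n q))"


section \<open>Schur functions and their Kronecker product\<close>

text \<open>Symmetric functions are formal power series in the variables with indices \<open>0, 1, 2, \<dots>\<close>,
  represented by the function that sends an exponent vector to the coefficient of its monomial;
  polynomials are represented in the same way.\<close>

type_synonym exponent = "nat \<Rightarrow>\<^sub>0 nat"

definition semistandard :: "nat list \<Rightarrow> (nat \<times> nat \<Rightarrow> nat) \<Rightarrow> bool" where
  "semistandard p T \<longleftrightarrow> T \<in> extensional (diagram p) \<and>
     (\<forall>r c c'. (r, c') \<in> diagram p \<and> c < c' \<longrightarrow> T (r, c) \<le> T (r, c')) \<and>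
     (\<forall>r r' c. (r', c) \<in> diagram p \<and> r < r' \<longrightarrow> T (r, c) < T (r', c))"

text \<open>The Schur function is the generating function of semistandard tableaux by content.\<close>

definition schur :: "nat list \<Rightarrow> exponent \<Rightarrow> int" where
  "schur p \<alpha> = int (card {T. semistandard p T \<and>
     (\<forall>i. card {b \<in> diagram p. T b = i} = Poly_Mapping.lookup \<alpha> i)})"

definition kronecker_product :: "nat \<Rightarrow> nat list \<Rightarrow> nat list \<Rightarrow> exponent \<Rightarrow> int" where
  "kronecker_product n p q \<alpha> = (\<Sum>s\<in>partitions n. int (kronecker_coeff n p q s) * schur s \<alpha>)"

text \<open>Keep the variables with indices \<open>0, \<dots>, k - 1\<close> and set all the others to 0.\<close>

definition specialize :: "nat \<Rightarrow> (exponent \<Rightarrow> int) \<Rightarrow> exponent \<Rightarrow> int" where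
  "specialize k f \<alpha> = (if Poly_Mapping.keys \<alpha> \<subseteq> {..<k} then f \<alpha> else 0)"


section \<open>Saturated Newton polytopes\<close>

text \<open>Real \<open>k\<close>-space is taken to be the subspace of the finitely supported real sequences whose
  support lies in \<open>{..<k}\<close>.\<close>

definition real_point :: "exponent \<Rightarrow> nat \<Rightarrow>\<^sub>0 real" where
  "real_point = Poly_Mapping.map real"

definition integer_points :: "nat \<Rightarrow> (nat \<Rightarrow>\<^sub>0 real) set" where
  "integer_points k = {v. Poly_Mapping.keys v \<subseteq> {..<k} \<and> (\<forall>i. Poly_Mapping.lookup v i \<in> \<int>)}"

definition exponent_set :: "nat \<Rightarrow> (exponent \<Rightarrow> int) \<Rightarrow> (nat \<Rightarrow>\<^sub>0 real) set" where
  "exponent_set k f = real_point ` {\<alpha>. Poly_Mapping.keys \<alpha> \<subseteq> {..<k} \<and> 0 < f \<alpha>}"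

definition saturated_newton_polytope :: "nat \<Rightarrow> (exponent \<Rightarrow> int) \<Rightarrow> bool" where
  "saturated_newton_polytope k f \<longleftrightarrow> (\<forall>\<alpha>. 0 \<le> f \<alpha>) \<and>
     exponent_set k f = convex hull (exponent_set k f) \<inter> integer_points k"

end

theory Submission
  imports Defs
begin


text \<open>Let \<open>N = nth_part lam 0 + nth_part mu 1\<close>. The monomial \<open>x^\<alpha>\<close> occurs in the Kronecker product if and only
  if \<open>\<alpha>\<close> has sum \<open>n\<close> and no exponent exceeds \<open>N\<close> (\<open>kronecker_product_pos_iff\<close>). So the exponent set
  consists of the integer points of the polytope that is cut out of real \<open>k\<close>-space by
  \<open>0 \<le> x_i \<le> N\<close> and \<open>\<Sum> x_i = n\<close>, and such a set contains all integer points of its convex hull.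

  The exponents of a Schur function are bounded by the first part of its partition. Hence the
  description of the monomials follows from two statements about the constituents of the tensor
  product \<open>V\<close> of the Specht modules of \<open>lam\<close> and \<open>mu\<close>.

  \<^item> No constituent has a first part larger than \<open>N\<close> (\<open>kronecker_coeff_eq_0\<close>). The Specht module of
    \<open>s\<close> contains a nonzero vector that is fixed by all permutations of the first row of a tableau.
    But \<open>V\<close> has no nonzero vector that is fixed by the symmetric group of a set \<open>A\<close> with more than
    \<open>N\<close> elements (\<open>symmetric_block_size\<close>): Specht modules consist of highest weight vectors, so that
    such a vector, looked at on \<open>A\<close> only, is a polynomial in the six entries of a
    \<open>2 \<times> 3\<close> matrix that is a highest weight vector for \<open>gl_2\<close> and \<open>gl_3\<close> at once. These polynomials
    are combinations of products of the corner entry and the corner minor, which limits their degree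
    (\<open>block_size_le\<close>).

  \<^item> The partition \<open>(N, n - N)\<close> does occur (\<open>kronecker_coeff_two_row_pos\<close>), and its Schur function
    alone has every monomial with sum \<open>n\<close> and exponents at most \<open>N\<close>: write the letters in weakly
    increasing order into a first row of length \<open>N\<close> and a second row (\<open>schur_two_row_pos\<close>).
    To see that it occurs, take tableaux of shapes \<open>lam\<close> and \<open>mu\<close> whose first columns agree in their
    two upper entries, and symmetrize the tensor product of their polytabloids over the stabilizer \<open>H\<close> of a
    tabloid of shape \<open>(N, n - N)\<close>. No cancellation takes place, so the result is a nonzero vector of
    \<open>V\<close> that is fixed by \<open>H\<close>. By the first statement an irreducible constituent with such a vector has
    no nonzero vector that is fixed by a larger symmetric group, and this makes it isomorphic to
    the Specht module of \<open>(N, n - N)\<close> (\<open>isomorphic_if_fixed_vector\<close>).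

  Multiplicities are treated directly. A decomposition into irreducible subspaces exists by
  Maschke's theorem, and the number of summands that are isomorphic to the Specht module of
  \<open>(N, n - N)\<close> is the dimension of the space of vectors in \<open>V\<close> that are fixed by \<open>H\<close>, whatever the
  decomposition (\<open>card_summands_eq_dim_fixed\<close>).\<close>

section \<open>Bihighest weight vectors with a symmetric block\<close>

text \<open>A function of words whose letters are pairs \<open>(i, j)\<close> is an element of the \<open>n\<close>-th
  tensor power of \<open>\<complex>\<^sup>2 \<otimes> \<complex>\<^sup>3\<close>. The assumption
  \<open>symmetric\<close> turns the tensor factors with index in \<open>A\<close> into a symmetric power, that
  is, into polynomials in variables \<open>x\<^bsub>ij\<^esub>\<close>; \<open>l\<close> and \<open>m\<close> are
  the two coordinates of the weight that matter below; the last two assumptions are the equations of highest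
  weight vectors for the first and the second index.\<close>

locale bihighest_weight_vector =
  fixes n l m :: nat and A :: "nat set" and f :: "(nat \<Rightarrow> nat \<times> nat) \<Rightarrow> complex"
  assumes A_subset: "A \<subseteq> {..<n}"
    and symmetric: "\<And>\<sigma> z. \<sigma> permutes A \<Longrightarrow> f (z \<circ> \<sigma>) = f z"
    and letters: "\<And>z q. f z \<noteq> 0 \<Longrightarrow> q < n \<Longrightarrow> z q \<in> {0, 1} \<times> {0, 1, 2}"
    and first_content: "\<And>z. f z \<noteq> 0 \<Longrightarrow> card {q. q < n \<and> fst (z q) = 0} = l"
    and second_content: "\<And>z. f z \<noteq> 0 \<Longrightarrow> card {q. q < n \<and> snd (z q) = 1} = m"
    and raise_first: "\<And>z. (\<Sum>q | q < n \<and> fst (z q) = 0. f (z(q := (1, snd (z q))))) = 0"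
    and raise_second: "\<And>z i j. i < j \<Longrightarrow>
      (\<Sum>q | q < n \<and> snd (z q) = i. f (z(q := (fst (z q), j)))) = 0"
begin

definition depth :: "(nat \<Rightarrow> nat \<times> nat) \<Rightarrow> nat" where
  "depth z = (\<Sum>q\<in>{..<n} - A. fst (z q) + snd (z q))"

text \<open>Raising an index of a letter outside \<open>A\<close> increases the depth. At a word of maximal depth the
  raising equations therefore involve the letters in \<open>A\<close> only.\<close>

definition extremal :: "(nat \<Rightarrow> nat \<times> nat) \<Rightarrow> bool" where
  "extremal z \<longleftrightarrow> (\<forall>z'. f z' \<noteq> 0 \<longrightarrow> depth z' \<le> depth z)"

definition letter_count :: "(nat \<Rightarrow> nat \<times> nat) \<Rightarrow> nat \<times> nat \<Rightarrow> nat" where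
  "letter_count z a = card {q \<in> A. z q = a}"

definition replace_sum :: "(nat \<Rightarrow> nat \<times> nat) \<Rightarrow> nat \<times> nat \<Rightarrow> nat \<times> nat \<Rightarrow> complex" where
  "replace_sum z a b = (\<Sum>q | q \<in> A \<and> z q = a. f (z(q := b)))"

lemma finite_A: "finite A"
  using A_subset finite_subset by blast

lemma extremal_upd [simp]: "p \<in> A \<Longrightarrow> extremal (z(p := a)) = extremal z"
proof -
  assume "p \<in> A"
  then have "depth (z(p := a)) = depth z"
    unfolding depth_def by (intro sum.cong) auto
  then show ?thesis by (simp add: extremal_def)
qed

lemma extremal_upd_outside:
  assumes "extremal z" "q < n" "q \<notin> A" "fst (z q) + snd (z q) < fst a + snd a"
  shows "f (z(q := a)) = 0"
proof -
  have "depth z < depth (z(q := a))"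
    unfolding depth_def using assms by (intro sum_strict_mono_ex1) auto
  then show ?thesis using assms(1) unfolding extremal_def using leD by blast
qed

lemma ex_extremal:
  assumes "f z \<noteq> 0"
  obtains z' where "f z' \<noteq> 0" "extremal z'"
proof -
  have bound: "depth z' \<le> 3 * n" if "f z' \<noteq> 0" for z'
  proof -
    have "depth z' \<le> (\<Sum>q\<in>{..<n} - A. 3)"
      unfolding depth_def using letters[OF that] by (intro sum_mono) force
    also have "\<dots> \<le> 3 * n"
      using card_Diff_subset[OF finite_A A_subset] by simp
    finally show ?thesis .
  qed
  define P where "P d \<longleftrightarrow> (\<exists>z'. f z' \<noteq> 0 \<and> depth z' = d)" for d
  have P: "P (depth z')" if "f z' \<noteq> 0" for z' using that P_def by blast
  have P_le: "d \<le> 3 * n" if "P d" for d using that bound by (auto simp: P_def)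
  have "P (GREATEST d. P d)" using P[OF assms] P_le by (rule GreatestI_nat)
  then obtain z' where z': "f z' \<noteq> 0" "depth z' = (GREATEST d. P d)" by (auto simp: P_def)
  have "depth z'' \<le> depth z'" if "f z'' \<noteq> 0" for z''
    unfolding z'(2) using P[OF that] P_le by (rule Greatest_le_nat)
  then show ?thesis using that z'(1) extremal_def by blast
qed

lemma replace_sum_eq:
  assumes "p \<in> A"
  shows "replace_sum z (z p) b = of_nat (letter_count z (z p)) * f (z(p := b))"
proof -
  have "f (z(q := b)) = f (z(p := b))" if q: "q \<in> A" "z q = z p" for q
  proof -
    have "z(p := b) \<circ> Transposition.transpose p q = z(q := b)"
      using q(2) by (auto simp: fun_eq_iff Transposition.transpose_def)
    moreover have "Transposition.transpose p q permutes A" using assms q(1) by (rule permutes_swap_id)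
    ultimately show ?thesis using symmetric by metis
  qed
  then show ?thesis unfolding replace_sum_def letter_count_def by simp
qed

lemma replace_sum_empty: "(\<And>q. q \<in> A \<Longrightarrow> z q \<noteq> a) \<Longrightarrow> replace_sum z a b = 0"
  unfolding replace_sum_def by (rule sum.neutral) auto

lemma letter_count_pos: "p \<in> A \<Longrightarrow> letter_count z (z p) \<noteq> 0"
  unfolding letter_count_def using finite_A by auto

lemma replace_second:
  assumes z: "extremal z" and ij: "i < j"
  shows "replace_sum z (0, i) (0, j) + replace_sum z (1, i) (1, j) = 0"
proof -
  let ?g = "\<lambda>q. f (z(q := (fst (z q), j)))"
  have "0 = (\<Sum>q | q < n \<and> snd (z q) = i. ?g q)"
    using raise_second[OF ij] by simp
  also have "\<dots> = (\<Sum>q\<in>{q. q \<in> A \<and> z q = (0, i)} \<union> {q. q \<in> A \<and> z q = (1, i)}. ?g q)"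
  proof (rule sum.mono_neutral_right)
    show "\<forall>q\<in>{q. q < n \<and> snd (z q) = i} - ({q. q \<in> A \<and> z q = (0, i)} \<union> {q. q \<in> A \<and> z q = (1, i)}). ?g q = 0"
    proof
      fix q assume q: "q \<in> {q. q < n \<and> snd (z q) = i} - ({q. q \<in> A \<and> z q = (0, i)} \<union> {q. q \<in> A \<and> z q = (1, i)})"
      show "?g q = 0"
      proof (cases "q \<in> A")
        case True
        then have "fst (z q) \<notin> {0, 1}" using q by (cases "z q") auto
        then show ?thesis using letters[of "z(q := (fst (z q), j))" q] q by auto
      next
        case False
        then show ?thesis using extremal_upd_outside[OF z _ False] q ij by auto
      qed
    qed
  qed (use A_subset in auto)
  also have "\<dots> = (\<Sum>q | q \<in> A \<and> z q = (0, i). ?g q) + (\<Sum>q | q \<in> A \<and> z q = (1, i). ?g q)"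
    by (rule sum.union_disjoint) (use finite_A in auto)
  finally show ?thesis unfolding replace_sum_def by simp
qed

lemma replace_first:
  assumes z: "extremal z"
  shows "replace_sum z (0, 0) (1, 0) + replace_sum z (0, 1) (1, 1) + replace_sum z (0, 2) (1, 2) = 0"
proof -
  let ?g = "\<lambda>q. f (z(q := (1, snd (z q))))"
  let ?S = "\<lambda>j. {q. q \<in> A \<and> z q = (0, j)}"
  have "0 = (\<Sum>q | q < n \<and> fst (z q) = 0. ?g q)"
    using raise_first by simp
  also have "\<dots> = (\<Sum>q\<in>?S 0 \<union> ?S 1 \<union> ?S 2. ?g q)"
  proof (rule sum.mono_neutral_right)
    show "\<forall>q\<in>{q. q < n \<and> fst (z q) = 0} - (?S 0 \<union> ?S 1 \<union> ?S 2). ?g q = 0"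
    proof
      fix q assume q: "q \<in> {q. q < n \<and> fst (z q) = 0} - (?S 0 \<union> ?S 1 \<union> ?S 2)"
      show "?g q = 0"
      proof (cases "q \<in> A")
        case True
        then have "snd (z q) \<notin> {0, 1, 2}" using q by (cases "z q") auto
        then show ?thesis using letters[of "z(q := (1, snd (z q)))" q] q by auto
      next
        case False
        then show ?thesis using extremal_upd_outside[OF z _ False] q by auto
      qed
    qed
  qed (use A_subset in auto)
  also have "\<dots> = sum ?g (?S 0) + sum ?g (?S 1) + sum ?g (?S 2)"
    using finite_A by (subst sum.union_disjoint, auto)+
  finally show ?thesis unfolding replace_sum_def by simp
qed

text \<open>On polynomials \<open>p\<close> in the \<open>x\<^bsub>ij\<^esub>\<close> the equations that raise the second
  index from 2 read \<open>D\<^sub>0 p = D\<^sub>1 p = 0\<close> with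
  \<open>D\<^sub>j = x\<^bsub>0j\<^esub> \<partial>\<^bsub>02\<^esub> + x\<^bsub>1j\<^esub> \<partial>\<^bsub>12\<^esub>\<close>.
  Cramer's rule gives
  \<open>x\<^bsub>11\<^esub> D\<^sub>0 - x\<^bsub>10\<^esub> D\<^sub>1 = (x\<^bsub>00\<^esub> x\<^bsub>11\<^esub> - x\<^bsub>01\<^esub> x\<^bsub>10\<^esub>) \<partial>\<^bsub>02\<^esub>\<close>,
  and the minor can be cancelled, so \<open>\<partial>\<^bsub>02\<^esub> p = 0\<close>. The induction on the
  number of letters \<open>(1, 1)\<close> carries out this cancellation on coefficients.\<close>

lemma no_letter_02:
  assumes "extremal z" "p \<in> A" "z p = (0, 2)"
  shows "f z = 0"
  using assms
proof (induction "letter_count z (1, 1)" arbitrary: z p rule: less_induct)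
  case less
  define z' where "z' = z(p := (0, 1))"
  have ext': "extremal z'" and z'p: "z' p = (0, 1)" and z: "z'(p := (0, 2)) = z"
    using less.prems by (auto simp: z'_def)
  have sum1: "of_nat (letter_count z' (0, 1)) * f z + replace_sum z' (1, 1) (1, 2) = 0"
    using replace_second[OF ext', of 1 2] replace_sum_eq[OF less.prems(2), of z' "(0, 2)"] z'p z
    by simp
  have nz1: "letter_count z' (0, 1) \<noteq> 0"
    using letter_count_pos[OF less.prems(2), of z'] z'p by simp
  show ?case
  proof (cases "\<exists>q\<in>A. z' q = (1, 1)")
    case False
    then have "replace_sum z' (1, 1) (1, 2) = 0" by (intro replace_sum_empty) auto
    then show ?thesis using sum1 nz1 by simp
  next
    case True
    then obtain q where q: "q \<in> A" "z' q = (1, 1)" by auto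
    define z1 where "z1 = z'(q := (1, 2))"
    define z1' where "z1' = z'(q := (1, 0))"
    have sum1': "of_nat (letter_count z' (0, 1)) * f z + of_nat (letter_count z' (1, 1)) * f z1 = 0"
      using sum1 replace_sum_eq[OF q(1), of z' "(1, 2)"] q(2) z1_def by simp
    have ext1: "extremal z1'" and z1q: "z1' q = (1, 0)" and z1: "z1'(q := (1, 2)) = z1"
      using ext' q by (auto simp: z1'_def z1_def)
    have sum2: "replace_sum z1' (0, 0) (0, 2) + of_nat (letter_count z1' (1, 0)) * f z1 = 0"
      using replace_second[OF ext1, of 0 2] replace_sum_eq[OF q(1), of z1' "(1, 2)"] z1q z1
      by simp
    have nz2: "letter_count z1' (1, 0) \<noteq> 0"
      using letter_count_pos[OF q(1), of z1'] z1q by simp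
    have "replace_sum z1' (0, 0) (0, 2) = 0"
    proof (cases "\<exists>r\<in>A. z1' r = (0, 0)")
      case False
      then show ?thesis by (intro replace_sum_empty) auto
    next
      case True
      then obtain r where r: "r \<in> A" "z1' r = (0, 0)" by auto
      define z2 where "z2 = z1'(r := (0, 2))"
      have "{s \<in> A. z2 s = (1, 1)} \<subset> {s \<in> A. z s = (1, 1)}"
        using q r less.prems(3) by (auto simp: z2_def z1'_def z'_def split: if_splits)
      then have "letter_count z2 (1, 1) < letter_count z (1, 1)"
        unfolding letter_count_def using finite_A by (intro psubset_card_mono) auto
      moreover have "extremal z2" using ext1 r(1) by (simp add: z2_def)
      ultimately have "f z2 = 0" using less.hyps r(1) by (simp add: z2_def)
      then show ?thesis using replace_sum_eq[OF r(1), of z1' "(0, 2)"] r(2) z2_def by simp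
    qed
    then have "f z1 = 0" using sum2 nz2 by simp
    then show ?thesis using sum1' nz1 by simp
  qed
qed

lemma no_letter_12:
  assumes "extremal z" "p \<in> A" "z p = (1, 2)"
  shows "f z = 0"
proof -
  define z' where "z' = z(p := (1, 1))"
  have ext': "extremal z'" and z'p: "z' p = (1, 1)" and z: "z'(p := (1, 2)) = z"
    using assms by (auto simp: z'_def)
  have sum1: "replace_sum z' (0, 1) (0, 2) + of_nat (letter_count z' (1, 1)) * f z = 0"
    using replace_second[OF ext', of 1 2] replace_sum_eq[OF assms(2), of z' "(1, 2)"] z'p z
    by simp
  have "f (z'(q := (0, 2))) = 0" if "q \<in> A" for q
    using no_letter_02[of "z'(q := (0, 2))" q] that ext' by simp
  then have "replace_sum z' (0, 1) (0, 2) = 0"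
    unfolding replace_sum_def by (intro sum.neutral) auto
  then show ?thesis using sum1 letter_count_pos[OF assms(2), of z'] z'p by simp
qed

text \<open>Without letters of second index 2 the operators are
  \<open>R = x\<^bsub>00\<^esub> \<partial>\<^bsub>10\<^esub> + x\<^bsub>01\<^esub> \<partial>\<^bsub>11\<^esub>\<close>
  for the first index and
  \<open>C = x\<^bsub>00\<^esub> \<partial>\<^bsub>01\<^esub> + x\<^bsub>10\<^esub> \<partial>\<^bsub>11\<^esub>\<close>
  for the second. Since
  \<open>x\<^bsub>01\<^esub> C - x\<^bsub>10\<^esub> R = x\<^bsub>00\<^esub> (x\<^bsub>01\<^esub> \<partial>\<^bsub>01\<^esub> - x\<^bsub>10\<^esub> \<partial>\<^bsub>10\<^esub>)\<close>,
  every monomial of a polynomial that is killed by both has equal degrees in \<open>x\<^bsub>01\<^esub>\<close>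
  and \<open>x\<^bsub>10\<^esub>\<close>.\<close>

lemma letter_counts_01_10:
  assumes z: "extremal z" and nz: "f z \<noteq> 0"
  shows "letter_count z (0, 1) = letter_count z (1, 0)"
proof -
  have col: "\<exists>q\<in>A. z q = (1, 0)" if p: "p \<in> A" "z p = (0, 1)" for p
  proof (rule ccontr)
    assume *: "\<not> (\<exists>q\<in>A. z q = (1, 0))"
    let ?z = "z(p := (0, 0))"
    have "replace_sum ?z (1, 0) (1, 1) = 0" using * by (intro replace_sum_empty) auto
    then show False
      using replace_second[of ?z 0 1] replace_sum_eq[OF p(1), of ?z "(0, 1)"] z p nz
        letter_count_pos[OF p(1), of ?z] fun_upd_triv[of z p] by simp
  qed
  have third: "replace_sum (z(q := (0, 0))) (0, 2) (1, 2) = 0" if "q \<in> A" for q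
  proof -
    have "f (z(q := (0, 0), s := (1, 2))) = 0" if "s \<in> A" for s
      using no_letter_12[of "z(q := (0, 0), s := (1, 2))" s] z that \<open>q \<in> A\<close> by simp
    then show ?thesis unfolding replace_sum_def by (intro sum.neutral) auto
  qed
  have row: "\<exists>p\<in>A. z p = (0, 1)" if q: "q \<in> A" "z q = (1, 0)" for q
  proof (rule ccontr)
    assume *: "\<not> (\<exists>p\<in>A. z p = (0, 1))"
    let ?z = "z(q := (0, 0))"
    have "replace_sum ?z (0, 1) (1, 1) = 0" using * by (intro replace_sum_empty) auto
    then show False
      using replace_first[of ?z] replace_sum_eq[OF q(1), of ?z "(1, 0)"] z q nz third[OF q(1)]
        letter_count_pos[OF q(1), of ?z] fun_upd_triv[of z q] by simp
  qed
  show ?thesis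
  proof (cases "\<exists>p\<in>A. z p = (0, 1)")
    case False
    then have "\<not> (\<exists>q\<in>A. z q = (1, 0))" using row by blast
    then have "{q \<in> A. z q = (0, 1)} = {}" "{q \<in> A. z q = (1, 0)} = {}" using False by auto
    then show ?thesis unfolding letter_count_def by (simp only:)
  next
    case True
    then obtain p where p: "p \<in> A" "z p = (0, 1)" by blast
    then obtain q where q: "q \<in> A" "z q = (1, 0)" using col by blast
    have pq: "p \<noteq> q" using p q by auto
    \<comment> \<open>The word \<open>?g\<close> is the common value of raising a letter in \<open>?p\<close> and in \<open>?q\<close>; comparing its coefficients in the two equations gives the claim.\<close>
    let ?p = "z(p := (0, 0))" and ?q = "z(q := (0, 0))"
    let ?g = "z(p := (0, 0), q := (1, 1))"
    have swap: "f (?q(p := (1, 1))) = f ?g"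
    proof -
      have "?q(p := (1, 1)) = ?g \<circ> Transposition.transpose p q"
        using pq by (auto simp: fun_eq_iff Transposition.transpose_def)
      then show ?thesis using symmetric permutes_swap_id[OF p(1) q(1)] by metis
    qed
    have counts: "letter_count ?p (1, 0) = letter_count z (1, 0)"
      "letter_count ?q (0, 1) = letter_count z (0, 1)"
      unfolding letter_count_def using p q by (auto intro!: arg_cong[where f = card])
    have "letter_count ?p (0, 0) = letter_count ?q (0, 0)"
    proof -
      have "{s \<in> A. ?p s = (0, 0)} = insert p {s \<in> A. z s = (0, 0)}"
        "{s \<in> A. ?q s = (0, 0)} = insert q {s \<in> A. z s = (0, 0)}"
        using p q by auto
      then show ?thesis unfolding letter_count_def using p q finite_A by simp
    qed
    moreover have "of_nat (letter_count ?p (0, 0)) * f z + of_nat (letter_count z (1, 0)) * f ?g = 0"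
      using replace_second[of ?p 0 1] replace_sum_eq[OF p(1), of ?p "(0, 1)"]
        replace_sum_eq[OF q(1), of ?p "(1, 1)"] z p q pq counts fun_upd_triv[of z p] by simp
    moreover have "of_nat (letter_count ?q (0, 0)) * f z + of_nat (letter_count z (0, 1)) * f ?g = 0"
      using replace_first[of ?q] replace_sum_eq[OF q(1), of ?q "(1, 0)"] third[OF q(1)]
        replace_sum_eq[OF p(1), of ?q "(1, 1)"] z p q pq counts fun_upd_triv[of z q] swap by simp
    ultimately have "of_nat (letter_count z (1, 0)) * f ?g = of_nat (letter_count z (0, 1)) * f ?g"
      by (metis add_left_cancel)
    moreover have "f ?g \<noteq> 0"
      using \<open>of_nat (letter_count ?p (0, 0)) * f z + of_nat (letter_count z (1, 0)) * f ?g = 0\<close> nz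
        letter_count_pos[OF p(1), of ?p] by auto
    ultimately show ?thesis by simp
  qed
qed

text \<open>Let \<open>c\<^bsub>ij\<^esub>\<close> be the number of letters \<open>(i, j)\<close> in \<open>A\<close>. At an
  extremal word
  \<open>card A = c\<^bsub>00\<^esub> + c\<^bsub>10\<^esub> + c\<^bsub>01\<^esub> + c\<^bsub>11\<^esub>\<close>,
  while \<open>c\<^bsub>00\<^esub> + c\<^bsub>01\<^esub> \<le> l\<close>,
  \<open>c\<^bsub>01\<^esub> + c\<^bsub>11\<^esub> \<le> m\<close> and
  \<open>c\<^bsub>01\<^esub> = c\<^bsub>10\<^esub>\<close>.\<close>

theorem block_size_le:
  assumes "f z \<noteq> 0"
  shows "card A \<le> l + m"
proof -
  obtain z where nz: "f z \<noteq> 0" and z: "extremal z" using ex_extremal assms by blast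
  let ?S = "\<lambda>a. {q \<in> A. z q = a}"
  have "A \<subseteq> {q. q \<in> A \<and> fst (z q) = 0} \<union> ?S (1, 0) \<union> ?S (1, 1)"
  proof
    fix q assume q: "q \<in> A"
    have "z q \<in> {0, 1} \<times> {0, 1, 2}" using letters[OF nz] q A_subset by auto
    moreover have "z q \<noteq> (1, 2)" using no_letter_12[OF z q] nz by auto
    ultimately show "q \<in> {q. q \<in> A \<and> fst (z q) = 0} \<union> ?S (1, 0) \<union> ?S (1, 1)" using q by auto
  qed
  then have "card A \<le> card ({q. q \<in> A \<and> fst (z q) = 0} \<union> ?S (1, 0) \<union> ?S (1, 1))"
    using finite_A by (intro card_mono) auto
  also have "\<dots> \<le> card {q. q \<in> A \<and> fst (z q) = 0} + card (?S (1, 0)) + card (?S (1, 1))"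
    by (meson add_le_mono card_Un_le le_refl order_trans)
  also have "card (?S (1, 0)) = card (?S (0, 1))"
    using letter_counts_01_10[OF z nz] unfolding letter_count_def by simp
  also have "card {q. q \<in> A \<and> fst (z q) = 0} + card (?S (0, 1)) + card (?S (1, 1))
      = card {q. q \<in> A \<and> fst (z q) = 0} + card (?S (0, 1) \<union> ?S (1, 1))"
    using finite_A by (subst card_Un_disjoint) auto
  also have "card {q. q \<in> A \<and> fst (z q) = 0} \<le> l"
    unfolding first_content[OF nz, symmetric] using A_subset by (intro card_mono) auto
  also have "card (?S (0, 1) \<union> ?S (1, 1)) \<le> m"
    unfolding second_content[OF nz, symmetric] using A_subset by (intro card_mono) auto
  finally show ?thesis by simp
qed

end


section \<open>Representations of the symmetric group on functions\<close>

lemma bij_comp_inv: "bij \<sigma> \<Longrightarrow> \<sigma> \<circ> inv \<sigma> = id"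
  using bij_is_surj surj_iff by blast

lemma bij_inv_comp: "bij \<sigma> \<Longrightarrow> inv \<sigma> \<circ> \<sigma> = id"
  by (simp add: bij_is_inj inv_o_cancel)

lemma finite_sym_perms: "finite (sym_perms n)"
  unfolding sym_perms_def by (intro finite_permutations) simp

lemma sym_perms_comp: "\<sigma> \<in> sym_perms n \<Longrightarrow> \<tau> \<in> sym_perms n \<Longrightarrow> \<sigma> \<circ> \<tau> \<in> sym_perms n"
  unfolding sym_perms_def by (auto intro: permutes_compose)

lemma sym_perms_inv: "\<sigma> \<in> sym_perms n \<Longrightarrow> inv \<sigma> \<in> sym_perms n"
  unfolding sym_perms_def by (auto intro: permutes_inv)

lemma sym_perms_id: "id \<in> sym_perms n"
  unfolding sym_perms_def by (auto intro: permutes_id)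

lemma sym_perms_bij: "\<sigma> \<in> sym_perms n \<Longrightarrow> bij \<sigma>"
  unfolding sym_perms_def by (auto intro: permutes_bij)

lemma sym_perms_less: "\<sigma> \<in> sym_perms n \<Longrightarrow> \<sigma> q < n \<longleftrightarrow> q < n"
  unfolding sym_perms_def using permutes_in_image by fastforce

lemma permutes_sym_perms: "\<sigma> permutes A \<Longrightarrow> A \<subseteq> {..<n} \<Longrightarrow> \<sigma> \<in> sym_perms n"
  unfolding sym_perms_def using permutes_subset by auto

lemma sum_fun_apply: "(\<Sum>i\<in>I. F i) x = (\<Sum>i\<in>I. F i x)"
  by (induction I rule: infinite_finite_induct) auto

lemma sum_fscale: "fscale c (\<Sum>i\<in>I. F i) = (\<Sum>i\<in>I. fscale c (F i))"
  by (simp add: fun_eq_iff fscale_def sum_fun_apply sum_distrib_left)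

locale perm_action =
  fixes a :: "(nat \<Rightarrow> nat) \<Rightarrow> 'x \<Rightarrow> 'x"
  assumes act_id: "a id x = x" and act_comp: "a (\<sigma> \<circ> \<tau>) x = a \<sigma> (a \<tau> x)"
begin

abbreviation rep where "rep \<equiv> function_rep a"

lemma rep_id: "rep id f = f"
  by (simp add: function_rep_def act_id)

lemma rep_comp: "bij \<sigma> \<Longrightarrow> bij \<tau> \<Longrightarrow> rep (\<sigma> \<circ> \<tau>) f = rep \<sigma> (rep \<tau> f)"
  by (simp add: function_rep_def o_inv_distrib act_comp)

lemma rep_inv_left: "bij \<sigma> \<Longrightarrow> rep (inv \<sigma>) (rep \<sigma> f) = f"
  using rep_comp[of "inv \<sigma>" \<sigma> f] by (simp add: bij_imp_bij_inv rep_id bij_inv_comp)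

lemma rep_inv_right: "bij \<sigma> \<Longrightarrow> rep \<sigma> (rep (inv \<sigma>) f) = f"
  using rep_comp[of \<sigma> "inv \<sigma>" f]
  by (simp add: bij_imp_bij_inv rep_id bij_comp_inv)

lemma rep_zero: "rep \<sigma> 0 = 0"
  and rep_add: "rep \<sigma> (f + g) = rep \<sigma> f + rep \<sigma> g"
  and rep_scale: "rep \<sigma> (fscale c f) = fscale c (rep \<sigma> f)"
  and rep_sum: "rep \<sigma> (\<Sum>i\<in>I. F i) = (\<Sum>i\<in>I. rep \<sigma> (F i))"
  by (simp_all add: function_rep_def fscale_def fun_eq_iff sum_fun_apply)

lemma rep_sum_invariant:
  assumes "finite Q" "\<And>g. g \<in> Q \<Longrightarrow> bij g" "bij h" "\<And>g. g \<in> Q \<Longrightarrow> h \<circ> g \<in> Q"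
  shows "rep h (\<Sum>g\<in>Q. rep g f) = (\<Sum>g\<in>Q. rep g f)"
proof -
  have inj: "inj_on ((\<circ>) h) Q"
    using fun.inj_map[OF bij_is_inj[OF assms(3)]] by (rule inj_on_subset) simp
  then have "(\<circ>) h ` Q = Q"
    using assms(1,4) by (intro endo_inj_surj) auto
  then have "(\<Sum>g\<in>Q. rep g f) = (\<Sum>g\<in>Q. rep (h \<circ> g) f)"
    using sum.reindex[OF inj, of "\<lambda>g. rep g f"] by simp
  also have "\<dots> = rep h (\<Sum>g\<in>Q. rep g f)"
    using assms by (simp add: rep_sum rep_comp)
  finally show ?thesis by simp
qed

definition fixed_vectors :: "(nat \<Rightarrow> nat) set \<Rightarrow> ('x \<Rightarrow> complex) set \<Rightarrow> ('x \<Rightarrow> complex) set" where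
  "fixed_vectors H V = {v \<in> V. \<forall>h\<in>H. rep h v = v}"

lemma subspace_fixed_vectors: "cfun.subspace V \<Longrightarrow> cfun.subspace (fixed_vectors H V)"
  unfolding cfun.subspace_def fixed_vectors_def by (auto simp: rep_zero rep_add rep_scale)

lemma invariant_subspaceD:
  assumes "invariant_subspace (sym_perms n) rep V"
  shows "cfun.subspace V" "\<sigma> \<in> sym_perms n \<Longrightarrow> v \<in> V \<Longrightarrow> rep \<sigma> v \<in> V"
  using assms by (auto simp: invariant_subspace_def)

lemma invariant_subspace_span:
  assumes "\<And>\<sigma> v. \<sigma> \<in> sym_perms n \<Longrightarrow> v \<in> B \<Longrightarrow> rep \<sigma> v \<in> cfun.span B"
  shows "invariant_subspace (sym_perms n) rep (cfun.span B)"
  unfolding invariant_subspace_def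
proof (intro conjI ballI)
  fix \<sigma> w assume s: "\<sigma> \<in> sym_perms n" and "w \<in> cfun.span B"
  from this(2) show "rep \<sigma> w \<in> cfun.span B"
  proof (induction rule: cfun.span_induct_alt)
    case base
    then show ?case by (simp only: rep_zero cfun.span_zero)
  next
    case (step c x y)
    then show ?case
      unfolding rep_add rep_scale using assms[OF s]
      by (intro cfun.span_add cfun.span_scale) auto
  qed
qed simp

text \<open>Maschke's theorem: averaging a linear projection onto \<open>U\<close> over the group makes it equivariant, and
  the complement is its kernel in \<open>V\<close>.\<close>

lemma invariant_complement:
  assumes V: "invariant_subspace (sym_perms n) rep V"
    and U: "invariant_subspace (sym_perms n) rep U" and UV: "U \<subseteq> V"
  obtains U' where "invariant_subspace (sym_perms n) rep U'" "U' \<subseteq> V" "U \<inter> U' = {0}"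
    "\<And>v. v \<in> V \<Longrightarrow> \<exists>u\<in>U. \<exists>u'\<in>U'. v = u + u'"
proof -
  let ?G = "sym_perms n"
  interpret vs: vector_space_pair "fscale :: complex \<Rightarrow> ('x \<Rightarrow> complex) \<Rightarrow> _" "fscale :: complex \<Rightarrow> ('x \<Rightarrow> complex) \<Rightarrow> _"
    by unfold_locales
  have subU: "cfun.subspace U" and subV: "cfun.subspace V"
    using U V by (auto dest: invariant_subspaceD(1))
  obtain \<pi> where \<pi>: "range \<pi> \<subseteq> U" "Vector_Spaces.linear fscale fscale \<pi>" "\<forall>v\<in>U. \<pi> v = v"
    using vs.linear_exists_left_inverse_on[OF cfun.linear_id subU] by auto
  interpret \<pi>: Vector_Spaces.linear fscale fscale \<pi> by (rule \<pi>(2))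
  define p where "p v = fscale (1 / of_nat (card ?G)) (\<Sum>g\<in>?G. rep g (\<pi> (rep (inv g) v)))" for v
  have card: "of_nat (card ?G) \<noteq> (0::complex)"
    using finite_sym_perms sym_perms_id by auto
  have p_add: "p (v + w) = p v + p w" for v w
    unfolding p_def by (simp add: rep_add \<pi>.add sum.distrib cfun.scale_right_distrib)
  have p_scale: "p (fscale c v) = fscale c (p v)" for c v
    unfolding p_def by (simp add: rep_scale \<pi>.scale sum_fscale mult.commute)
  have p_mem: "p v \<in> U" for v
    unfolding p_def using \<pi>(1) U
    by (intro cfun.subspace_scale[OF subU] cfun.subspace_sum[OF subU]) (auto intro: invariant_subspaceD(2))
  have p_id: "p u = u" if "u \<in> U" for u
  proof -
    have "rep g (\<pi> (rep (inv g) u)) = u" if "g \<in> ?G" for g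
      using \<pi>(3) invariant_subspaceD(2)[OF U sym_perms_inv[OF that] \<open>u \<in> U\<close>]
        rep_inv_right[OF sym_perms_bij[OF that]] by simp
    then have "p u = fscale (1 / of_nat (card ?G)) (\<Sum>g\<in>?G. u)" by (simp add: p_def)
    also have "\<dots> = u" using card by (simp add: fun_eq_iff fscale_def sum_fun_apply)
    finally show ?thesis .
  qed
  have p_rep: "p (rep h v) = rep h (p v)" if h: "h \<in> ?G" for h v
  proof -
    have *: "rep (h \<circ> g) (\<pi> (rep (inv (h \<circ> g)) (rep h v))) = rep h (rep g (\<pi> (rep (inv g) v)))"
      if g: "g \<in> ?G" for g
    proof -
      have b: "bij h" "bij g" using g h by (auto intro: sym_perms_bij)
      have "rep (inv (h \<circ> g)) (rep h v) = rep (inv g) v"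
        using b by (simp add: o_inv_distrib rep_comp bij_imp_bij_inv rep_inv_left)
      then show ?thesis using b by (simp add: rep_comp)
    qed
    have "(\<Sum>g\<in>?G. rep g (\<pi> (rep (inv g) (rep h v))))
        = (\<Sum>g\<in>?G. rep (h \<circ> g) (\<pi> (rep (inv (h \<circ> g)) (rep h v))))"
      using h by (intro sum.reindex_bij_witness[of _ "\<lambda>g. h \<circ> g" "\<lambda>g. inv h \<circ> g"])
        (auto simp: sym_perms_comp sym_perms_inv o_assoc bij_inv_comp bij_comp_inv sym_perms_bij)
    also have "\<dots> = (\<Sum>g\<in>?G. rep h (rep g (\<pi> (rep (inv g) v))))"
      using * by (intro sum.cong) auto
    finally show ?thesis by (simp add: p_def rep_scale rep_sum)
  qed
  have p0: "p 0 = 0" using p_scale[of 0 0] by simp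
  show ?thesis
  proof
    show "invariant_subspace ?G rep {v \<in> V. p v = 0}"
      unfolding invariant_subspace_def cfun.subspace_def
      using subV V p_add p_scale p_rep p0
      by (auto simp: rep_zero cfun.subspace_def invariant_subspaceD(2)[OF V])
    show "U \<inter> {v \<in> V. p v = 0} = {0}"
      using p_id cfun.subspace_0[OF subU] UV p0 by auto
    fix v assume v: "v \<in> V"
    have "p (v - p v) = 0"
      using p_add[of "v - p v" "p v"] p_id[OF p_mem] by simp
    moreover have "v - p v \<in> V" using v p_mem UV by (intro cfun.subspace_diff[OF subV]) auto
    ultimately show "\<exists>u\<in>U. \<exists>u'\<in>{v \<in> V. p v = 0}. v = u + u'"
      using p_mem[of v] by (intro bexI[of _ "p v"] bexI[of _ "v - p v"]) auto
  qed simp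
qed


lemma irreducible_repD:
  assumes "irreducible_rep (sym_perms n) rep W"
  shows "invariant_subspace (sym_perms n) rep W" "cfun.subspace W" "W \<noteq> {0}"
    "invariant_subspace (sym_perms n) rep U \<Longrightarrow> U \<subseteq> W \<Longrightarrow> U = {0} \<or> U = W"
  using assms by (auto simp: irreducible_rep_def invariant_subspace_def)

text \<open>The bijection in the definition of a decomposition, in terms of families that are not required to be
  extensional: an internal direct sum is one in which 0 has only the trivial representation.\<close>

lemma irreducible_decomposition_iff:
  "irreducible_decomposition (sym_perms n) rep V d W \<longleftrightarrow>
    (\<forall>i<d. irreducible_rep (sym_perms n) rep (W i)) \<and>
    (\<forall>w. (\<forall>i<d. w i \<in> W i) \<longrightarrow> (\<Sum>i<d. w i) \<in> V) \<and>
    (\<forall>v\<in>V. \<exists>w. (\<forall>i<d. w i \<in> W i) \<and> v = (\<Sum>i<d. w i)) \<and>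
    (\<forall>w. (\<forall>i<d. w i \<in> W i) \<longrightarrow> (\<Sum>i<d. w i) = 0 \<longrightarrow> (\<forall>i<d. w i = 0))"
  (is "?L \<longleftrightarrow> ?irr \<and> ?into \<and> ?onto \<and> ?indep")
proof -
  let ?s = "\<lambda>w. \<Sum>i<d. w i :: 'x \<Rightarrow> complex"
  have restr: "?s (restrict w {..<d}) = ?s w" for w by (intro sum.cong) auto
  have restr_PiE: "restrict w {..<d} \<in> PiE {..<d} W \<longleftrightarrow> (\<forall>i<d. w i \<in> W i)" for w by auto
  have image: "?s ` PiE {..<d} W = {?s w | w. \<forall>i<d. w i \<in> W i}"
  proof (intro equalityI subsetI)
    fix v assume "v \<in> {?s w | w. \<forall>i<d. w i \<in> W i}"
    then obtain w where "v = ?s w" "\<forall>i<d. w i \<in> W i" by auto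
    then show "v \<in> ?s ` PiE {..<d} W"
      using restr[of w] restr_PiE[of w] by (intro image_eqI[of _ _ "restrict w {..<d}"]) auto
  qed auto
  have inj: "inj_on ?s (PiE {..<d} W) \<longleftrightarrow> ?indep" if irr: ?irr
  proof
    have zero: "0 \<in> W i" if "i < d" for i
      using irr that irreducible_repD(2) cfun.subspace_0 by blast
    assume inj: "inj_on ?s (PiE {..<d} W)"
    show ?indep
    proof (intro allI impI)
      fix w i assume w: "\<forall>i<d. w i \<in> W i" "?s w = 0" and i: "i < d"
      have "restrict w {..<d} = restrict (\<lambda>_. 0) {..<d}"
        using w zero restr by (intro inj_onD[OF inj]) auto
      then show "w i = 0" using i by (metis lessThan_iff restrict_apply')
    qed
  next
    assume indep: ?indep
    show "inj_on ?s (PiE {..<d} W)"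
    proof (rule inj_onI)
      fix w w' assume w: "w \<in> PiE {..<d} W" "w' \<in> PiE {..<d} W" "?s w = ?s w'"
      have "\<forall>i<d. w i - w' i \<in> W i"
        using irr w irreducible_repD(2) cfun.subspace_diff by blast
      moreover have "(\<Sum>i<d. w i - w' i) = 0" using w(3) by (simp add: sum_subtractf)
      ultimately have "\<forall>i<d. w i - w' i = 0" using indep by (elim allE[of _ "\<lambda>i. w i - w' i"]) blast
      then show "w = w'" using w by (intro PiE_ext[OF w(1,2)]) auto
    qed
  qed
  have "{?s w | w. \<forall>i<d. w i \<in> W i} = V \<longleftrightarrow> ?into \<and> ?onto" by blast
  then have "?L \<longleftrightarrow> ?irr \<and> inj_on ?s (PiE {..<d} W) \<and> ?into \<and> ?onto"
    by (simp only: irreducible_decomposition_def bij_betw_def image)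
  then show ?thesis using inj by argo
qed

lemma irreducible_decompositionD:
  assumes "irreducible_decomposition (sym_perms n) rep V d W"
  shows "i < d \<Longrightarrow> irreducible_rep (sym_perms n) rep (W i)"
    and "(\<And>i. i < d \<Longrightarrow> w i \<in> W i) \<Longrightarrow> (\<Sum>i<d. w i) \<in> V"
    and "v \<in> V \<Longrightarrow> \<exists>w. (\<forall>i<d. w i \<in> W i) \<and> v = (\<Sum>i<d. w i)"
    and "(\<And>i. i < d \<Longrightarrow> w i \<in> W i) \<Longrightarrow> (\<Sum>i<d. w i) = 0 \<Longrightarrow> i < d \<Longrightarrow> w i = 0"
proof -
  note dec = irreducible_decomposition_iff[THEN iffD1, OF assms]
  note dec1 = conjunct1[OF dec] and dec2 = conjunct1[OF conjunct2[OF dec]]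
    and dec3 = conjunct1[OF conjunct2[OF conjunct2[OF dec]]]
    and dec4 = conjunct2[OF conjunct2[OF conjunct2[OF dec]]]
  show "irreducible_rep (sym_perms n) rep (W i)" if "i < d" using dec1 that by simp
  show "(\<Sum>i<d. w i) \<in> V" if "\<And>i. i < d \<Longrightarrow> w i \<in> W i" using dec2 that by simp
  show "\<exists>w. (\<forall>i<d. w i \<in> W i) \<and> v = (\<Sum>i<d. w i)" if "v \<in> V" using dec3 that by (rule bspec)
  show "w i = 0" if "\<And>i. i < d \<Longrightarrow> w i \<in> W i" "(\<Sum>i<d. w i) = 0" "i < d"
    using dec4[THEN spec[of _ w]] that by simp
qed

lemma irreducible_decomposition_append:
  assumes dec: "irreducible_decomposition (sym_perms n) rep V' d W"
    and U: "irreducible_rep (sym_perms n) rep U"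
    and V: "cfun.subspace V" "U \<subseteq> V" "V' \<subseteq> V" "U \<inter> V' = {0}"
      "\<And>v. v \<in> V \<Longrightarrow> \<exists>u\<in>U. \<exists>u'\<in>V'. v = u + u'"
  shows "irreducible_decomposition (sym_perms n) rep V (Suc d) (W(d := U))"
proof -
  note decD = irreducible_decompositionD[OF dec]
  have subU: "cfun.subspace U" using irreducible_repD(2)[OF U] .
  show ?thesis
    unfolding irreducible_decomposition_iff
  proof (intro conjI allI impI ballI)
    show "irreducible_rep (sym_perms n) rep ((W(d := U)) i)" if "i < Suc d" for i
      using that decD(1) U by (auto simp: less_Suc_eq)
    fix w assume w: "\<forall>i<Suc d. w i \<in> (W(d := U)) i"
    then have wU: "w d \<in> U" and wW: "\<forall>i<d. w i \<in> W i" by (auto simp: less_Suc_eq)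
    have sumV': "(\<Sum>i<d. w i) \<in> V'" using wW decD(2) by simp
    show "(\<Sum>i<Suc d. w i) \<in> V"
      using wU sumV' V(2,3) cfun.subspace_add[OF V(1)] by auto
    fix i assume sum: "(\<Sum>i<Suc d. w i) = 0" and i: "i < Suc d"
    then have "(\<Sum>i<d. w i) = - w d" by (simp add: eq_neg_iff_add_eq_0)
    then have "(\<Sum>i<d. w i) \<in> U" using wU cfun.subspace_neg[OF subU] by simp
    then have sum0: "(\<Sum>i<d. w i) = 0" using sumV' V(4) by blast
    have "w i = 0" if "i < d" for i
      by (rule decD(4)[OF _ sum0 that]) (use wW in blast)
    moreover have "w d = 0" using sum sum0 by simp
    ultimately show "w i = 0" using i by (auto simp: less_Suc_eq)
  next
    fix v assume "v \<in> V"
    then obtain u u' where u: "u \<in> U" "u' \<in> V'" "v = u + u'" using V(5) by blast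
    then obtain w where w: "\<forall>i<d. w i \<in> W i" "u' = (\<Sum>i<d. w i)"
      using decD(3) by blast
    then show "\<exists>w. (\<forall>i<Suc d. w i \<in> (W(d := U)) i) \<and> v = (\<Sum>i<Suc d. w i)"
      using u by (intro exI[of _ "w(d := u)"]) (auto simp: less_Suc_eq add.commute)
  qed
qed

text \<open>The ambient space of functions may have infinite dimension, where monotonicity of \<open>dim\<close> can fail;
  hence the finite spanning set.\<close>

lemma dim_psubset:
  assumes U: "cfun.subspace U" "U \<subset> V" and V: "V \<subseteq> cfun.span B" "finite B"
  shows "cfun.dim U < cfun.dim (V :: ('x \<Rightarrow> complex) set)"
proof -
  obtain C where C: "C \<subseteq> U" "cfun.independent C" "U \<subseteq> cfun.span C" "card C = cfun.dim U"
    by (rule cfun.basis_exists)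
  obtain D where D: "D \<subseteq> V" "cfun.independent D" "V \<subseteq> cfun.span D" "card D = cfun.dim V"
    by (rule cfun.basis_exists)
  have fin: "finite D" "finite C"
    using cfun.independent_span_bound[OF V(2)] C(1,2) D(1,2) U(2) V(1) by blast+
  obtain v where v: "v \<in> V" "v \<notin> U" using U(2) by blast
  have "v \<notin> cfun.span C" using v(2) cfun.span_minimal[OF C(1) U(1)] by blast
  then have "cfun.independent (insert v C)" using C(2) by (rule cfun.independent_insertI)
  moreover have "insert v C \<subseteq> cfun.span D" using v C(1) U(2) D(3) by blast
  ultimately have "card (insert v C) \<le> card D" using cfun.independent_span_bound[OF fin(1)] by blast
  moreover have "v \<notin> C" using v C(1) by blast
  ultimately show ?thesis using fin C(4) D(4) by simp
qed

text \<open>A nonzero invariant subspace of minimal dimension is irreducible; split it off and repeat with an invariant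
  complement.\<close>

lemma ex_irreducible_decomposition:
  assumes "invariant_subspace (sym_perms n) rep V" "V \<subseteq> cfun.span B" "finite B"
  shows "\<exists>d W. irreducible_decomposition (sym_perms n) rep V d W"
  using assms
proof (induction "cfun.dim V" arbitrary: V rule: less_induct)
  case less
  let ?inv = "invariant_subspace (sym_perms n) rep"
  have subV: "cfun.subspace V" using less.prems(1) by (rule invariant_subspaceD)
  show ?case
  proof (cases "V = {0}")
    case True
    then have "irreducible_decomposition (sym_perms n) rep V 0 (\<lambda>_. V)"
      by (simp add: irreducible_decomposition_def bij_betw_def)
    then show ?thesis by blast
  next
    case False
    define P where "P U \<longleftrightarrow> ?inv U \<and> U \<subseteq> V \<and> U \<noteq> {0}" for U
    have "P V" using False less.prems P_def by blast
    then obtain U where U: "P U" "\<And>U'. P U' \<Longrightarrow> cfun.dim U \<le> cfun.dim U'"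
      using ex_has_least_nat[of P V cfun.dim] by blast
    have irr: "irreducible_rep (sym_perms n) rep U"
      unfolding irreducible_rep_def
    proof (intro conjI allI impI)
      fix U' assume U': "?inv U' \<and> U' \<subseteq> U"
      show "U' = {0} \<or> U' = U"
      proof (rule ccontr)
        assume *: "\<not> (U' = {0} \<or> U' = U)"
        then have "P U'" using U' U(1) by (auto simp: P_def)
        moreover have "cfun.dim U' < cfun.dim U"
          using U' U(1) * less.prems(2,3)
          by (intro dim_psubset[where B = B]) (auto simp: P_def dest: invariant_subspaceD(1))
        ultimately show False using U(2) leD by blast
      qed
    qed (use U(1) P_def in auto)
    obtain V' where V': "?inv V'" "V' \<subseteq> V" "U \<inter> V' = {0}"
      "\<And>v. v \<in> V \<Longrightarrow> \<exists>u\<in>U. \<exists>u'\<in>V'. v = u + u'"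
      using invariant_complement[OF less.prems(1), of U] U(1) P_def by metis
    have "0 \<in> U" using irr irreducible_repD(2) cfun.subspace_0 by blast
    then have "V' \<noteq> V" using U(1) V'(3) by (auto simp: P_def)
    then have "cfun.dim V' < cfun.dim V"
      using V'(1,2) less.prems(2,3) invariant_subspaceD(1) by (intro dim_psubset[where B = B]) auto
    then obtain d W where "irreducible_decomposition (sym_perms n) rep V' d W"
      using less.hyps[of V'] V'(1,2) less.prems(2,3) by blast
    then have "irreducible_decomposition (sym_perms n) rep V (Suc d) (W(d := U))"
      using irr subV V' U(1) by (intro irreducible_decomposition_append) (auto simp: P_def)
    then show ?thesis by blast
  qed
qed

text \<open>The multiplicity is a definite description. It denotes \<open>m\<close> once every decomposition gives the count
  \<open>m\<close>, because there is at least one decomposition.\<close>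

lemma multiplicity_in_eqI:
  assumes "invariant_subspace (sym_perms n) rep V" "V \<subseteq> cfun.span B" "finite B"
    and "\<And>d W. irreducible_decomposition (sym_perms n) rep V d W \<Longrightarrow>
      card {i. i < d \<and> isomorphic_reps (sym_perms n) \<rho>' U rep (W i)} = m"
  shows "multiplicity_in (sym_perms n) \<rho>' U rep V = m"
  unfolding multiplicity_in_def
  using ex_irreducible_decomposition[OF assms(1-3)] assms(4) by (intro the_equality) blast+

lemma irreducible_decomposition_subset:
  assumes "irreducible_decomposition (sym_perms n) rep V d W" "i < d"
  shows "W i \<subseteq> V"
proof
  fix v assume v: "v \<in> W i"
  note decD = irreducible_decompositionD[OF assms(1)]
  have "0 \<in> W j" if "j < d" for j
    using decD(1) that irreducible_repD(2) cfun.subspace_0 by blast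
  then have "(\<Sum>j<d. if j = i then v else 0) \<in> V" using v by (intro decD(2)) auto
  then show "v \<in> V" using assms(2) by simp
qed

text \<open>The components of a fixed vector are fixed, so the fixed vectors of \<open>V\<close> are the direct sum of those
  of the summands. If a fixed line distinguishes the summands of one kind, then their number is seen to be
  independent of the decomposition.\<close>

lemma card_summands_eq_dim_fixed:
  assumes dec: "irreducible_decomposition (sym_perms n) rep V d W" and H: "H \<subseteq> sym_perms n"
    and V: "cfun.subspace V"
    and P: "\<And>i. i < d \<Longrightarrow> P i \<Longrightarrow> \<exists>u. u \<noteq> 0 \<and> fixed_vectors H (W i) = cfun.span {u}"
    and not_P: "\<And>i. i < d \<Longrightarrow> \<not> P i \<Longrightarrow> fixed_vectors H (W i) \<subseteq> {0}"
  shows "card {i. i < d \<and> P i} = cfun.dim (fixed_vectors H V)"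
proof -
  let ?J = "{i. i < d \<and> P i}"
  note decD = irreducible_decompositionD[OF dec]
  have sub: "cfun.subspace (W i)" if "i < d" for i using decD(1) that irreducible_repD(2) by blast
  have "\<forall>i\<in>?J. \<exists>u. u \<noteq> 0 \<and> fixed_vectors H (W i) = cfun.span {u}" using P by blast
  then obtain u where u: "\<And>i. i \<in> ?J \<Longrightarrow> u i \<noteq> 0 \<and> fixed_vectors H (W i) = cfun.span {u i}"
    by metis
  have u_fixed: "u i \<in> fixed_vectors H (W i)" if "i \<in> ?J" for i
    using u[OF that] by (simp add: cfun.span_base)
  have u_W: "u i \<in> W i" if "i \<in> ?J" for i using u_fixed[OF that] by (simp add: fixed_vectors_def)
  have coeff: "c i = 0" if sum: "(\<Sum>i\<in>?J. fscale (c i) (u i)) = 0" and i: "i \<in> ?J" for c i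
  proof -
    let ?w = "\<lambda>i. if P i then fscale (c i) (u i) else 0"
    have "(\<Sum>i<d. ?w i) = (\<Sum>i\<in>?J. fscale (c i) (u i))"
      by (rule sum.mono_neutral_cong_right) auto
    moreover have "\<forall>i<d. ?w i \<in> W i"
      using u_W sub by (auto intro: cfun.subspace_0 cfun.subspace_scale)
    ultimately have "?w i = 0" using decD(4)[of ?w i] sum i by simp
    then have "fscale (c i) (u i) = 0" using i by auto
    then show ?thesis using u[OF i] cfun.scale_eq_0_iff by blast
  qed
  have inj: "inj_on u ?J"
  proof (rule inj_onI, rule ccontr)
    fix i j assume ij: "i \<in> ?J" "j \<in> ?J" "u i = u j" "i \<noteq> j"
    \<comment> \<open>A vector common to two summands would give a nontrivial representation of 0.\<close>
    let ?c = "\<lambda>k. if k = i then 1 else if k = j then - 1 else 0"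
    have "(\<Sum>k\<in>?J. fscale (?c k) (u k)) = (\<Sum>k\<in>{i, j}. fscale (?c k) (u k))"
      using ij by (intro sum.mono_neutral_right) auto
    also have "\<dots> = 0" using ij by (simp add: fun_eq_iff fscale_def)
    finally show False using coeff[of ?c i] ij by simp
  qed
  have "cfun.independent (u ` ?J)"
  proof (rule cfun.independent_if_scalars_zero)
    fix c x assume c: "(\<Sum>x\<in>u ` ?J. fscale (c x) x) = 0" and x: "x \<in> u ` ?J"
    have "(\<Sum>i\<in>?J. fscale (c (u i)) (u i)) = 0" 
      using c unfolding sum.reindex[OF inj] o_def .
    then show "c x = 0" using coeff[of "\<lambda>i. c (u i)"] x by blast
  qed simp
  moreover have "u ` ?J \<subseteq> fixed_vectors H V"
    using u_fixed irreducible_decomposition_subset[OF dec] by (auto simp: fixed_vectors_def)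
  moreover have "fixed_vectors H V \<subseteq> cfun.span (u ` ?J)"
  proof
    fix v assume v: "v \<in> fixed_vectors H V"
    then obtain w where w: "\<forall>i<d. w i \<in> W i" "v = (\<Sum>i<d. w i)"
      using decD(3)[of v] by (auto simp: fixed_vectors_def)
    have fix_w: "w i \<in> fixed_vectors H (W i)" if i: "i < d" for i
      unfolding fixed_vectors_def
    proof (intro CollectI conjI ballI)
      fix h assume h: "h \<in> H"
      have "rep h (w j) - w j \<in> W j" if "j < d" for j
      proof -
        have "rep h (w j) \<in> W j"
          using invariant_subspaceD(2)[OF irreducible_repD(1)[OF decD(1)[OF that]]] w(1) h H that
          by blast
        then show ?thesis using cfun.subspace_diff[OF sub[OF that]] w(1) that by blast
      qed
      moreover have "(\<Sum>j<d. rep h (w j) - w j) = 0"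
        using v h w(2) by (simp add: fixed_vectors_def sum_subtractf rep_sum)
      ultimately show "rep h (w i) = w i" 
        using decD(4)[of "\<lambda>j. rep h (w j) - w j" i] i by simp
    qed (use w i in auto)
    have "w i \<in> cfun.span (u ` ?J)" if i: "i < d" for i
    proof (cases "P i")
      case True
      then have "w i \<in> cfun.span {u i}" using fix_w[OF i] u i by blast
      then show ?thesis using True i cfun.span_mono[of "{u i}" "u ` ?J"] by blast
    next
      case False
      then have "w i = 0" using fix_w[OF i] not_P[OF i] by blast
      then show ?thesis by (simp only: cfun.span_zero)
    qed
    then show "v \<in> cfun.span (u ` ?J)" unfolding w(2) by (intro cfun.span_sum) auto
  qed
  ultimately show ?thesis
    using cfun.dim_unique card_image[OF inj] by metis
qed

end


section \<open>Tabloids as words\<close>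

text \<open>A tabloid is encoded by the word that gives for each entry the row in which it lies. Words with the same
  restriction to \<open>{..<n}\<close> encode the same tabloid.\<close>

definition word_tabloid :: "nat \<Rightarrow> (nat \<Rightarrow> nat) \<Rightarrow> nat \<Rightarrow> nat set" where
  "word_tabloid n x = (\<lambda>r. {q. q < n \<and> x q = r})"

definition has_content :: "nat \<Rightarrow> nat list \<Rightarrow> (nat \<Rightarrow> nat) \<Rightarrow> bool" where
  "has_content n p x \<longleftrightarrow> (\<forall>r. card {q. q < n \<and> x q = r} = nth_part p r)"

definition row_word :: "nat list \<Rightarrow> (nat \<times> nat \<Rightarrow> nat) \<Rightarrow> nat \<Rightarrow> nat" where
  "row_word p T q = fst (inv_into (diagram p) T q)"

text \<open>Words with letters \<open>0, \<dots>, d - 1\<close> are a basis of the \<open>n\<close>-th tensor power of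
  \<open>\<complex>\<^sup>d\<close>, on which \<open>gl_d\<close> acts. The sum in the definition is the
  coefficient at \<open>x\<close> of the image of \<open>f\<close> under the raising operator that changes one
  letter \<open>j\<close> into \<open>i\<close>, and \<open>p\<close> is the weight of \<open>f\<close>.\<close>

definition highest_weight_space :: "nat \<Rightarrow> nat list \<Rightarrow> ((nat \<Rightarrow> nat set) \<Rightarrow> complex) set" where
  "highest_weight_space n p = {f.
     (\<forall>t. f t \<noteq> 0 \<longrightarrow> (\<exists>x. has_content n p x \<and> t = word_tabloid n x)) \<and>
     (\<forall>i j x. i < j \<longrightarrow> (\<Sum>q | q < n \<and> x q = i. f (word_tabloid n (x(q := j)))) = 0)}"

global_interpretation tabl: perm_action tabloid_action
  by unfold_locales (auto simp: tabloid_action_def fun_eq_iff)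

global_interpretation pairs: perm_action "pair_action tabloid_action tabloid_action"
  by unfold_locales (auto simp: pair_action_def tabl.act_id tabl.act_comp)

lemma word_tabloid_eq_iff: "word_tabloid n x = word_tabloid n y \<longleftrightarrow> (\<forall>q<n. x q = y q)"
  unfolding word_tabloid_def by (auto simp: fun_eq_iff set_eq_iff)

lemma tabloid_action_word:
  assumes "\<sigma> \<in> sym_perms n"
  shows "tabloid_action \<sigma> (word_tabloid n x) = word_tabloid n (x \<circ> inv \<sigma>)"
proof (intro ext set_eqI)
  note b = sym_perms_bij[OF assms]
  have i: "inv \<sigma> (\<sigma> q) = q" "\<sigma> (inv \<sigma> q) = q" for q
    using b by (simp_all add: bij_is_inj bij_is_surj surj_f_inv_f)
  have l: "inv \<sigma> q < n \<longleftrightarrow> q < n" for q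
    using sym_perms_less[OF sym_perms_inv[OF assms]] .
  fix r q
  have "q \<in> \<sigma> ` S \<longleftrightarrow> inv \<sigma> q \<in> S" for S using i by (metis image_iff)
  then show "q \<in> tabloid_action \<sigma> (word_tabloid n x) r \<longleftrightarrow> q \<in> word_tabloid n (x \<circ> inv \<sigma>) r"
    using l by (simp add: tabloid_action_def word_tabloid_def)
qed

lemma inv_inv_sym_perms: "\<sigma> \<in> sym_perms n \<Longrightarrow> inv (inv \<sigma>) = \<sigma>"
  by (rule inv_inv_eq[OF sym_perms_bij])

lemma tabl_rep_word:
  "\<sigma> \<in> sym_perms n \<Longrightarrow> tabl.rep \<sigma> f (word_tabloid n x) = f (word_tabloid n (x \<circ> \<sigma>))"
  by (simp add: function_rep_def tabloid_action_word sym_perms_inv inv_inv_sym_perms)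

lemma pairs_rep_word:
  "\<sigma> \<in> sym_perms n \<Longrightarrow> pairs.rep \<sigma> f (word_tabloid n x, word_tabloid n y)
    = f (word_tabloid n (x \<circ> \<sigma>), word_tabloid n (y \<circ> \<sigma>))"
  by (simp add: function_rep_def pair_action_def tabloid_action_word sym_perms_inv inv_inv_sym_perms)

lemma card_sym_perms_preimage:
  assumes "\<sigma> \<in> sym_perms n"
  shows "card {q. q < n \<and> P (\<sigma> q)} = card {q. q < n \<and> P q}"
proof (rule bij_betw_same_card[of \<sigma>])
  note b = sym_perms_bij[OF assms]
  show "bij_betw \<sigma> {q. q < n \<and> P (\<sigma> q)} {q. q < n \<and> P q}"
    using b sym_perms_less[OF assms] sym_perms_less[OF sym_perms_inv[OF assms]]
    by (intro bij_betwI[where g = "inv \<sigma>"]) (auto simp: bij_is_inj bij_is_surj surj_f_inv_f)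
qed

lemma has_content_comp: "\<sigma> \<in> sym_perms n \<Longrightarrow> has_content n p x \<Longrightarrow> has_content n p (x \<circ> \<sigma>)"
  unfolding has_content_def using card_sym_perms_preimage[of \<sigma> n "\<lambda>q. x q = r" for r] by simp

lemma subspace_highest_weight_space: "cfun.subspace (highest_weight_space n p)"
  unfolding cfun.subspace_def highest_weight_space_def
proof (intro conjI ballI allI impI CollectI; (elim CollectE conjE)?)
  fix f g t
  assume "\<forall>t. f t \<noteq> 0 \<longrightarrow> (\<exists>x. has_content n p x \<and> t = word_tabloid n x)"
    "\<forall>t. g t \<noteq> 0 \<longrightarrow> (\<exists>x. has_content n p x \<and> t = word_tabloid n x)" "(f + g) t \<noteq> (0::complex)"
  then show "\<exists>x. has_content n p x \<and> t = word_tabloid n x" by (metis add.right_neutral plus_fun_apply)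
qed (auto simp: fscale_def sum.distrib simp flip: sum_distrib_left)

section \<open>Specht modules\<close>

lemma row_word:
  assumes "tableau n p T" "b \<in> diagram p"
  shows "row_word p T (T b) = fst b"
  using assms by (auto simp: row_word_def tableau_def bij_betw_def inv_into_f_f)

lemma tableau_less: "tableau n p T \<Longrightarrow> b \<in> diagram p \<Longrightarrow> T b < n"
  by (auto simp: tableau_def bij_betw_def)

lemma tableau_ex:
  assumes "tableau n p T" "q < n"
  obtains b where "b \<in> diagram p" "T b = q"
  using assms unfolding tableau_def bij_betw_def by (metis imageE lessThan_iff)

lemma row_word_eq_iff:
  assumes T: "tableau n p T" and q: "q < n"
  shows "row_word p T q = r \<longleftrightarrow> (\<exists>c. (r, c) \<in> diagram p \<and> T (r, c) = q)"
proof -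
  obtain b where b: "b \<in> diagram p" "T b = q" using tableau_ex[OF T q] by blast
  show ?thesis using row_word[OF T] b by (metis fst_conv prod.collapse)
qed

lemma row_entries:
  assumes T: "tableau n p T"
  shows "{q. q < n \<and> row_word p T q = r} = (\<lambda>c. T (r, c)) ` {..<nth_part p r}"
proof (rule set_eqI)
  fix q
  have "q < n \<and> row_word p T q = r \<longleftrightarrow> q < n \<and> (\<exists>c. (r, c) \<in> diagram p \<and> T (r, c) = q)"
    using row_word_eq_iff[OF T] by blast
  also have "\<dots> \<longleftrightarrow> (\<exists>c. (r, c) \<in> diagram p \<and> T (r, c) = q)"
    using tableau_less[OF T] by blast
  also have "\<dots> \<longleftrightarrow> q \<in> (\<lambda>c. T (r, c)) ` {..<nth_part p r}"
    by (auto simp: diagram_def)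
  finally show "q \<in> {q. q < n \<and> row_word p T q = r} \<longleftrightarrow> q \<in> (\<lambda>c. T (r, c)) ` {..<nth_part p r}"
    by simp
qed

lemma tabloid_eq_word: "tableau n p T \<Longrightarrow> tabloid p T = word_tabloid n (row_word p T)"
  by (auto simp: tabloid_def word_tabloid_def fun_eq_iff row_entries diagram_def)

lemma has_content_row_word:
  assumes T: "tableau n p T"
  shows "has_content n p (row_word p T)"
  unfolding has_content_def row_entries[OF T]
proof
  fix r
  have "inj_on (\<lambda>c. T (r, c)) {..<nth_part p r}"
    using T by (auto simp: inj_on_def tableau_def bij_betw_def diagram_def)
  then show "card ((\<lambda>c. T (r, c)) ` {..<nth_part p r}) = nth_part p r" by (simp add: card_image)
qed

lemma finite_column_stabilizer: "finite (column_stabilizer n p T)"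
  unfolding column_stabilizer_def using finite_sym_perms by auto

lemma column_stabilizer_sym_perms: "\<sigma> \<in> column_stabilizer n p T \<Longrightarrow> \<sigma> \<in> sym_perms n"
  unfolding column_stabilizer_def by auto

lemma sign_sym_perms_comp:
  "\<sigma> \<in> sym_perms n \<Longrightarrow> \<tau> \<in> sym_perms n \<Longrightarrow> sign (\<sigma> \<circ> \<tau>) = sign \<sigma> * sign \<tau>"
  unfolding sym_perms_def by (simp add: sign_compose permutes_imp_permutation[of "{..<n}"])

lemma polytabloid_word:
  assumes T: "tableau n p T"
  shows "polytabloid n p T (word_tabloid n x) = (\<Sum>\<sigma>\<in>column_stabilizer n p T.
    if \<forall>q<n. x (\<sigma> q) = row_word p T q then of_int (sign \<sigma>) else 0)"
  unfolding polytabloid_def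
proof (intro sum.cong refl)
  fix \<sigma> assume "\<sigma> \<in> column_stabilizer n p T"
  then have s: "\<sigma> \<in> sym_perms n" by (rule column_stabilizer_sym_perms)
  note b = sym_perms_bij[OF s]
  have "word_tabloid n x = tabloid_action \<sigma> (tabloid p T)
      \<longleftrightarrow> (\<forall>q<n. x q = row_word p T (inv \<sigma> q))"
    using s by (simp add: tabloid_eq_word[OF T] tabloid_action_word word_tabloid_eq_iff)
  also have "\<dots> \<longleftrightarrow> (\<forall>q<n. x (\<sigma> q) = row_word p T q)"
    using b sym_perms_less[OF s] sym_perms_less[OF sym_perms_inv[OF s]]
    by (metis bij_inv_eq_iff)
  finally show "(if word_tabloid n x = tabloid_action \<sigma> (tabloid p T) then of_int (sign \<sigma>) else 0)
    = (if \<forall>q<n. x (\<sigma> q) = row_word p T q then of_int (sign \<sigma>) else (0::complex))" by simp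
qed

text \<open>Only the identity preserves both the rows and the columns of a tableau.\<close>

lemma polytabloid_tabloid:
  assumes T: "tableau n p T"
  shows "polytabloid n p T (tabloid p T) = 1"
proof -
  have "\<sigma> = id" if s: "\<sigma> \<in> column_stabilizer n p T"
    and fixed: "\<forall>q<n. row_word p T (\<sigma> q) = row_word p T q" for \<sigma>
  proof
    fix q
    show "\<sigma> q = id q"
    proof (cases "q < n")
      case True
      obtain r c where b: "(r, c) \<in> diagram p" "T (r, c) = q"
        using tableau_ex[OF T True] by (metis prod.collapse)
      obtain r' where r': "(r', c) \<in> diagram p" "\<sigma> q = T (r', c)"
        using s b by (auto simp: column_stabilizer_def)
      have "r' = r" using fixed True row_word[OF T] b r' by (metis fst_conv)
      then show ?thesis using b r' by simp
    next
      case False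
      then show ?thesis
        using column_stabilizer_sym_perms[OF s] by (auto simp: sym_perms_def permutes_def)
    qed
  qed
  then have "polytabloid n p T (tabloid p T)
      = (\<Sum>\<sigma>\<in>column_stabilizer n p T. if \<sigma> = id then 1 else 0)"
    unfolding tabloid_eq_word[OF T] polytabloid_word[OF T]
    by (intro sum.cong) auto
  moreover have "id \<in> column_stabilizer n p T"
    by (auto simp: column_stabilizer_def sym_perms_id)
  ultimately show ?thesis using finite_column_stabilizer by simp
qed

text \<open>The terms of \<open>e\<^sub>T\<close> that are moved to the word \<open>x\<close> are those where the entry
  \<open>\<sigma> (T (j, c))\<close> goes up from row \<open>j\<close> to row \<open>i\<close>. Afterwards
  \<open>\<sigma> (T (i, c))\<close> and \<open>\<sigma> (T (j, c))\<close> lie in the same row, so the result is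
  the same for \<open>\<sigma>\<close> and for its composition with the transposition of \<open>T (i, c)\<close>
  and \<open>T (j, c)\<close>. These two have opposite signs.\<close>

lemma raise_polytabloid:
  assumes T: "tableau n p T" and p: "sorted_wrt (\<ge>) p" and ij: "i < j"
  shows "(\<Sum>q | q < n \<and> x q = i. polytabloid n p T (word_tabloid n (x(q := j)))) = 0"
proof -
  let ?C = "column_stabilizer n p T" and ?y = "row_word p T"
  \<comment> \<open>\<open>ok c \<sigma>\<close>: moving the entry \<open>\<sigma> (T (j, c))\<close> of the tabloid \<open>\<sigma> {T}\<close> to row \<open>i\<close> gives the word \<open>x\<close>.\<close>
  define ok where "ok c \<sigma> \<longleftrightarrow> (\<forall>u<n. x (\<sigma> u) = (if u = T (j, c) then i else ?y u))" for c \<sigma>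
  have inj_T: "T b = T b' \<longleftrightarrow> b = b'" if "b \<in> diagram p" "b' \<in> diagram p" for b b'
    using T that by (auto simp: tableau_def bij_betw_def inj_on_def)
  have up: "(i, c) \<in> diagram p" if "c < nth_part p j" for c
  proof -
    have "j < length p" using that by (auto simp: nth_part_def split: if_splits)
    then have "p ! j \<le> p ! i" using p ij by (auto simp: sorted_wrt_iff_nth_less)
    then show ?thesis using that \<open>j < length p\<close> ij by (auto simp: diagram_def nth_part_def)
  qed
  have sum_q: "(\<Sum>q | q < n \<and> x q = i. if \<forall>u<n. (x(q := j)) (\<sigma> u) = ?y u then s else 0)
      = (\<Sum>c<nth_part p j. if ok c \<sigma> then s else 0)"
    if \<sigma>: "\<sigma> \<in> ?C" for \<sigma> and s :: complex
  proof -
    have b: "bij \<sigma>" and less: "\<And>u. \<sigma> u < n \<longleftrightarrow> u < n"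
      using column_stabilizer_sym_perms[OF \<sigma>] sym_perms_bij sym_perms_less by auto
    let ?h = "\<lambda>c. \<sigma> (T (j, c))"
    have inj: "inj_on ?h {..<nth_part p j}"
    proof (rule inj_onI)
      fix c c' assume c: "c \<in> {..<nth_part p j}" "c' \<in> {..<nth_part p j}" "?h c = ?h c'"
      then have "T (j, c) = T (j, c')" using b by (auto simp: bij_def dest: injD)
      then show "c = c'" using inj_T[of "(j, c)" "(j, c')"] c by (simp add: diagram_def)
    qed
    have ok_iff: "ok c \<sigma> \<longleftrightarrow> ?h c < n \<and> x (?h c) = i \<and> (\<forall>u<n. (x(?h c := j)) (\<sigma> u) = ?y u)"
      if c: "c < nth_part p j" for c
    proof -
      have d: "(j, c) \<in> diagram p" using c by (simp add: diagram_def)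
      have "?y (T (j, c)) = j" "T (j, c) < n" using row_word[OF T d] tableau_less[OF T d] by auto
      moreover have "\<sigma> u = ?h c \<longleftrightarrow> u = T (j, c)" for u using b by (auto simp: bij_def dest: injD)
      ultimately show ?thesis unfolding ok_def using less ij by auto
    qed
    have "(\<Sum>q | q < n \<and> x q = i. if \<forall>u<n. (x(q := j)) (\<sigma> u) = ?y u then s else 0)
      = (\<Sum>q\<in>?h ` {..<nth_part p j}. if q < n \<and> x q = i \<and> (\<forall>u<n. (x(q := j)) (\<sigma> u) = ?y u) then s else 0)"
    proof (rule sum.mono_neutral_cong)
      fix q assume q: "q \<in> {q. q < n \<and> x q = i} - ?h ` {..<nth_part p j}"
      show "(if \<forall>u<n. (x(q := j)) (\<sigma> u) = ?y u then s else 0) = 0"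
      proof (rule if_not_P, rule notI)
        assume *: "\<forall>u<n. (x(q := j)) (\<sigma> u) = ?y u"
        define u where "u = inv \<sigma> q"
        have u: "\<sigma> u = q" using b by (simp add: u_def bij_is_surj surj_f_inv_f)
        then have "u < n" using q less[of u] by auto
        then have "?y u = j" using * u by auto
        then obtain c where "(j, c) \<in> diagram p" "T (j, c) = u"
          using row_word_eq_iff[OF T \<open>u < n\<close>] by blast
        then have "q \<in> ?h ` {..<nth_part p j}" using u by (auto simp: diagram_def)
        then show False using q by blast
      qed
    qed auto
    also have "\<dots> = (\<Sum>c<nth_part p j. if ok c \<sigma> then s else 0)"
      unfolding sum.reindex[OF inj] o_def using ok_iff by (intro sum.cong) auto
    finally show ?thesis .
  qed
  have cancel: "(\<Sum>\<sigma>\<in>?C. if ok c \<sigma> then of_int (sign \<sigma>) else (0::complex)) = 0" (is "?S = 0")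
    if c: "c < nth_part p j" for c
  proof -
    have d: "(i, c) \<in> diagram p" "(j, c) \<in> diagram p" using c up by (auto simp: diagram_def)
    define \<tau> where "\<tau> = Transposition.transpose (T (i, c)) (T (j, c))"
    have ne: "T (i, c) \<noteq> T (j, c)" using inj_T[OF d] ij by simp
    have \<tau>: "\<tau> \<in> sym_perms n" unfolding \<tau>_def sym_perms_def
      using tableau_less[OF T] d by (auto intro: permutes_swap_id)
    have \<tau>2: "\<tau> \<circ> \<tau> = id" unfolding \<tau>_def by simp
    have comp: "\<sigma> \<circ> \<tau> \<in> ?C" if \<sigma>: "\<sigma> \<in> ?C" for \<sigma>
      unfolding column_stabilizer_def
    proof (intro CollectI conjI allI impI)
      show "\<sigma> \<circ> \<tau> \<in> sym_perms n" using \<sigma> \<tau> column_stabilizer_sym_perms sym_perms_comp by blast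
      fix r c' assume b: "(r, c') \<in> diagram p"
      have "\<exists>r''. (r'', c') \<in> diagram p \<and> \<tau> (T (r, c')) = T (r'', c')"
        unfolding \<tau>_def Transposition.transpose_def using b d inj_T by (cases "c' = c") auto
      then show "\<exists>r'. (r', c') \<in> diagram p \<and> (\<sigma> \<circ> \<tau>) (T (r, c')) = T (r', c')"
        using \<sigma> unfolding column_stabilizer_def by fastforce
    qed
    have y: "?y (T (i, c)) = i" using row_word[OF T d(1)] by simp
    have ok_comp: "ok c (\<sigma> \<circ> \<tau>) \<longleftrightarrow> ok c \<sigma>" for \<sigma>
    proof -
      have aux: "ok c (\<sigma> \<circ> \<tau>)" if "ok c \<sigma>" for \<sigma>
        unfolding ok_def
      proof (intro allI impI)
        fix u assume u: "u < n"
        have "x (\<sigma> (\<tau> u)) = (if \<tau> u = T (j, c) then i else ?y (\<tau> u))"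
          using that u sym_perms_less[OF \<tau>] by (simp add: ok_def)
        then show "x ((\<sigma> \<circ> \<tau>) u) = (if u = T (j, c) then i else ?y u)"
          using y ne by (auto simp: \<tau>_def Transposition.transpose_def split: if_splits)
      qed
      have "\<sigma> \<circ> \<tau> \<circ> \<tau> = \<sigma>" using \<tau>2 by (simp add: o_assoc[symmetric])
      then show ?thesis using aux[of \<sigma>] aux[of "\<sigma> \<circ> \<tau>"] by auto
    qed
    have sgn: "sign (\<sigma> \<circ> \<tau>) = - sign \<sigma>" if "\<sigma> \<in> ?C" for \<sigma>
      using sign_sym_perms_comp[OF column_stabilizer_sym_perms[OF that] \<tau>] ne
      by (simp add: \<tau>_def sign_swap_id)
    have "?S = (\<Sum>\<sigma>\<in>?C. if ok c (\<sigma> \<circ> \<tau>) then of_int (sign (\<sigma> \<circ> \<tau>)) else 0)"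
      by (rule sum.reindex_bij_witness[of _ "\<lambda>\<sigma>. \<sigma> \<circ> \<tau>" "\<lambda>\<sigma>. \<sigma> \<circ> \<tau>"])
        (use comp \<tau>2 in \<open>auto simp: o_assoc[symmetric]\<close>)
    also have "\<dots> = (\<Sum>\<sigma>\<in>?C. - (if ok c \<sigma> then of_int (sign \<sigma>) else 0))"
      using sgn ok_comp by (intro sum.cong) auto
    also have "\<dots> = - ?S" by (simp add: sum_negf)
    finally show ?thesis by simp
  qed
  have "(\<Sum>q | q < n \<and> x q = i. polytabloid n p T (word_tabloid n (x(q := j))))
      = (\<Sum>\<sigma>\<in>?C. \<Sum>q | q < n \<and> x q = i. if \<forall>u<n. (x(q := j)) (\<sigma> u) = ?y u then of_int (sign \<sigma>) else 0)"
    unfolding polytabloid_word[OF T] by (rule sum.swap)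
  also have "\<dots> = (\<Sum>\<sigma>\<in>?C. \<Sum>c<nth_part p j. if ok c \<sigma> then of_int (sign \<sigma>) else 0)"
    by (rule sum.cong[OF refl sum_q])
  also have "\<dots> = (\<Sum>c<nth_part p j. \<Sum>\<sigma>\<in>?C. if ok c \<sigma> then of_int (sign \<sigma>) else 0)"
    by (rule sum.swap)
  also have "\<dots> = 0" using cancel by simp
  finally show ?thesis .
qed

lemma polytabloid_highest_weight:
  assumes T: "tableau n p T" and p: "sorted_wrt (\<ge>) p"
  shows "polytabloid n p T \<in> highest_weight_space n p"
  unfolding highest_weight_space_def
proof (intro CollectI conjI allI impI)
  fix t assume "polytabloid n p T t \<noteq> 0"
  then obtain \<sigma> where \<sigma>: "\<sigma> \<in> column_stabilizer n p T" "t = tabloid_action \<sigma> (tabloid p T)"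
    unfolding polytabloid_def
    by (elim sum.not_neutral_contains_not_neutral) (auto split: if_splits)
  then have s: "\<sigma> \<in> sym_perms n" by (blast intro: column_stabilizer_sym_perms)
  then have "t = word_tabloid n (row_word p T \<circ> inv \<sigma>)"
    using \<sigma>(2) by (simp add: tabloid_eq_word[OF T] tabloid_action_word)
  then show "\<exists>x. has_content n p x \<and> t = word_tabloid n x"
    using has_content_comp[OF sym_perms_inv[OF s] has_content_row_word[OF T]] by blast
qed (rule raise_polytabloid[OF assms])

lemma specht_module_subset:
  "sorted_wrt (\<ge>) p \<Longrightarrow> specht_module n p \<subseteq> highest_weight_space n p"
  unfolding specht_module_def
  using polytabloid_highest_weight subspace_highest_weight_space
  by (intro cfun.span_minimal) auto

lemma tableau_comp: "\<sigma> \<in> sym_perms n \<Longrightarrow> tableau n p T \<Longrightarrow> tableau n p (\<sigma> \<circ> T)"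
  unfolding tableau_def sym_perms_def using permutes_imp_bij bij_betw_trans by blast

lemma rep_polytabloid:
  assumes g: "g \<in> sym_perms n"
  shows "tabl.rep g (polytabloid n p T) = polytabloid n p (g \<circ> T)"
proof
  fix t
  note b = sym_perms_bij[OF g] and gi = sym_perms_inv[OF g]
  have g_inv [simp]: "g (inv g q) = q" "inv g (g q) = q" for q
    using b by (simp_all add: bij_is_surj surj_f_inv_f bij_is_inj)
  have tab: "tabloid p (g \<circ> T) = tabloid_action g (tabloid p T)"
    by (auto simp: tabloid_def tabloid_action_def fun_eq_iff)
  have act: "tabloid_action (inv g) t = t' \<longleftrightarrow> t = tabloid_action g t'" for t t'
  proof -
    have "tabloid_action g (tabloid_action (inv g) t) = t"
      "tabloid_action (inv g) (tabloid_action g t') = t'"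
      by (simp_all add: tabloid_action_def image_image)
    then show ?thesis by metis
  qed
  have conj: "g \<circ> \<sigma> \<circ> inv g \<in> column_stabilizer n p (g \<circ> T)"
    if s: "\<sigma> \<in> column_stabilizer n p T" for \<sigma>
    unfolding column_stabilizer_def
  proof (intro CollectI conjI allI impI)
    show "g \<circ> \<sigma> \<circ> inv g \<in> sym_perms n"
      using column_stabilizer_sym_perms[OF s] g gi by (intro sym_perms_comp)
    fix r c assume "(r, c) \<in> diagram p"
    then obtain r' where "(r', c) \<in> diagram p" "\<sigma> (T (r, c)) = T (r', c)"
      using s by (auto simp: column_stabilizer_def)
    then show "\<exists>r'. (r', c) \<in> diagram p \<and> (g \<circ> \<sigma> \<circ> inv g) ((g \<circ> T) (r, c)) = (g \<circ> T) (r', c)"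
      by auto
  qed
  have conj': "inv g \<circ> \<sigma> \<circ> g \<in> column_stabilizer n p T"
    if "\<sigma> \<in> column_stabilizer n p (g \<circ> T)" for \<sigma>
  proof -
    have "\<exists>r'. (r', c) \<in> diagram p \<and> inv g (\<sigma> (g (T (r, c)))) = T (r', c)"
      if d: "(r, c) \<in> diagram p" for r c
    proof -
      obtain r' where "(r', c) \<in> diagram p" "\<sigma> (g (T (r, c))) = g (T (r', c))"
        using \<open>\<sigma> \<in> _\<close> d by (auto simp: column_stabilizer_def)
      then show ?thesis by auto
    qed
    moreover have "inv g \<circ> \<sigma> \<circ> g \<in> sym_perms n"
      using column_stabilizer_sym_perms[OF that] g gi by (intro sym_perms_comp)
    ultimately show ?thesis by (simp add: column_stabilizer_def)
  qed
  have sgn: "sign (g \<circ> \<sigma> \<circ> inv g) = sign \<sigma>" if "\<sigma> \<in> sym_perms n" for \<sigma>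
  proof -
    have "sign (inv g) = sign g"
      using g by (simp add: sym_perms_def sign_inverse permutes_imp_permutation[of "{..<n}"])
    then show ?thesis
      using sign_sym_perms_comp[OF sym_perms_comp[OF g that] gi] sign_sym_perms_comp[OF g that]
      by simp
  qed
  have cancel: "g \<circ> (inv g \<circ> \<sigma> \<circ> g) \<circ> inv g = \<sigma>" "inv g \<circ> (g \<circ> \<sigma> \<circ> inv g) \<circ> g = \<sigma>" for \<sigma>
    by (simp_all add: fun_eq_iff)
  have "polytabloid n p (g \<circ> T) t = (\<Sum>\<sigma>\<in>column_stabilizer n p T.
      if t = tabloid_action (g \<circ> \<sigma> \<circ> inv g) (tabloid_action g (tabloid p T))
      then of_int (sign (g \<circ> \<sigma> \<circ> inv g)) else 0)"
    unfolding polytabloid_def tab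
    by (rule sum.reindex_bij_witness[of _ "\<lambda>\<sigma>. g \<circ> \<sigma> \<circ> inv g" "\<lambda>\<sigma>. inv g \<circ> \<sigma> \<circ> g"])
      (simp_all only: conj conj' cancel)
  also have "\<dots> = tabl.rep g (polytabloid n p T) t"
    unfolding polytabloid_def function_rep_def act
  proof (intro sum.cong refl)
    fix \<sigma> assume "\<sigma> \<in> column_stabilizer n p T"
    then have "\<sigma> \<in> sym_perms n" by (rule column_stabilizer_sym_perms)
    moreover have "tabloid_action (g \<circ> \<sigma> \<circ> inv g) (tabloid_action g (tabloid p T))
        = tabloid_action g (tabloid_action \<sigma> (tabloid p T))"
      by (simp add: tabloid_action_def image_image)
    ultimately show "(if t = tabloid_action (g \<circ> \<sigma> \<circ> inv g) (tabloid_action g (tabloid p T))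
        then of_int (sign (g \<circ> \<sigma> \<circ> inv g)) else 0)
      = (if t = tabloid_action g (tabloid_action \<sigma> (tabloid p T)) then of_int (sign \<sigma>) else (0::complex))"
      using sgn by simp
  qed
  finally show "tabl.rep g (polytabloid n p T) t = polytabloid n p (g \<circ> T) t" by simp
qed

lemma invariant_specht_module: "invariant_subspace (sym_perms n) tabl.rep (specht_module n p)"
  unfolding specht_module_def
  using rep_polytabloid tableau_comp
  by (intro tabl.invariant_subspace_span) (blast intro: cfun.span_base)

lemma polytabloid_specht: "tableau n p T \<Longrightarrow> polytabloid n p T \<in> specht_module n p"
  unfolding specht_module_def by (blast intro: cfun.span_base)

lemma ex_tableau:
  assumes "p \<in> partitions n"
  obtains T where "tableau n p T"
proof -
  have d: "diagram p = (SIGMA r:{..<length p}. {..<p ! r})"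
    by (auto simp: diagram_def nth_part_def split: if_splits)
  have "card (diagram p) = n"
    using assms unfolding d by (simp add: partitions_def sum_list_sum_nth atLeast0LessThan)
  moreover have "finite (diagram p)" unfolding d by simp
  ultimately obtain T where "bij_betw T (diagram p) {..<n}"
    using finite_same_card_bij[of "diagram p" "{..<n}"] by auto
  then show ?thesis using that tableau_def by blast
qed

text \<open>Symmetrize a polytabloid over the permutations of the first row. They fix the tabloid, at which the polytabloid
  has coefficient 1, so nothing cancels there.\<close>

lemma specht_row_symmetric_vector:
  assumes p: "p \<in> partitions n"
  obtains A v where "A \<subseteq> {..<n}" "card A = nth_part p 0" "v \<in> specht_module n p" "v \<noteq> 0"
    "\<And>\<sigma>. \<sigma> permutes A \<Longrightarrow> tabl.rep \<sigma> v = v"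
proof -
  obtain T where T: "tableau n p T" using ex_tableau[OF p] .
  let ?y = "row_word p T"
  define A where "A = {q. q < n \<and> ?y q = 0}"
  define R where "R = {\<sigma>. \<sigma> permutes A}"
  define v where "v = (\<Sum>\<sigma>\<in>R. tabl.rep \<sigma> (polytabloid n p T))"
  have A: "A \<subseteq> {..<n}" by (auto simp: A_def)
  have finR: "finite R" unfolding R_def using A finite_subset by (intro finite_permutations) auto
  have R: "\<sigma> \<in> sym_perms n" if "\<sigma> \<in> R" for \<sigma>
    using that permutes_sym_perms[OF _ A] by (simp add: R_def)
  have cardA: "card A = nth_part p 0"
    using has_content_row_word[OF T] by (simp add: has_content_def A_def)
  have "tabl.rep \<sigma> (polytabloid n p T) (word_tabloid n ?y) = 1" if "\<sigma> \<in> R" for \<sigma>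
  proof -
    have \<sigma>: "\<sigma> permutes A" using that by (simp add: R_def)
    have "?y (\<sigma> q) = ?y q" for q
    proof (cases "q \<in> A")
      case True
      then have "\<sigma> q \<in> A" using permutes_in_image[OF \<sigma>] by simp
      then show ?thesis using True by (simp add: A_def)
    qed (simp add: permutes_not_in[OF \<sigma>])
    then have "word_tabloid n (?y \<circ> \<sigma>) = word_tabloid n ?y" by (simp add: word_tabloid_eq_iff)
    then show ?thesis
      using polytabloid_tabloid[OF T] tabl_rep_word[OF R[OF that]] by (simp add: tabloid_eq_word[OF T])
  qed
  then have "v (word_tabloid n ?y) = of_nat (card R)" by (simp add: v_def sum_fun_apply)
  moreover have "id \<in> R" by (simp add: R_def permutes_id)
  ultimately have "v (word_tabloid n ?y) \<noteq> 0" using finR by auto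
  then have "v \<noteq> 0" by auto
  moreover have "v \<in> specht_module n p"
  proof -
    have "cfun.subspace (specht_module n p)" using invariant_specht_module tabl.invariant_subspaceD(1) by blast
    then show ?thesis
      unfolding v_def using R polytabloid_specht[OF T] tabl.invariant_subspaceD(2)[OF invariant_specht_module]
      by (intro cfun.subspace_sum) auto
  qed
  moreover have "tabl.rep \<sigma> v = v" if "\<sigma> permutes A" for \<sigma>
    unfolding v_def using finR that R sym_perms_bij
    by (intro tabl.rep_sum_invariant) (auto simp: R_def intro: permutes_compose permutes_bij)
  ultimately show ?thesis using that[OF A cardA] by blast
qed


section \<open>The tensor product of two Specht modules\<close>

lemma rep_tensor:
  "pairs.rep \<sigma> (tensor u v) = tensor (tabl.rep \<sigma> u) (tabl.rep \<sigma> v)"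
  by (simp add: function_rep_def pair_action_def tensor_def fun_eq_iff)

lemma invariant_tensor_space:
  assumes "invariant_subspace (sym_perms n) tabl.rep U" "invariant_subspace (sym_perms n) tabl.rep W"
  shows "invariant_subspace (sym_perms n) pairs.rep (tensor_space U W)"
  unfolding tensor_space_def
proof (rule pairs.invariant_subspace_span)
  fix \<sigma> f assume s: "\<sigma> \<in> sym_perms n" and "f \<in> {tensor u v |u v. u \<in> U \<and> v \<in> W}"
  then obtain u v where f: "f = tensor u v" "u \<in> U" "v \<in> W" by blast
  then have "tabl.rep \<sigma> u \<in> U" "tabl.rep \<sigma> v \<in> W"
    using s assms tabl.invariant_subspaceD(2) by blast+
  then show "pairs.rep \<sigma> f \<in> cfun.span {tensor u v |u v. u \<in> U \<and> v \<in> W}"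
    unfolding f(1) rep_tensor by (blast intro: cfun.span_base)
qed

lemma tensor_space_slice1:
  assumes f: "f \<in> tensor_space U W" and U: "U \<subseteq> U'" "cfun.subspace U'"
  shows "(\<lambda>s. f (s, t)) \<in> U'"
proof -
  have "cfun.subspace {f. (\<lambda>s. f (s, t)) \<in> U'}"
    using U(2) unfolding cfun.subspace_def
    by (auto simp: zero_fun_def plus_fun_def fscale_def)
  moreover have "tensor u v \<in> {f. (\<lambda>s. f (s, t)) \<in> U'}" if "u \<in> U" for u v
    using cfun.subspace_scale[OF U(2), of u "v t"] U(1) that
    by (auto simp: tensor_def fscale_def mult.commute)
  ultimately have "tensor_space U W \<subseteq> {f. (\<lambda>s. f (s, t)) \<in> U'}"
    unfolding tensor_space_def by (intro cfun.span_minimal) auto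
  then show ?thesis using f by blast
qed

lemma tensor_space_slice2:
  assumes f: "f \<in> tensor_space U W" and W: "W \<subseteq> W'" "cfun.subspace W'"
  shows "(\<lambda>t. f (s, t)) \<in> W'"
proof -
  have "cfun.subspace {f. (\<lambda>t. f (s, t)) \<in> W'}"
    using W(2) unfolding cfun.subspace_def
    by (auto simp: zero_fun_def plus_fun_def fscale_def)
  moreover have "tensor u v \<in> {f. (\<lambda>t. f (s, t)) \<in> W'}" if "v \<in> W" for u v
    using cfun.subspace_scale[OF W(2), of v "u s"] W(1) that
    by (auto simp: tensor_def fscale_def)
  ultimately have "tensor_space U W \<subseteq> {f. (\<lambda>t. f (s, t)) \<in> W'}"
    unfolding tensor_space_def by (intro cfun.span_minimal) auto
  then show ?thesis using f by blast
qed

lemma has_content_cong: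
  assumes "has_content n p x" "word_tabloid n x = word_tabloid n y"
  shows "has_content n p y"
proof -
  have "{q. q < n \<and> y q = r} = {q. q < n \<and> x q = r}" for r
    using assms(2) unfolding word_tabloid_eq_iff by auto
  then show ?thesis using assms(1) by (simp add: has_content_def)
qed

lemma has_content_nth_part_pos:
  assumes "has_content n p x" "q < n"
  shows "0 < nth_part p (x q)"
proof -
  have "q \<in> {u. u < n \<and> x u = x q}" using assms(2) by simp
  then have "0 < card {u. u < n \<and> x u = x q}" by (intro card_gt_0_iff[THEN iffD2]) auto
  then show ?thesis using assms(1) by (simp add: has_content_def)
qed

lemma has_content_less_length:
  "has_content n p x \<Longrightarrow> q < n \<Longrightarrow> x q < length p"
  using has_content_nth_part_pos[of n p x q] by (auto simp: nth_part_def split: if_splits)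

lemma highest_weight_content:
  assumes "f \<in> highest_weight_space n p" "f (word_tabloid n x) \<noteq> 0"
  shows "has_content n p x"
proof -
  obtain y where "has_content n p y" "word_tabloid n x = word_tabloid n y"
    using assms unfolding highest_weight_space_def by blast
  then show ?thesis using has_content_cong by metis
qed

lemma highest_weight_raise:
  "f \<in> highest_weight_space n p \<Longrightarrow> i < j \<Longrightarrow>
    (\<Sum>q | q < n \<and> x q = i. f (word_tabloid n (x(q := j)))) = 0"
  unfolding highest_weight_space_def by blast

definition tabloids :: "nat \<Rightarrow> nat list \<Rightarrow> (nat \<Rightarrow> nat set) set" where
  "tabloids n p = {word_tabloid n x | x. has_content n p x}"

lemma finite_tabloids: "finite (tabloids n p)"
proof (rule finite_subset)
  show "tabloids n p \<subseteq> word_tabloid n ` (PiE {..<n} (\<lambda>_. {..<length p}))"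
  proof
    fix t assume "t \<in> tabloids n p"
    then obtain x where x: "has_content n p x" "t = word_tabloid n x" by (auto simp: tabloids_def)
    have "t = word_tabloid n (restrict x {..<n})" unfolding x(2) word_tabloid_eq_iff by simp
    moreover have "restrict x {..<n} \<in> PiE {..<n} (\<lambda>_. {..<length p})"
      using has_content_less_length[OF x(1)] by auto
    ultimately show "t \<in> word_tabloid n ` (PiE {..<n} (\<lambda>_. {..<length p}))" by blast
  qed
qed (intro finite_imageI finite_PiE; simp)

lemma tabloid_action_tabloids: "\<sigma> \<in> sym_perms n \<Longrightarrow> t \<in> tabloids n p \<Longrightarrow> tabloid_action \<sigma> t \<in> tabloids n p"
  unfolding tabloids_def using tabloid_action_word has_content_comp sym_perms_inv by blast

lemma highest_weight_support: "f \<in> highest_weight_space n p \<Longrightarrow> t \<notin> tabloids n p \<Longrightarrow> f t = 0"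
  unfolding highest_weight_space_def tabloids_def by blast

locale specht_pair =
  fixes n :: nat and lam mu :: "nat list"
  assumes lam: "lam \<in> partitions n" and mu: "mu \<in> partitions n"
begin

abbreviation "V \<equiv> tensor_space (specht_module n lam) (specht_module n mu)"

lemma invariant_V: "invariant_subspace (sym_perms n) pairs.rep V"
  by (intro invariant_tensor_space invariant_specht_module)

lemma slices:
  assumes "f \<in> V"
  shows "(\<lambda>s. f (s, t)) \<in> highest_weight_space n lam" "(\<lambda>t. f (s, t)) \<in> highest_weight_space n mu"
  using tensor_space_slice1[OF assms] tensor_space_slice2[OF assms] lam mu
    specht_module_subset subspace_highest_weight_space by (auto simp: partitions_def)

lemma V_support: "f \<in> V \<Longrightarrow> x \<notin> tabloids n lam \<times> tabloids n mu \<Longrightarrow> f x = 0"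
  using highest_weight_support[OF slices(1)] highest_weight_support[OF slices(2)]
  by (cases x) blast

lemma V_finite_dimensional: "\<exists>B. finite B \<and> V \<subseteq> cfun.span B"
proof (intro exI conjI subsetI)
  let ?P = "tabloids n lam \<times> tabloids n mu"
  let ?\<delta> = "\<lambda>x y. if y = x then 1 else (0::complex)"
  show "finite (?\<delta> ` ?P)" by (intro finite_imageI finite_cartesian_product finite_tabloids)
  fix f assume f: "f \<in> V"
  have "f = (\<Sum>x\<in>?P. fscale (f x) (?\<delta> x))"
  proof
    fix y
    have "(\<Sum>x\<in>?P. fscale (f x) (?\<delta> x)) y = (\<Sum>x\<in>?P. if x = y then f x else 0)"
      by (auto simp: sum_fun_apply fscale_def intro!: sum.cong)
    then show "f y = (\<Sum>x\<in>?P. fscale (f x) (?\<delta> x)) y"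
      using V_support[OF f, of y] by (simp add: finite_tabloids)
  qed
  also have "\<dots> \<in> cfun.span (?\<delta> ` ?P)"
    by (intro cfun.span_sum cfun.span_scale cfun.span_base) auto
  finally show "f \<in> cfun.span (?\<delta> ` ?P)" .
qed

text \<open>An element of \<open>V\<close> is a highest weight vector in each of its two arguments. Two words are combined
  into one word whose letters are pairs.\<close>

theorem symmetric_block_size:
  assumes len: "length lam \<le> 2" "length mu \<le> 3"
    and f: "f \<in> V" "f \<noteq> 0" and A: "A \<subseteq> {..<n}"
    and sym: "\<And>\<sigma>. \<sigma> permutes A \<Longrightarrow> pairs.rep \<sigma> f = f"
  shows "card A \<le> nth_part lam 0 + nth_part mu 1"
proof -
  define F where "F z = f (word_tabloid n (fst \<circ> z), word_tabloid n (snd \<circ> z))" for z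
  have content: "has_content n lam (fst \<circ> z)" "has_content n mu (snd \<circ> z)" if "F z \<noteq> 0" for z
    using that highest_weight_content[OF slices(1)[OF f(1)]]
      highest_weight_content[OF slices(2)[OF f(1)]] unfolding F_def by blast+
  interpret bihighest_weight_vector n "nth_part lam 0" "nth_part mu 1" A F
  proof
    show "F (z \<circ> \<sigma>) = F z" if "\<sigma> permutes A" for \<sigma> z
      using pairs_rep_word[OF permutes_sym_perms[OF that A], of f "fst \<circ> z" "snd \<circ> z"] sym[OF that]
      by (simp add: F_def o_assoc)
    show "z q \<in> {0, 1} \<times> {0, 1, 2}" if "F z \<noteq> 0" "q < n" for z q
      using has_content_less_length[OF content(1)[OF that(1)] that(2)]
        has_content_less_length[OF content(2)[OF that(1)] that(2)] len by (cases "z q") auto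
    show "card {q. q < n \<and> fst (z q) = 0} = nth_part lam 0" if "F z \<noteq> 0" for z
      using content(1)[OF that] by (simp add: has_content_def)
    show "card {q. q < n \<and> snd (z q) = 1} = nth_part mu 1" if "F z \<noteq> 0" for z
      using content(2)[OF that] by (simp add: has_content_def)
    have upd: "fst \<circ> z(q := (a, b)) = (fst \<circ> z)(q := a)" "snd \<circ> z(q := (a, b)) = (snd \<circ> z)(q := b)"
      for z :: "nat \<Rightarrow> nat \<times> nat" and q a b by auto
    show "(\<Sum>q | q < n \<and> fst (z q) = 0. F (z(q := (1, snd (z q))))) = 0" for z
    proof -
      have "(snd \<circ> z)(q := snd (z q)) = snd \<circ> z" for q by auto
      then show ?thesis
        using highest_weight_raise[OF slices(1)[OF f(1), of "word_tabloid n (snd \<circ> z)"], of 0 1 "fst \<circ> z"]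
        by (simp add: F_def upd)
    qed
    show "(\<Sum>q | q < n \<and> snd (z q) = i. F (z(q := (fst (z q), j)))) = 0" if "i < j" for z i j
    proof -
      have "(fst \<circ> z)(q := fst (z q)) = fst \<circ> z" for q by auto
      then show ?thesis
        using highest_weight_raise[OF slices(2)[OF f(1), of "word_tabloid n (fst \<circ> z)"] that, of "snd \<circ> z"]
        by (simp add: F_def upd)
    qed
  qed (rule A)
  obtain s t where "f (s, t) \<noteq> 0" using f(2) by (auto simp: fun_eq_iff)
  moreover from this have "s \<in> tabloids n lam" "t \<in> tabloids n mu" using V_support[OF f(1)] by blast+
  then obtain x y where "s = word_tabloid n x" "t = word_tabloid n y" by (auto simp: tabloids_def)
  ultimately have "F (\<lambda>q. (x q, y q)) \<noteq> 0" by (simp add: F_def o_def)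
  then show ?thesis by (rule block_size_le)
qed

text \<open>A copy of the Specht module of \<open>s\<close> in \<open>V\<close> would contain a nonzero vector fixed by the
  symmetric group of a set with \<open>nth_part s 0\<close> elements.\<close>

lemma kronecker_coeff_eq_0:
  assumes len: "length lam \<le> 2" "length mu \<le> 3"
    and s: "s \<in> partitions n" "nth_part lam 0 + nth_part mu 1 < nth_part s 0"
  shows "kronecker_coeff n lam mu s = 0"
proof -
  obtain B where B: "finite B" "V \<subseteq> cfun.span B" using V_finite_dimensional by blast
  show ?thesis
    unfolding kronecker_coeff_def
  proof (rule pairs.multiplicity_in_eqI[OF invariant_V B(2,1)])
    fix d W assume dec: "irreducible_decomposition (sym_perms n) pairs.rep V d W"
    have "\<not> isomorphic_reps (sym_perms n) tabl.rep (specht_module n s) pairs.rep (W i)" if "i < d" for i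
    proof
      assume "isomorphic_reps (sym_perms n) tabl.rep (specht_module n s) pairs.rep (W i)"
      then obtain \<phi> where \<phi>: "bij_betw \<phi> (specht_module n s) (W i)"
        "\<And>c v. v \<in> specht_module n s \<Longrightarrow> \<phi> (fscale c v) = fscale c (\<phi> v)"
        "\<And>g v. g \<in> sym_perms n \<Longrightarrow> v \<in> specht_module n s \<Longrightarrow> \<phi> (tabl.rep g v) = pairs.rep g (\<phi> v)"
        unfolding isomorphic_reps_def by blast
      obtain A v where A: "A \<subseteq> {..<n}" "card A = nth_part s 0" and v: "v \<in> specht_module n s" "v \<noteq> 0"
        and inv: "\<And>\<sigma>. \<sigma> permutes A \<Longrightarrow> tabl.rep \<sigma> v = v"
        by (rule specht_row_symmetric_vector[OF s(1)]) blast
      have zero: "0 \<in> specht_module n s"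
        using invariant_specht_module tabl.invariant_subspaceD(1) cfun.subspace_0 by blast
      have "\<phi> 0 = 0" using \<phi>(2)[OF zero, of 0] by simp
      then have "\<phi> v \<noteq> 0" using \<phi>(1) v zero by (metis bij_betw_inv_into_left)
      moreover have "\<phi> v \<in> V"
        using \<phi>(1) v(1) pairs.irreducible_decomposition_subset[OF dec that] bij_betwE by blast
      moreover have "pairs.rep \<sigma> (\<phi> v) = \<phi> v" if "\<sigma> permutes A" for \<sigma>
        using \<phi>(3)[OF permutes_sym_perms[OF that A(1)] v(1)] inv[OF that] by simp
      ultimately have "card A \<le> nth_part lam 0 + nth_part mu 1"
        using symmetric_block_size[OF len _ _ A(1)] by blast
      then show False using s(2) A(2) by simp
    qed
    then have "{i. i < d \<and> isomorphic_reps (sym_perms n) tabl.rep (specht_module n s) pairs.rep (W i)} = {}"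
      by blast
    then show "card {i. i < d \<and> isomorphic_reps (sym_perms n) tabl.rep (specht_module n s) pairs.rep (W i)} = 0"
      by (simp only: card.empty)
  qed
qed

end


section \<open>Specht modules of two-row shapes\<close>

definition word_stabilizer :: "nat \<Rightarrow> (nat \<Rightarrow> nat) \<Rightarrow> (nat \<Rightarrow> nat) set" where
  "word_stabilizer n x = {h \<in> sym_perms n. \<forall>q<n. x (h q) = x q}"

lemma finite_word_stabilizer: "finite (word_stabilizer n x)"
  unfolding word_stabilizer_def using finite_sym_perms by auto

lemma word_stabilizer_sym_perms: "h \<in> word_stabilizer n x \<Longrightarrow> h \<in> sym_perms n"
  by (simp add: word_stabilizer_def)

lemma word_stabilizer_comp:
  "h \<in> word_stabilizer n x \<Longrightarrow> h' \<in> word_stabilizer n x \<Longrightarrow> h \<circ> h' \<in> word_stabilizer n x"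
  by (simp add: word_stabilizer_def sym_perms_comp sym_perms_less)

lemma id_word_stabilizer: "id \<in> word_stabilizer n x"
  by (simp add: word_stabilizer_def sym_perms_id)

lemma (in perm_action) sum_word_stabilizer_fixed:
  assumes V: "invariant_subspace (sym_perms n) rep V" and f: "f \<in> V"
  shows "(\<Sum>h\<in>word_stabilizer n x. rep h f) \<in> fixed_vectors (word_stabilizer n x) V"
  unfolding fixed_vectors_def
proof (intro CollectI conjI ballI)
  show "(\<Sum>h\<in>word_stabilizer n x. rep h f) \<in> V"
    using invariant_subspaceD[OF V] f word_stabilizer_sym_perms by (intro cfun.subspace_sum) auto
  show "rep h (\<Sum>h\<in>word_stabilizer n x. rep h f) = (\<Sum>h\<in>word_stabilizer n x. rep h f)"
    if "h \<in> word_stabilizer n x" for h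
    using that finite_word_stabilizer word_stabilizer_sym_perms sym_perms_bij word_stabilizer_comp
    by (intro rep_sum_invariant) blast+
qed

lemma ex_sym_perm_word:
  assumes "has_content n p x" "has_content n p y"
  obtains g where "g \<in> sym_perms n" "\<And>q. q < n \<Longrightarrow> x q = y (g q)"
proof -
  have "count (image_mset z (mset_set {..<n})) r = card {q. q < n \<and> z q = r}" for z :: "nat \<Rightarrow> nat" and r
    by (auto simp: count_image_mset intro!: arg_cong[where f = card])
  then have "image_mset x (mset_set {..<n}) = image_mset y (mset_set {..<n})"
    using assms by (intro multiset_eqI) (simp add: has_content_def)
  then obtain g where "g permutes {..<n}" "\<forall>q\<in>{..<n}. x q = y (g q)"
    by (rule image_mset_eq_implies_permutes[rotated]) auto
  then show ?thesis using that by (auto simp: sym_perms_def)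
qed

text \<open>The word \<open>x0\<close> encodes a tabloid \<open>t0\<close> of shape \<open>s\<close>, and \<open>H\<close>
  is the stabilizer of \<open>t0\<close>, a Young subgroup.\<close>

locale two_row_shape =
  fixes n :: nat and s :: "nat list" and x0 :: "nat \<Rightarrow> nat"
  assumes s: "s \<in> partitions n" and two_rows: "length s \<le> 2" and x0: "has_content n s x0"
begin

abbreviation "H \<equiv> word_stabilizer n x0"
abbreviation "t0 \<equiv> word_tabloid n x0"
abbreviation "S \<equiv> specht_module n s"

lemma S_subset: "S \<subseteq> highest_weight_space n s"
  using s specht_module_subset by (auto simp: partitions_def)

lemma letters: "has_content n s x \<Longrightarrow> q < n \<Longrightarrow> x q = 0 \<or> x q = 1"
  using has_content_less_length[of n s x q] two_rows by linarith

text \<open>The value of a function fixed by \<open>H\<close> at a word depends only on the number of entries that lie in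
  row 1 of the word and in row 0 of \<open>t0\<close>. Moving such an entry up and raising leads back to words
  with the same number or with one less, so the raising equation determines the value for each number from the one
  before, and in the end from the value at \<open>t0\<close>.\<close>

lemma fixed_highest_weight_eq_0:
  assumes f: "f \<in> highest_weight_space n s" "\<And>h. h \<in> H \<Longrightarrow> tabl.rep h f = f" "f t0 = 0"
  shows "f = 0"
proof -
  have zero: "f (word_tabloid n x) = 0" if "has_content n s x" for x
    using that
  proof (induction "card {q. q < n \<and> x q = 1 \<and> x0 q = 0}" arbitrary: x rule: less_induct)
    case less
    show ?case
    proof (cases "\<exists>a<n. x a = 1 \<and> x0 a = 0")
      case False
      then have sub: "{q. q < n \<and> x q = 1} \<subseteq> {q. q < n \<and> x0 q = 1}"
        using letters[OF x0] by fastforce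
      have eq: "{q. q < n \<and> x q = 1} = {q. q < n \<and> x0 q = 1}"
        using less.prems x0 by (intro card_subset_eq[OF _ sub]) (auto simp: has_content_def)
      have "x q = x0 q" if "q < n" for q
      proof -
        have "x q = 1 \<longleftrightarrow> x0 q = 1" using eq that by blast
        then show ?thesis using letters[OF less.prems that] letters[OF x0 that] by auto
      qed
      then have "word_tabloid n x = t0" by (simp add: word_tabloid_eq_iff)
      then show ?thesis using f(3) by simp
    next
      case True
      then obtain a where a: "a < n" "x a = 1" "x0 a = 0" by blast
      define x' where "x' = x(a := 0)"
      have swap: "x'(q := 1) = x \<circ> Transposition.transpose a q" if "x' q = 0" for q
        using that a by (auto simp: x'_def fun_eq_iff Transposition.transpose_def)
      have perm: "Transposition.transpose a q \<in> sym_perms n" if "q < n" for q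
        using a that by (auto simp: sym_perms_def intro: permutes_swap_id)
      have same: "f (word_tabloid n (x'(q := 1))) = f (word_tabloid n x)"
        if q: "q < n" "x' q = 0" "x0 q = 0" for q
      proof -
        have "x0 (Transposition.transpose a q u) = x0 u" for u
          using a q by (auto simp: Transposition.transpose_def)
        then have "Transposition.transpose a q \<in> H"
          using perm[OF q(1)] by (simp add: word_stabilizer_def)
        then have "tabl.rep (Transposition.transpose a q) f = f" by (rule f(2))
        then show ?thesis using tabl_rep_word[OF perm[OF q(1)], of f x] swap[OF q(2)] by simp
      qed
      have less_1: "f (word_tabloid n (x'(q := 1))) = 0" if q: "q < n" "x' q = 0" "x0 q \<noteq> 0" for q
      proof (rule less.hyps)
        have "q \<noteq> a" using q a by auto
        then have "{u. u < n \<and> (x'(q := 1)) u = 1 \<and> x0 u = 0} \<subset> {u. u < n \<and> x u = 1 \<and> x0 u = 0}"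
          using a q by (auto simp: x'_def)
        then show "card {u. u < n \<and> (x'(q := 1)) u = 1 \<and> x0 u = 0} < card {u. u < n \<and> x u = 1 \<and> x0 u = 0}"
          by (intro psubset_card_mono) auto
        show "has_content n s (x'(q := 1))"
          unfolding swap[OF q(2)] using perm[OF q(1)] less.prems by (rule has_content_comp)
      qed
      have "0 = (\<Sum>q | q < n \<and> x' q = 0. f (word_tabloid n (x'(q := 1))))"
        using highest_weight_raise[OF f(1), of 0 1 x'] by simp
      also have "\<dots> = (\<Sum>q | q < n \<and> x' q = 0 \<and> x0 q = 0. f (word_tabloid n x))"
        using same less_1 by (intro sum.mono_neutral_cong_right) auto
      also have "\<dots> = of_nat (card {q. q < n \<and> x' q = 0 \<and> x0 q = 0}) * f (word_tabloid n x)"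
        by simp
      finally have "card {q. q < n \<and> x' q = 0 \<and> x0 q = 0} = 0 \<or> f (word_tabloid n x) = 0"
        by simp
      moreover have "a \<in> {q. q < n \<and> x' q = 0 \<and> x0 q = 0}" using a by (simp add: x'_def)
      then have "card {q. q < n \<and> x' q = 0 \<and> x0 q = 0} \<noteq> 0" by auto
      ultimately show ?thesis by blast
    qed
  qed
  show ?thesis
  proof
    fix t
    show "f t = 0 t"
      using highest_weight_support[OF f(1), of t] zero by (auto simp: tabloids_def)
  qed
qed

text \<open>Transport a nonzero coefficient to \<open>t0\<close> and symmetrize over \<open>H\<close>.\<close>

lemma ex_fixed_vector:
  assumes U: "invariant_subspace (sym_perms n) tabl.rep U" "U \<subseteq> highest_weight_space n s" "U \<noteq> {0}"
  obtains u where "u \<in> tabl.fixed_vectors H U" "u t0 = 1"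
proof -
  have subU: "cfun.subspace U" using U(1) by (rule tabl.invariant_subspaceD)
  then obtain f where f: "f \<in> U" "f \<noteq> 0" using U(3) cfun.subspace_0 by blast
  then obtain t where t: "f t \<noteq> 0" by (auto simp: fun_eq_iff)
  then obtain x where x: "has_content n s x" "t = word_tabloid n x"
    using highest_weight_support[of f n s t] f(1) U(2) by (auto simp: tabloids_def)
  obtain g where g: "g \<in> sym_perms n" "\<And>q. q < n \<Longrightarrow> x q = x0 (g q)"
    using ex_sym_perm_word[OF x(1) x0] by blast
  define v where "v = tabl.rep g f"
  have "word_tabloid n (x0 \<circ> g) = t"
    unfolding x(2) word_tabloid_eq_iff using g(2) by simp
  then have v: "v \<in> U" "v t0 = f t"
    using tabl.invariant_subspaceD(2)[OF U(1) g(1) f(1)]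
    by (simp_all add: v_def tabl_rep_word[OF g(1)])
  define w where "w = (\<Sum>h\<in>H. tabl.rep h v)"
  have w: "w \<in> tabl.fixed_vectors H U"
    unfolding w_def using U(1) v(1) by (rule tabl.sum_word_stabilizer_fixed)
  have "tabl.rep h v t0 = f t" if "h \<in> H" for h
  proof -
    have "word_tabloid n (x0 \<circ> h) = t0"
      using that by (simp add: word_tabloid_eq_iff word_stabilizer_def)
    then show ?thesis using v(2) tabl_rep_word[OF word_stabilizer_sym_perms[OF that]] by simp
  qed
  then have "w t0 = of_nat (card H) * f t" by (simp add: w_def sum_fun_apply)
  moreover have "card H \<noteq> 0" using finite_word_stabilizer[of n x0] id_word_stabilizer[of n x0] by auto
  ultimately have w0: "w t0 \<noteq> 0" using t by simp
  have "fscale (1 / w t0) w \<in> tabl.fixed_vectors H U"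
    using w tabl.subspace_fixed_vectors[OF subU] by (rule cfun.subspace_scale[rotated])
  then show ?thesis using that w0 by (simp add: fscale_def)
qed

lemma fixed_vector_unique:
  assumes "f \<in> tabl.fixed_vectors H (highest_weight_space n s)"
    and "g \<in> tabl.fixed_vectors H (highest_weight_space n s)" and "f t0 = g t0"
  shows "f = g"
proof -
  have "f - g \<in> tabl.fixed_vectors H (highest_weight_space n s)"
    using assms(1,2) by (intro cfun.subspace_diff tabl.subspace_fixed_vectors subspace_highest_weight_space)
  then have "f - g = 0"
    using assms(3) by (intro fixed_highest_weight_eq_0) (auto simp: tabl.fixed_vectors_def)
  then show ?thesis by simp
qed

text \<open>Both subspaces contain the unique vector that is fixed by \<open>H\<close> and has coefficient 1 at
  \<open>t0\<close>.\<close>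

lemma invariant_subspaces_meet:
  assumes U: "invariant_subspace (sym_perms n) tabl.rep U" "U \<subseteq> highest_weight_space n s" "U \<noteq> {0}"
    and W: "invariant_subspace (sym_perms n) tabl.rep W" "W \<subseteq> highest_weight_space n s" "W \<noteq> {0}"
  shows "U \<inter> W \<noteq> {0}"
proof -
  obtain u where u: "u \<in> tabl.fixed_vectors H U" "u t0 = 1" by (rule ex_fixed_vector[OF U])
  obtain w where w: "w \<in> tabl.fixed_vectors H W" "w t0 = 1" by (rule ex_fixed_vector[OF W])
  have "u = w"
    using u w U(2) W(2) by (intro fixed_vector_unique) (auto simp: tabl.fixed_vectors_def)
  then have "u \<in> U \<inter> W" using u(1) w(1) by (simp add: tabl.fixed_vectors_def)
  moreover have "u \<noteq> 0" using u(2) by auto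
  ultimately show ?thesis by blast
qed

lemma S_nonzero: "S \<noteq> {0}"
proof -
  obtain T where T: "tableau n s T" using ex_tableau[OF s] .
  have "polytabloid n s T \<noteq> 0" using polytabloid_tabloid[OF T] by auto
  then show ?thesis using polytabloid_specht[OF T] by blast
qed

text \<open>An invariant complement of a nonzero invariant subspace would have to meet it.\<close>

lemma irreducible_S: "irreducible_rep (sym_perms n) tabl.rep S"
  unfolding irreducible_rep_def
proof (intro conjI allI impI invariant_specht_module S_nonzero)
  fix U assume U: "invariant_subspace (sym_perms n) tabl.rep U \<and> U \<subseteq> S"
  obtain U' where U': "invariant_subspace (sym_perms n) tabl.rep U'" "U' \<subseteq> S" "U \<inter> U' = {0}"
    "\<And>v. v \<in> S \<Longrightarrow> \<exists>u\<in>U. \<exists>u'\<in>U'. v = u + u'"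
    using tabl.invariant_complement[OF invariant_specht_module conjunct1[OF U] conjunct2[OF U]]
    by metis
  show "U = {0} \<or> U = S"
  proof (cases "U = {0}")
    case False
    then have "U' = {0}" using invariant_subspaces_meet[of U U'] U U'(1-3) S_subset by blast
    then show ?thesis using U U'(4) by fastforce
  qed simp
qed

lemma fixed_vectors_S:
  obtains u where "u \<noteq> 0" "tabl.fixed_vectors H S = cfun.span {u}"
proof -
  obtain u where u: "u \<in> tabl.fixed_vectors H S" "u t0 = 1"
    using ex_fixed_vector[OF invariant_specht_module S_subset S_nonzero] .
  have sub: "cfun.subspace (tabl.fixed_vectors H S)"
    using invariant_specht_module tabl.invariant_subspaceD(1) tabl.subspace_fixed_vectors by blast
  have "f \<in> cfun.span {u}" if f: "f \<in> tabl.fixed_vectors H S" for f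
  proof -
    have "fscale (f t0) u \<in> tabl.fixed_vectors H S" using u(1) by (rule cfun.subspace_scale[OF sub])
    then have "f = fscale (f t0) u"
      using f u S_subset by (intro fixed_vector_unique) (auto simp: tabl.fixed_vectors_def fscale_def)
    then show ?thesis using cfun.span_scale[OF cfun.span_base[of u "{u}"]] by (metis singletonI)
  qed
  moreover have "cfun.span {u} \<subseteq> tabl.fixed_vectors H S" using u(1) by (intro cfun.span_minimal sub) simp
  moreover have "u \<noteq> 0" using u(2) by auto
  ultimately show ?thesis using that by blast
qed

end

lemma isomorphic_reps_sym:
  assumes iso: "isomorphic_reps G \<rho> V \<rho>' W"
    and V: "cfun.subspace V" "\<And>g v. g \<in> G \<Longrightarrow> v \<in> V \<Longrightarrow> \<rho> g v \<in> V"
  shows "isomorphic_reps G \<rho>' W \<rho> V"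
proof -
  obtain f where f: "bij_betw f V W" and add: "\<forall>u\<in>V. \<forall>v\<in>V. f (u + v) = f u + f v"
    and scale: "\<forall>c. \<forall>v\<in>V. f (fscale c v) = fscale c (f v)"
    and rep: "\<forall>g\<in>G. \<forall>v\<in>V. f (\<rho> g v) = \<rho>' g (f v)"
    using iso unfolding isomorphic_reps_def by blast
  define h where "h = inv_into V f"
  have h: "bij_betw h W V" unfolding h_def using f by (rule bij_betw_inv_into)
  have hV: "h w \<in> V" if "w \<in> W" for w using h that bij_betwE by blast
  have fh: "f (h w) = w" if "w \<in> W" for w
    unfolding h_def using f that by (rule bij_betw_inv_into_right)
  have hf: "h w = v" if "v \<in> V" "f v = w" for v w
    unfolding h_def using f that bij_betw_inv_into_left by fastforce
  show ?thesis
    unfolding isomorphic_reps_def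
  proof (intro exI[of _ h] conjI ballI allI h)
    show "h (u + v) = h u + h v" if "u \<in> W" "v \<in> W" for u v
      using hV fh add that cfun.subspace_add[OF V(1)] by (intro hf) auto
    show "h (fscale c v) = fscale c (h v)" if "v \<in> W" for c v
      using hV fh scale that cfun.subspace_scale[OF V(1)] by (intro hf) auto
    show "h (\<rho>' g v) = \<rho> g (h v)" if "g \<in> G" "v \<in> W" for g v
      using hV fh rep that V(2) by (intro hf) auto
  qed
qed


context two_row_shape
begin

text \<open>By Frobenius reciprocity the fixed vector \<open>w\<close> defines an equivariant map \<open>\<eta>\<close> from
  \<open>W\<close> into the functions on tabloids: the coefficient of \<open>\<eta> v\<close> at
  \<open>g t0\<close> is a multiple of the inner product of \<open>v\<close> with \<open>g w\<close>. Raising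
  \<open>\<eta> v\<close> amounts to taking inner products of \<open>v\<close> with vectors that are fixed by the
  symmetric group of a set with one element more than the first row of \<open>s\<close>, and there are no such
  vectors in \<open>W\<close> except 0. So \<open>\<eta>\<close> maps into the highest weight space, and there
  every irreducible subspace equals \<open>S\<close>.\<close>

lemma isomorphic_if_fixed_vector:
  fixes a :: "(nat \<Rightarrow> nat) \<Rightarrow> 'x \<Rightarrow> 'x" and W :: "('x \<Rightarrow> complex) set"
  assumes a: "perm_action a" and W: "irreducible_rep (sym_perms n) (function_rep a) W"
    and P: "finite P" "\<And>f x. f \<in> W \<Longrightarrow> x \<notin> P \<Longrightarrow> f x = 0"
      "\<And>\<sigma> x. \<sigma> \<in> sym_perms n \<Longrightarrow> x \<in> P \<Longrightarrow> a \<sigma> x \<in> P"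
    and w: "w \<in> W" "w \<noteq> 0" "\<And>h. h \<in> H \<Longrightarrow> function_rep a h w = w"
    and no_larger_block: "\<And>A v. A \<subseteq> {..<n} \<Longrightarrow> card A = Suc (nth_part s 0) \<Longrightarrow> v \<in> W \<Longrightarrow>
      (\<And>\<sigma>. \<sigma> permutes A \<Longrightarrow> function_rep a \<sigma> v = v) \<Longrightarrow> v = 0"
  shows "isomorphic_reps (sym_perms n) tabl.rep S (function_rep a) W"
proof -
  interpret perm_action a by (rule a)
  let ?G = "sym_perms n"
  have invW: "invariant_subspace ?G rep W" and subW: "cfun.subspace W"
    using irreducible_repD[OF W] by blast+
  note repW = invariant_subspaceD(2)[OF invW]
  \<comment> \<open>An invariant inner product; all elements of \<open>W\<close> are supported on the finite set \<open>P\<close>.\<close>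
  define ip where "ip f g = (\<Sum>x\<in>P. f x * cnj (g x))" for f g :: "'x \<Rightarrow> complex"
  have ip_zero: "ip f 0 = 0" for f by (simp add: ip_def)
  have ip_add: "ip (f + f') g = ip f g + ip f' g" for f f' g
    by (simp add: ip_def distrib_right sum.distrib)
  have ip_scale: "ip (fscale c f) g = c * ip f g" for c f g
    by (simp add: ip_def fscale_def sum_distrib_left mult.assoc)
  have ip_sum: "ip f (\<Sum>i\<in>I. F i) = (\<Sum>i\<in>I. ip f (F i))" for f F and I :: "(nat \<Rightarrow> nat) set"
    unfolding ip_def sum_fun_apply cnj_sum sum_distrib_left by (rule sum.swap)
  have ip_rep: "ip (rep g f) (rep g f') = ip f f'" if g: "g \<in> ?G" for g f f'
  proof -
    have b: "bij g" using g by (rule sym_perms_bij)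
    have "a g (a (inv g) x) = x" "a (inv g) (a g x) = x" for x
      using act_comp[of g "inv g" x] act_comp[of "inv g" g x] b
      by (simp_all add: bij_comp_inv bij_inv_comp act_id)
    then show ?thesis
      unfolding ip_def function_rep_def using P(3) g sym_perms_inv[OF g]
      by (intro sum.reindex_bij_witness[of _ "a g" "a (inv g)"]) auto
  qed
  have ip_self: "ip w w \<noteq> 0"
  proof
    assume "ip w w = 0"
    then have "(\<Sum>x\<in>P. complex_of_real ((cmod (w x))\<^sup>2)) = 0"
      unfolding ip_def by (simp only: complex_norm_square)
    then have "(\<Sum>x\<in>P. (cmod (w x))\<^sup>2) = 0"
      by (metis of_real_sum of_real_eq_0_iff)
    then have "\<forall>x\<in>P. w x = 0" using P(1) by (simp add: sum_nonneg_eq_0_iff)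
    then have "w = 0" using P(2)[OF w(1)] by (auto simp: fun_eq_iff)
    then show False using w(2) by simp
  qed
  \<comment> \<open>The coset of the group elements that take \<open>t0\<close> to \<open>t\<close>; summing over it avoids the choice of representatives.\<close>
  define to where "to t = {g \<in> ?G. tabloid_action g t0 = t}" for t
  have fin_to: "finite (to t)" for t unfolding to_def using finite_sym_perms by auto
  define \<eta> where "\<eta> v t = (\<Sum>g\<in>to t. ip v (rep g w))" for v t
  have \<eta>_add: "\<eta> (u + v) = \<eta> u + \<eta> v" for u v
    by (simp add: \<eta>_def fun_eq_iff ip_add sum.distrib)
  have \<eta>_scale: "\<eta> (fscale c v) = fscale c (\<eta> v)" for c v
    unfolding \<eta>_def ip_scale by (simp add: fun_eq_iff fscale_def sum_distrib_left)
  have \<eta>_zero: "\<eta> 0 = 0" using \<eta>_scale[of 0 0] by simp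
  have \<eta>_rep: "\<eta> (rep h v) = tabl.rep h (\<eta> v)" if h: "h \<in> ?G" for h v
  proof
    fix t
    have b: "bij h" and hi: "inv h \<in> ?G" using h sym_perms_bij sym_perms_inv by auto
    have cancel: "h \<circ> (inv h \<circ> g) = g" "inv h \<circ> (h \<circ> g) = g" for g
      using b by (simp_all add: o_assoc bij_comp_inv bij_inv_comp)
    have to1: "inv h \<circ> g \<in> to (tabloid_action (inv h) t)" if "g \<in> to t" for g
      using that hi by (simp add: to_def sym_perms_comp tabl.act_comp)
    have to2: "h \<circ> g \<in> to t" if "g \<in> to (tabloid_action (inv h) t)" for g
    proof -
      have "tabloid_action h (tabloid_action (inv h) t) = t"
        using tabl.act_comp[of h "inv h" t] b by (simp add: bij_comp_inv tabl.act_id)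
      then show ?thesis using that h by (simp add: to_def sym_perms_comp tabl.act_comp)
    qed
    have ip_move: "ip v (rep (inv h \<circ> g) w) = ip (rep h v) (rep g w)" if "g \<in> to t" for g
    proof -
      have "rep (h \<circ> (inv h \<circ> g)) w = rep h (rep (inv h \<circ> g) w)"
        using b sym_perms_bij[OF sym_perms_comp[OF hi, of g]] that
        by (intro rep_comp) (auto simp: to_def)
      then show ?thesis using ip_rep[OF h, of v "rep (inv h \<circ> g) w"] by (simp only: cancel)
    qed
    show "\<eta> (rep h v) t = tabl.rep h (\<eta> v) t"
      unfolding \<eta>_def function_rep_def[of tabloid_action]
      by (rule sum.reindex_bij_witness[of _ "\<lambda>g. h \<circ> g" "\<lambda>g. inv h \<circ> g"])
        (simp_all only: cancel to1 to2 ip_move)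
  qed
  have \<eta>_highest: "\<eta> v \<in> highest_weight_space n s" if v: "v \<in> W" for v
    unfolding highest_weight_space_def
  proof (intro CollectI conjI allI impI)
    have to_content: "has_content n s x" if "g \<in> to (word_tabloid n x)" for g x
      using that has_content_cong[OF has_content_comp[OF sym_perms_inv x0, of g]]
      by (auto simp: to_def tabloid_action_word)
    show "\<exists>x. has_content n s x \<and> t = word_tabloid n x" if nz: "\<eta> v t \<noteq> 0" for t
    proof -
      have "to t \<noteq> {}" using nz by (auto simp: \<eta>_def)
      then obtain g where "g \<in> ?G" "t = tabloid_action g t0" by (auto simp: to_def)
      then show ?thesis
        using has_content_comp[OF sym_perms_inv x0, of g] by (auto simp: tabloid_action_word)
    qed
    fix i j :: nat and x
    assume ij: "i < j"
    let ?A = "{q. q < n \<and> x q = i}"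
    show "(\<Sum>q\<in>?A. \<eta> v (word_tabloid n (x(q := j)))) = 0"
    proof (cases "j = 1")
      case False
      have "\<eta> v (word_tabloid n (x(q := j))) = 0" if q: "q \<in> ?A" for q
      proof -
        have "to (word_tabloid n (x(q := j))) = {}"
          using to_content letters[of "x(q := j)" q] q ij False by fastforce
        then show ?thesis by (simp add: \<eta>_def)
      qed
      then show ?thesis by simp
    next
      case True
      then have i: "i = 0" using ij by simp
      \<comment> \<open>The elements that take \<open>t0\<close> to one of the tabloids in the sum form a set that is stable under the permutations of \<open>?A\<close> from the left.\<close>
      define Q where "Q = (\<Union>q\<in>?A. to (word_tabloid n (x(q := j))))"
      define u where "u = (\<Sum>g\<in>Q. rep g w)"
      have Q: "Q \<subseteq> ?G" by (auto simp: Q_def to_def)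
      have finQ: "finite Q" using Q finite_sym_perms finite_subset by blast
      have "u = 0"
      proof (cases "Q = {}")
        case True
        then show ?thesis by (simp add: u_def)
      next
        case False
        then obtain q g where q: "q \<in> ?A" "g \<in> to (word_tabloid n (x(q := j)))"
          unfolding Q_def by blast
        have "{p. p < n \<and> (x(q := j)) p = 0} = ?A - {q}" using i ij by auto
        moreover have "card {p. p < n \<and> (x(q := j)) p = 0} = nth_part s 0"
          using to_content[OF q(2)] unfolding has_content_def by blast
        ultimately have "card (?A - {q}) = nth_part s 0" by (simp only:)
        then have card: "card ?A = Suc (nth_part s 0)"
          using card_Suc_Diff1[OF _ q(1)] by simp
        have A: "?A \<subseteq> {..<n}" by auto
        have stable: "\<sigma> \<circ> g \<in> Q" if \<sigma>: "\<sigma> permutes ?A" and g: "g \<in> Q" for \<sigma> g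
        proof -
          have \<sigma>G: "\<sigma> \<in> ?G" using \<sigma> A by (rule permutes_sym_perms)
          obtain q where q: "q \<in> ?A" "g \<in> to (word_tabloid n (x(q := j)))"
            using g unfolding Q_def by blast
          have \<sigma>q: "\<sigma> q \<in> ?A" using \<sigma> q(1) permutes_in_image by metis
          have "x(q := j) \<circ> inv \<sigma> = x(\<sigma> q := j)"
          proof
            fix p
            have "x (inv \<sigma> p) = x p"
            proof (cases "p \<in> ?A")
              case True
              then have "inv \<sigma> p \<in> ?A" using permutes_in_image[OF permutes_inv[OF \<sigma>]] by metis
              then show ?thesis using True by simp
            next
              case False
              then show ?thesis using permutes_not_in[OF permutes_inv[OF \<sigma>]] by simp
            qed
            moreover have "inv \<sigma> p = q \<longleftrightarrow> p = \<sigma> q"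
              using permutes_inv_eq[OF \<sigma>, of p q] by auto
            ultimately show "(x(q := j) \<circ> inv \<sigma>) p = (x(\<sigma> q := j)) p" by simp
          qed
          then have "\<sigma> \<circ> g \<in> to (word_tabloid n (x(\<sigma> q := j)))"
            using q(2) \<sigma>G by (simp add: to_def sym_perms_comp tabl.act_comp tabloid_action_word)
          then show ?thesis using \<sigma>q unfolding Q_def by blast
        qed
        show ?thesis
        proof (rule no_larger_block[OF A card])
          show "u \<in> W" unfolding u_def using Q repW w(1) by (intro cfun.subspace_sum subW) blast
          show "rep \<sigma> u = u" if "\<sigma> permutes ?A" for \<sigma>
            unfolding u_def using finQ Q sym_perms_bij that stable permutes_bij
            by (intro rep_sum_invariant) blast+
        qed
      qed
      have disj: "to (word_tabloid n (x(q := j))) \<inter> to (word_tabloid n (x(p := j))) = {}"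
        if "q \<in> ?A" "p \<in> ?A" "q \<noteq> p" for p q
      proof -
        have "(x(q := j)) q \<noteq> (x(p := j)) q" using that ij by simp
        then have "word_tabloid n (x(q := j)) \<noteq> word_tabloid n (x(p := j))"
          using that(1) by (auto simp: word_tabloid_eq_iff)
        then show ?thesis by (auto simp: to_def)
      qed
      have "(\<Sum>q\<in>?A. \<eta> v (word_tabloid n (x(q := j)))) = (\<Sum>g\<in>Q. ip v (rep g w))"
        unfolding \<eta>_def Q_def using fin_to disj by (intro sum.UNION_disjoint[symmetric]) auto
      also have "\<dots> = ip v u" unfolding u_def ip_sum ..
      also have "\<dots> = 0" using \<open>u = 0\<close> ip_zero by simp
      finally show ?thesis .
    qed
  qed
  have \<eta>_w: "\<eta> w \<noteq> 0"
  proof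
    assume zero: "\<eta> w = 0"
    have "rep g w = w" if g: "g \<in> to t0" for g
    proof (rule w(3))
      have gG: "g \<in> ?G" using g by (simp add: to_def)
      have "\<forall>q<n. x0 (inv g q) = x0 q"
        using g by (simp add: to_def tabloid_action_word[OF gG] word_tabloid_eq_iff)
      then have "x0 (g q) = x0 q" if "q < n" for q
        using that sym_perms_less[OF gG, of q] sym_perms_bij[OF gG]
        by (metis bij_inv_eq_iff)
      then show "g \<in> H" using gG by (simp add: word_stabilizer_def)
    qed
    then have "\<eta> w t0 = of_nat (card (to t0)) * ip w w" by (simp add: \<eta>_def)
    moreover have "id \<in> to t0" by (simp add: to_def sym_perms_id tabl.act_id)
    then have "card (to t0) \<noteq> 0" using fin_to by auto
    ultimately show False using zero ip_self by simp
  qed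
  have kernel: "v = 0" if v: "v \<in> W" "\<eta> v = 0" for v
  proof -
    have "invariant_subspace ?G rep {v \<in> W. \<eta> v = 0}"
      unfolding invariant_subspace_def cfun.subspace_def
      using subW repW by (auto simp: \<eta>_zero \<eta>_add \<eta>_scale \<eta>_rep tabl.rep_zero cfun.subspace_def)
    then have "{v \<in> W. \<eta> v = 0} = {0} \<or> {v \<in> W. \<eta> v = 0} = W"
      by (intro irreducible_repD(4)[OF W]) auto
    then show ?thesis using \<eta>_w w(1) v by auto
  qed
  have inj: "inj_on \<eta> W"
  proof (rule inj_onI)
    fix u v assume uv: "u \<in> W" "v \<in> W" "\<eta> u = \<eta> v"
    have "\<eta> (u - v) = 0" using \<eta>_add[of "u - v" v] uv(3) by simp
    then show "u = v" using kernel[of "u - v"] cfun.subspace_diff[OF subW] uv by simp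
  qed
  have image: "invariant_subspace ?G tabl.rep (\<eta> ` W)"
    unfolding invariant_subspace_def cfun.subspace_def
  proof (intro conjI ballI allI)
    show "0 \<in> \<eta> ` W" using \<eta>_zero cfun.subspace_0[OF subW] by (metis imageI)
    show "x + y \<in> \<eta> ` W" if "x \<in> \<eta> ` W" "y \<in> \<eta> ` W" for x y
      using that cfun.subspace_add[OF subW] by (auto simp flip: \<eta>_add)
    show "fscale c x \<in> \<eta> ` W" if "x \<in> \<eta> ` W" for c x
      using that cfun.subspace_scale[OF subW] by (auto simp flip: \<eta>_scale)
    show "tabl.rep g x \<in> \<eta> ` W" if "g \<in> ?G" "x \<in> \<eta> ` W" for g x
      using that repW by (auto simp flip: \<eta>_rep)
  qed
  have meet: "S \<inter> \<eta> ` W \<noteq> {0}"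
    using \<eta>_highest \<eta>_w w(1)
    by (intro invariant_subspaces_meet invariant_specht_module S_subset S_nonzero image) auto
  have S_eq: "S \<inter> \<eta> ` W = S"
  proof -
    have "invariant_subspace ?G tabl.rep (S \<inter> \<eta> ` W)"
      using image invariant_specht_module[of n s]
      unfolding invariant_subspace_def by (auto intro: cfun.subspace_inter)
    then show ?thesis using tabl.irreducible_repD(4)[OF irreducible_S, of "S \<inter> \<eta> ` W"] meet by auto
  qed
  have W_eq: "{v \<in> W. \<eta> v \<in> S} = W"
  proof -
    have "invariant_subspace ?G rep {v \<in> W. \<eta> v \<in> S}"
      unfolding invariant_subspace_def cfun.subspace_def
      using subW repW invariant_specht_module[of n s]
      by (auto simp: \<eta>_zero \<eta>_add \<eta>_scale \<eta>_rep cfun.subspace_def invariant_subspace_def)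
    moreover have "{v \<in> W. \<eta> v \<in> S} \<noteq> {0}"
    proof
      assume *: "{v \<in> W. \<eta> v \<in> S} = {0}"
      have "S \<subseteq> {0}"
      proof
        fix y assume y: "y \<in> S"
        then have "y \<in> \<eta> ` W" using S_eq by blast
        then obtain v where v: "v \<in> W" "y = \<eta> v" by blast
        then have "v \<in> {v \<in> W. \<eta> v \<in> S}" using y by simp
        then have "v = 0" unfolding * by simp
        then show "y \<in> {0}" using v(2) \<eta>_zero by simp
      qed
      then show False
        using S_nonzero cfun.subspace_0[OF tabl.irreducible_repD(2)[OF irreducible_S]] by blast
    qed
    ultimately show ?thesis using irreducible_repD(4)[OF W, of "{v \<in> W. \<eta> v \<in> S}"] by auto
  qed
  have "\<eta> ` W = S" using S_eq W_eq by blast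
  then have "bij_betw \<eta> W S" using inj by (simp add: bij_betw_def)
  then have "isomorphic_reps ?G rep W tabl.rep S"
    unfolding isomorphic_reps_def using \<eta>_add \<eta>_scale \<eta>_rep by blast
  then show ?thesis using subW repW by (rule isomorphic_reps_sym)
qed

lemma fixed_vectors_isomorphic:
  assumes a: "perm_action a"
    and iso: "isomorphic_reps (sym_perms n) tabl.rep S (function_rep a) W"
  shows "\<exists>u. u \<noteq> 0 \<and> perm_action.fixed_vectors a H W = cfun.span {u}"
proof -
  interpret perm_action a by (rule a)
  obtain \<phi> where \<phi>: "bij_betw \<phi> S W"
    and scale: "\<And>c v. v \<in> S \<Longrightarrow> \<phi> (fscale c v) = fscale c (\<phi> v)"
    and rep: "\<And>g v. g \<in> sym_perms n \<Longrightarrow> v \<in> S \<Longrightarrow> \<phi> (tabl.rep g v) = rep g (\<phi> v)"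
    using iso unfolding isomorphic_reps_def by blast
  obtain u where u: "u \<noteq> 0" "tabl.fixed_vectors H S = cfun.span {u}" by (rule fixed_vectors_S)
  have uS: "u \<in> S" using u(2) cfun.span_base[of u "{u}"] by (auto simp: tabl.fixed_vectors_def)
  have inj: "\<phi> v = \<phi> v' \<longleftrightarrow> v = v'" if "v \<in> S" "v' \<in> S" for v v'
    using \<phi> that by (auto simp: bij_betw_def inj_on_def)
  have zero: "0 \<in> S"
    using invariant_specht_module tabl.invariant_subspaceD(1) cfun.subspace_0 by blast
  have \<phi>0: "\<phi> 0 = 0" using scale[OF zero, of 0] by simp
  have "fixed_vectors H W = \<phi> ` tabl.fixed_vectors H S"
  proof (intro equalityI subsetI)
    fix w assume w: "w \<in> fixed_vectors H W"
    then obtain v where v: "v \<in> S" "w = \<phi> v"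
      using \<phi> by (auto simp: fixed_vectors_def bij_betw_def)
    have "tabl.rep h v = v" if h: "h \<in> H" for h
    proof -
      have hG: "h \<in> sym_perms n" using h by (rule word_stabilizer_sym_perms)
      have "\<phi> (tabl.rep h v) = \<phi> v" using rep[OF hG v(1)] w h v(2) by (simp add: fixed_vectors_def)
      then show ?thesis
        using inj[OF _ v(1)] tabl.invariant_subspaceD(2)[OF invariant_specht_module hG v(1)] by blast
    qed
    then show "w \<in> \<phi> ` tabl.fixed_vectors H S" using v by (auto simp: tabl.fixed_vectors_def)
  next
    fix w assume "w \<in> \<phi> ` tabl.fixed_vectors H S"
    then obtain v where v: "v \<in> S" "\<And>h. h \<in> H \<Longrightarrow> tabl.rep h v = v" "w = \<phi> v"
      by (auto simp: tabl.fixed_vectors_def)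
    have "rep h w = w" if "h \<in> H" for h
      using rep[OF word_stabilizer_sym_perms[OF that] v(1)] v(2)[OF that] v(3) by simp
    then show "w \<in> fixed_vectors H W"
      using v \<phi> by (auto simp: fixed_vectors_def bij_betw_def)
  qed
  also have "\<dots> = cfun.span {\<phi> u}"
    unfolding u(2) cfun.span_singleton using scale[OF uS] by (auto simp: image_image)
  finally have "fixed_vectors H W = cfun.span {\<phi> u}" .
  moreover have "\<phi> u \<noteq> 0" using inj[OF uS zero] u(1) \<phi>0 by simp
  ultimately show ?thesis by blast
qed

end


section \<open>An invariant vector for the largest block\<close>

lemma column_stabilizerD:
  "\<sigma> \<in> column_stabilizer n p T \<Longrightarrow> (r, c) \<in> diagram p \<Longrightarrow>
    \<exists>r'. (r', c) \<in> diagram p \<and> \<sigma> (T (r, c)) = T (r', c)"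
  unfolding column_stabilizer_def by blast

lemma sum_nth_part:
  assumes "p \<in> partitions n" "length p \<le> 3"
  shows "nth_part p 0 + nth_part p 1 + nth_part p 2 = n"
proof -
  consider "p = []" | a where "p = [a]" | a b where "p = [a, b]" | a b c where "p = [a, b, c]"
    using assms(2) by (auto simp: le_Suc_eq numeral_eq_Suc length_Suc_conv)
  then show ?thesis using assms(1) by cases (auto simp: partitions_def nth_part_def)
qed

lemma nth_part_antimono:
  assumes "p \<in> partitions n" "i \<le> j"
  shows "nth_part p j \<le> nth_part p i"
  using assms by (auto simp: partitions_def nth_part_def sorted_wrt_iff_nth_less le_less)

locale dominating_pair = specht_pair +
  assumes len_lam: "length lam \<le> 2" and len_mu: "length mu \<le> 3"
    and dom: "nth_part lam 0 \<le> nth_part mu 0"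
begin

abbreviation "l1 \<equiv> nth_part lam 0"
abbreviation "l2 \<equiv> nth_part lam 1"
abbreviation "m1 \<equiv> nth_part mu 0"
abbreviation "m2 \<equiv> nth_part mu 1"
abbreviation "m3 \<equiv> nth_part mu 2"

text \<open>\<open>N\<close> is the largest first part of a constituent of \<open>V\<close>, by
  \<open>kronecker_coeff_eq_0\<close> and \<open>kronecker_coeff_two_row_pos\<close>.\<close>

definition N :: nat where "N = l1 + m2"

lemma parts: "l1 + l2 = n" "m1 + m2 + m3 = n" "l2 \<le> l1" "m2 \<le> m1" "m3 \<le> m2" "l1 \<le> m1"
  "m2 \<le> l2" "N + m3 \<le> n" "m2 \<le> l1"
proof -
  have "nth_part lam 2 = 0" using len_lam by (simp add: nth_part_def)
  then show *: "l1 + l2 = n" using sum_nth_part[OF lam] len_lam by simp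
  show "m1 + m2 + m3 = n" using sum_nth_part[OF mu] len_mu by simp
  moreover show "l2 \<le> l1" "m2 \<le> m1" "m3 \<le> m2"
    using nth_part_antimono[OF lam] nth_part_antimono[OF mu] by simp_all
  moreover show "l1 \<le> m1" by (rule dom)
  ultimately show "m2 \<le> l2" "N + m3 \<le> n" "m2 \<le> l1" using * by (simp_all add: N_def)
qed

lemma diagram_lam: "(r, c) \<in> diagram lam \<longleftrightarrow> r = 0 \<and> c < l1 \<or> r = 1 \<and> c < l2"
proof -
  have "nth_part lam r = 0" if "2 \<le> r" using len_lam that by (simp add: nth_part_def)
  then have "r \<in> {0, 1} \<or> nth_part lam r = 0" by fastforce
  then show ?thesis by (auto simp: diagram_def)
qed

lemma diagram_mu: "(r, c) \<in> diagram mu \<longleftrightarrow> r = 0 \<and> c < m1 \<or> r = 1 \<and> c < m2 \<or> r = 2 \<and> c < m3"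
proof -
  have "nth_part mu r = 0" if "3 \<le> r" using len_mu that by (simp add: nth_part_def)
  then have "r \<in> {0, 1, 2} \<or> nth_part mu r = 0" by fastforce
  then show ?thesis by (auto simp: diagram_def)
qed

text \<open>The entries below \<open>N\<close> are placed in the same rows of both tableaux: \<open>{..<l1}\<close> in row 0
  and \<open>{l1..<N}\<close> in row 1. The remaining \<open>n - N\<close> entries complete row 1 of
  \<open>T_lam\<close>, while they go to rows 0 and 2 of \<open>T_mu\<close>. For \<open>c < m2\<close> the column
  \<open>c\<close> of either tableau contains \<open>c\<close> and \<open>l1 + c\<close>. This is where the
  hypothesis on the first parts enters: it ensures that the first row of \<open>T_mu\<close> can hold
  \<open>{..<l1}\<close>.\<close>

definition T_lam :: "nat \<times> nat \<Rightarrow> nat" where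
  "T_lam = (\<lambda>(r, c). if r = 0 then c else l1 + c)"

definition T_mu :: "nat \<times> nat \<Rightarrow> nat" where
  "T_mu = (\<lambda>(r, c). if r = 0 then if c < l1 then c else c + m2 else if r = 1 then l1 + c else n - m3 + c)"

lemma tableau_T_lam: "tableau n lam T_lam"
  unfolding tableau_def
proof (rule bij_betw_imageI)
  show "inj_on T_lam (diagram lam)"
    by (rule inj_onI) (auto simp: T_lam_def diagram_lam split: if_splits)
  show "T_lam ` diagram lam = {..<n}"
  proof (intro equalityI subsetI)
    fix q assume q: "q \<in> {..<n}"
    show "q \<in> T_lam ` diagram lam"
    proof (cases "q < l1")
      case True
      then show ?thesis by (intro image_eqI[of _ _ "(0, q)"]) (auto simp: T_lam_def diagram_lam)
    next
      case False
      then show ?thesis using q parts(1)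
        by (intro image_eqI[of _ _ "(1, q - l1)"]) (auto simp: T_lam_def diagram_lam)
    qed
  qed (use parts(1) in \<open>auto simp: T_lam_def diagram_lam\<close>)
qed

lemma tableau_T_mu: "tableau n mu T_mu"
  unfolding tableau_def
proof (rule bij_betw_imageI)
  show "inj_on T_mu (diagram mu)"
    using parts by (intro inj_onI) (auto simp: T_mu_def diagram_mu N_def split: if_splits)
  show "T_mu ` diagram mu = {..<n}"
  proof (intro equalityI subsetI)
    fix q assume q: "q \<in> {..<n}"
    consider "q < l1" | "l1 \<le> q" "q < N" | "N \<le> q" "q < n - m3" | "n - m3 \<le> q" by linarith
    then show "q \<in> T_mu ` diagram mu"
    proof cases
      case 1
      then show ?thesis using parts by (intro image_eqI[of _ _ "(0, q)"]) (auto simp: T_mu_def diagram_mu)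
    next
      case 2
      then show ?thesis using parts
        by (intro image_eqI[of _ _ "(1, q - l1)"]) (auto simp: T_mu_def diagram_mu N_def)
    next
      case 3
      then show ?thesis using parts
        by (intro image_eqI[of _ _ "(0, q - m2)"]) (auto simp: T_mu_def diagram_mu N_def)
    next
      case 4
      then show ?thesis using parts q
        by (intro image_eqI[of _ _ "(2, q - (n - m3))"]) (auto simp: T_mu_def diagram_mu N_def)
    qed
  qed (use parts in \<open>auto simp: T_mu_def diagram_mu N_def split: if_splits\<close>)
qed

abbreviation "x \<equiv> row_word lam T_lam"
abbreviation "y \<equiv> row_word mu T_mu"

lemma x_eq: "q < n \<Longrightarrow> x q = (if q < l1 then 0 else 1)"
  using row_word[OF tableau_T_lam, of "(0, q)"] row_word[OF tableau_T_lam, of "(1, q - l1)"] parts(1)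
  by (auto simp: T_lam_def diagram_lam)

lemma y_eq:
  assumes q: "q < n"
  shows "y q = (if q < l1 then 0 else if q < N then 1 else if q < n - m3 then 0 else 2)"
proof -
  have y: "y q = r" if "T_mu (r, c) = q" "(r, c) \<in> diagram mu" for r c
    using row_word[OF tableau_T_mu that(2)] that(1) by simp
  consider "q < l1" | "l1 \<le> q" "q < N" | "N \<le> q" "q < n - m3" | "N \<le> q" "n - m3 \<le> q"
    using parts by linarith
  then show ?thesis
  proof cases
    case 1
    have "y q = 0" by (rule y[of 0 q]) (use 1 parts in \<open>auto simp: T_mu_def diagram_mu\<close>)
    then show ?thesis using 1 by simp
  next
    case 2
    have "y q = 1" by (rule y[of 1 "q - l1"]) (use 2 in \<open>auto simp: T_mu_def diagram_mu N_def\<close>)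
    then show ?thesis using 2 by simp
  next
    case 3
    have "y q = 0"
      by (rule y[of 0 "q - m2"]) (use 3 parts in \<open>auto simp: T_mu_def diagram_mu N_def\<close>)
    then show ?thesis using 3 by (simp add: N_def)
  next
    case 4
    have "y q = 2"
      by (rule y[of 2 "q - (n - m3)"]) (use 4 q parts in \<open>auto simp: T_mu_def diagram_mu N_def\<close>)
    then show ?thesis using 4 by (simp add: N_def)
  qed
qed

text \<open>The word of the tabloid with rows \<open>{..<N}\<close> and \<open>{N..<n}\<close>.\<close>

definition block_word :: "nat \<Rightarrow> nat" where
  "block_word q = (if q < N then 0 else 1)"

text \<open>The permutation \<open>h\<close> preserves the block \<open>{..<N}\<close>. Entries in row 2 of \<open>y\<close>
  lie outside the block, and in a column of \<open>T_mu\<close> with three entries only the lowest one does; so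
  \<open>\<tau>\<close> fixes it. Likewise all entries of \<open>x\<close> outside the block are in row 1, so
  \<open>\<sigma>\<close> fixes the columns of \<open>T_lam\<close> that leave the block. What remains for
  \<open>\<sigma>\<close> and \<open>\<tau>\<close> is to swap \<open>c\<close> and \<open>l1 + c\<close> for some
  \<open>c < m2\<close>. Whether they do can be read off from the row of \<open>h c\<close>, which is the same in
  \<open>x\<close> and \<open>y\<close>.\<close>

lemma column_permutations_agree:
  assumes h: "h \<in> word_stabilizer n block_word"
    and \<sigma>: "\<sigma> \<in> column_stabilizer n lam T_lam" "\<And>q. q < n \<Longrightarrow> x (h (\<sigma> q)) = x q"
    and \<tau>: "\<tau> \<in> column_stabilizer n mu T_mu" "\<And>q. q < n \<Longrightarrow> y (h (\<tau> q)) = y q"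
  shows "\<sigma> = \<tau>"
proof -
  have sG: "\<sigma> \<in> sym_perms n" "\<tau> \<in> sym_perms n" "h \<in> sym_perms n"
    using \<sigma>(1) \<tau>(1) h column_stabilizer_sym_perms word_stabilizer_sym_perms by blast+
  have inj_\<sigma>: "\<sigma> p = \<sigma> q \<Longrightarrow> p = q" and inj_\<tau>: "\<tau> p = \<tau> q \<Longrightarrow> p = q" for p q
    using sG sym_perms_bij by (metis bij_pointE)+
  have block: "h q < N \<longleftrightarrow> q < N" if "q < n" for q
    using h that by (simp add: word_stabilizer_def block_word_def split: if_splits) blast
  have h_less: "h q < n" if "q < n" for q using that sym_perms_less[OF sG(3)] by simp
  have sig1: "\<sigma> c = c \<or> c < l2 \<and> \<sigma> c = l1 + c" if "c < l1" for c
    using column_stabilizerD[OF \<sigma>(1), of 0 c] that by (auto simp: T_lam_def diagram_lam)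
  have sig2: "\<sigma> (l1 + c) = l1 + c \<or> \<sigma> (l1 + c) = c" if "c < l2" for c
    using column_stabilizerD[OF \<sigma>(1), of 1 c] that by (auto simp: T_lam_def diagram_lam)
  have tau1: "\<tau> c = c \<or> c < m2 \<and> \<tau> c = l1 + c \<or> c < m3 \<and> \<tau> c = n - m3 + c" if "c < l1" for c
    using column_stabilizerD[OF \<tau>(1), of 0 c] that parts by (auto simp: T_mu_def diagram_mu)
  have tau2: "\<tau> (l1 + c) = c \<or> \<tau> (l1 + c) = l1 + c \<or> c < m3 \<and> \<tau> (l1 + c) = n - m3 + c"
    if "c < m2" for c
    using column_stabilizerD[OF \<tau>(1), of 1 c] that parts by (auto simp: T_mu_def diagram_mu)
  have tau3: "\<tau> (n - m3 + c) = c \<or> \<tau> (n - m3 + c) = l1 + c \<or> \<tau> (n - m3 + c) = n - m3 + c"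
    if "c < m3" for c
    using column_stabilizerD[OF \<tau>(1), of 2 c] that parts by (auto simp: T_mu_def diagram_mu)
  have tau0: "\<tau> (c + m2) = c + m2" if "l1 \<le> c" "c < m1" for c
    using column_stabilizerD[OF \<tau>(1), of 0 c] that parts by (auto simp: T_mu_def diagram_mu)
  have tau_top: "\<tau> (n - m3 + c) = n - m3 + c" if c: "c < m3" for c
  proof -
    define q where "q = n - m3 + c"
    have q: "q < n" "\<not> q < N" "\<not> q < n - m3" "\<not> q < l1"
      using c parts by (simp_all add: q_def N_def)
    have "h (\<tau> q) < n" using h_less sym_perms_less[OF sG(2)] q(1) by simp
    moreover have "y (h (\<tau> q)) = 2" using \<tau>(2)[OF q(1)] y_eq[OF q(1)] q by simp
    ultimately have "\<not> h (\<tau> q) < N"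
      using y_eq[of "h (\<tau> q)"] by (auto split: if_splits)
    then have "\<not> \<tau> q < N" using block[of "\<tau> q"] sym_perms_less[OF sG(2)] q(1) by simp
    then show ?thesis using tau3[OF c] c parts unfolding q_def N_def by auto
  qed
  have tau_B: "\<tau> q = q" if "N \<le> q" "q < n" for q
  proof (cases "q < n - m3")
    case True
    then show ?thesis using tau0[of "q - m2"] that parts by (simp add: N_def)
  next
    case False
    then show ?thesis using tau_top[of "q - (n - m3)"] that parts by simp
  qed
  have tau_A: "\<tau> c = c" if "m2 \<le> c" "c < l1" for c
    using tau1[OF that(2)] that parts by linarith
  have sig_mid: "\<sigma> c = c \<and> \<sigma> (l1 + c) = l1 + c" if c: "m2 \<le> c" "c < l2" for c
  proof -
    have q: "l1 + c < n" "\<not> l1 + c < N" "c < n" "c < l1" using c parts by (simp_all add: N_def)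
    have "\<sigma> c \<noteq> l1 + c"
    proof
      assume *: "\<sigma> c = l1 + c"
      have "\<not> h (l1 + c) < N" using block q by simp
      then have "x (h (l1 + c)) = 1" using x_eq[OF h_less[OF q(1)]] by (simp add: N_def)
      then show False using \<sigma>(2)[OF q(3)] x_eq[OF q(3)] q(4) * by simp
    qed
    then have "\<sigma> c = c" using sig1[OF q(4)] by blast
    moreover have "\<sigma> (l1 + c) \<noteq> c"
    proof
      assume "\<sigma> (l1 + c) = c"
      then have "l1 + c = c" using inj_\<sigma>[of "l1 + c" c] \<open>\<sigma> c = c\<close> by simp
      then show False using q(4) by simp
    qed
    ultimately show ?thesis using sig2[OF c(2)] by blast
  qed
  have low: "\<sigma> c = \<tau> c \<and> \<sigma> (l1 + c) = \<tau> (l1 + c)" if c: "c < m2" for c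
  proof -
    have q: "c < l1" "c < l2" "c < n" "l1 + c < n" "c < N" "l1 + c < N"
      using c parts by (simp_all add: N_def)
    have xy: "x (h c) = y (h c)"
      using x_eq[OF h_less[OF q(3)]] y_eq[OF h_less[OF q(3)]] block[OF q(3)] q(5) by simp
    have neq: "\<tau> c \<noteq> n - m3 + c" "\<tau> (l1 + c) \<noteq> n - m3 + c" if "c < m3"
      using inj_\<tau>[of c "n - m3 + c"] inj_\<tau>[of "l1 + c" "n - m3 + c"] tau_top[OF that] parts q
      by auto
    have t: "\<tau> c = c \<and> \<tau> (l1 + c) = l1 + c \<or> \<tau> c = l1 + c \<and> \<tau> (l1 + c) = c"
      using tau1[OF q(1)] tau2[OF c] neq inj_\<tau>[of c "l1 + c"] q(1) by auto
    have s: "\<sigma> c = c \<and> \<sigma> (l1 + c) = l1 + c \<or> \<sigma> c = l1 + c \<and> \<sigma> (l1 + c) = c"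
      using sig1[OF q(1)] sig2[OF q(2)] inj_\<sigma>[of c "l1 + c"] q(1) by auto
    have "x c = 0" "x (l1 + c) = 1" "y c = 0" "y (l1 + c) = 1"
      using x_eq[OF q(3)] x_eq[OF q(4)] y_eq[OF q(3)] y_eq[OF q(4)] q by simp_all
    then have "\<sigma> c = c \<longleftrightarrow> \<tau> c = c"
      using s t \<sigma>(2)[OF q(3)] \<sigma>(2)[OF q(4)] \<tau>(2)[OF q(3)] \<tau>(2)[OF q(4)] xy q(1)
      by (metis zero_neq_one)
    then show ?thesis using s t by auto
  qed
  have "\<sigma> q = \<tau> q" if q: "q < n" for q
  proof -
    consider "q < m2" | "m2 \<le> q" "q < l2" "q < l1" | "l2 \<le> q" "q < l1" | "l1 \<le> q" "q < N" | "N \<le> q"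
      by linarith
    then show ?thesis
    proof cases
      case 1
      then show ?thesis using low by simp
    next
      case 2
      then show ?thesis using sig_mid tau_A by simp
    next
      case 3
      then show ?thesis using sig1[of q] tau_A[of q] parts by simp
    next
      case 4
      then show ?thesis using low[of "q - l1"] by (simp add: N_def)
    next
      case 5
      then show ?thesis using sig_mid[of "q - l1"] tau_B[OF 5 q] q parts by (simp add: N_def)
    qed
  qed
  moreover have "\<sigma> q = \<tau> q" if "\<not> q < n" for q
    using that sG by (simp add: sym_perms_def permutes_def)
  ultimately show ?thesis by blast
qed

text \<open>The coefficient of the symmetrized vector at the pair of tabloids of \<open>T_lam\<close> and
  \<open>T_mu\<close> is a sum of products of signs over triples \<open>(h, \<sigma>, \<tau>)\<close>. All triples
  that contribute have \<open>\<sigma> = \<tau>\<close>, so the coefficient is the number of these triples, and it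
  is positive because of the triple of identities.\<close>

lemma ex_block_invariant_vector:
  obtains v where "v \<in> pairs.fixed_vectors (word_stabilizer n block_word) V" "v \<noteq> 0"
proof -
  let ?H = "word_stabilizer n block_word"
  let ?e = "polytabloid n lam T_lam" and ?e' = "polytabloid n mu T_mu"
  let ?C = "column_stabilizer n lam T_lam" and ?C' = "column_stabilizer n mu T_mu"
  let ?z = "(word_tabloid n x, word_tabloid n y)"
  define v where "v = (\<Sum>h\<in>?H. pairs.rep h (tensor ?e ?e'))"
  have "tensor ?e ?e' \<in> V"
    unfolding tensor_space_def using polytabloid_specht tableau_T_lam tableau_T_mu
    by (blast intro: cfun.span_base)
  then have v: "v \<in> pairs.fixed_vectors ?H V"
    unfolding v_def using invariant_V by (intro pairs.sum_word_stabilizer_fixed)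
  define k where "k h = (\<Sum>\<sigma>\<in>?C. \<Sum>\<tau>\<in>?C'.
    if (\<forall>q<n. x (h (\<sigma> q)) = x q) \<and> (\<forall>q<n. y (h (\<tau> q)) = y q) then 1 else 0 :: nat)" for h
  have summand: "pairs.rep h (tensor ?e ?e') ?z = of_nat (k h)" if h: "h \<in> ?H" for h
  proof -
    have "pairs.rep h (tensor ?e ?e') ?z = ?e (word_tabloid n (x \<circ> h)) * ?e' (word_tabloid n (y \<circ> h))"
      using pairs_rep_word[OF word_stabilizer_sym_perms[OF h]] by (simp add: tensor_def)
    also have "\<dots> = (\<Sum>\<sigma>\<in>?C. \<Sum>\<tau>\<in>?C'.
        (if \<forall>q<n. (x \<circ> h) (\<sigma> q) = x q then of_int (sign \<sigma>) else 0) *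
        (if \<forall>q<n. (y \<circ> h) (\<tau> q) = y q then of_int (sign \<tau>) else 0))"
      unfolding polytabloid_word[OF tableau_T_lam] polytabloid_word[OF tableau_T_mu]
      by (rule sum_product)
    also have "\<dots> = of_nat (k h)"
      unfolding k_def of_nat_sum
    proof (intro sum.cong refl)
      fix \<sigma> \<tau> assume "\<sigma> \<in> ?C" "\<tau> \<in> ?C'"
      then have "\<sigma> = \<tau>" if "\<forall>q<n. x (h (\<sigma> q)) = x q" "\<forall>q<n. y (h (\<tau> q)) = y q"
        using column_permutations_agree[OF h] that by blast
      moreover have "of_int (sign \<tau>) * of_int (sign \<tau>) = (1::complex)"
        by (simp flip: of_int_mult)
      ultimately show "(if \<forall>q<n. (x \<circ> h) (\<sigma> q) = x q then of_int (sign \<sigma>) else 0) *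
        (if \<forall>q<n. (y \<circ> h) (\<tau> q) = y q then of_int (sign \<tau>) else (0::complex)) =
        of_nat (if (\<forall>q<n. x (h (\<sigma> q)) = x q) \<and> (\<forall>q<n. y (h (\<tau> q)) = y q) then 1 else 0)"
        by auto
    qed
    finally show ?thesis .
  qed
  have "pairs.rep id (tensor ?e ?e') ?z = 1"
    using polytabloid_tabloid[OF tableau_T_lam] polytabloid_tabloid[OF tableau_T_mu]
    by (simp add: pairs.rep_id tensor_def tabloid_eq_word[OF tableau_T_lam] tabloid_eq_word[OF tableau_T_mu])
  then have "k id = 1" using summand[OF id_word_stabilizer] by (metis of_nat_1 of_nat_eq_iff)
  moreover have "k id \<le> (\<Sum>h\<in>?H. k h)"
    by (rule member_le_sum[OF id_word_stabilizer _ finite_word_stabilizer]) simp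
  ultimately have "(\<Sum>h\<in>?H. k h) \<noteq> 0" by linarith
  moreover have "v ?z = of_nat (\<Sum>h\<in>?H. k h)" using summand by (simp add: v_def sum_fun_apply)
  ultimately have "v ?z \<noteq> 0" by (simp only: of_nat_eq_0_iff not_False_eq_True)
  then have "v \<noteq> 0" by auto
  then show ?thesis using that v by blast
qed

text \<open>Partitions have nonzero parts only, so \<open>n - N\<close> (and for \<open>n = 0\<close> also \<open>N\<close>)
  is dropped when it is 0.\<close>

definition two_row_partition :: "nat list" where
  "two_row_partition = filter (\<lambda>k. 0 < k) [N, n - N]"

lemma block_bounds: "N \<le> n" "n - N \<le> N"
  using parts unfolding N_def by linarith+

lemma nth_part_two_row: "nth_part two_row_partition 0 = N" "nth_part two_row_partition 1 = n - N"
  using block_bounds by (auto simp: two_row_partition_def nth_part_def)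

lemma two_row_partition_partitions: "two_row_partition \<in> partitions n"
  using block_bounds by (auto simp: two_row_partition_def partitions_def)

lemma block_word_content: "has_content n two_row_partition block_word"
  unfolding has_content_def
proof
  fix r :: nat
  let ?eq = "\<lambda>r. card {q. q < n \<and> block_word q = r} = nth_part two_row_partition r"
  have small: "?eq 0" "?eq 1"
  proof -
    have "{q. q < n \<and> block_word q = 0} = {..<N}"
      using block_bounds(1) by (auto simp: block_word_def)
    then show "?eq 0" unfolding nth_part_two_row by (metis card_lessThan)
    have "{q. q < n \<and> block_word q = 1} = {N..<n}"
      using block_bounds(1) by (auto simp: block_word_def)
    then show "?eq 1" unfolding nth_part_two_row by (metis card_atLeastLessThan)
  qed
  have large: "?eq r" if "2 \<le> r"
  proof -
    have "{q. q < n \<and> block_word q = r} = {}" using that by (auto simp: block_word_def)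
    moreover have "nth_part two_row_partition r = 0"
      using that by (auto simp: nth_part_def two_row_partition_def)
    ultimately show ?thesis by (simp only: card.empty)
  qed
  have "r = 0 \<or> r = 1 \<or> 2 \<le> r" by linarith
  then show "?eq r" using small large by blast
qed

text \<open>A summand of \<open>V\<close> is isomorphic to the Specht module if and only if it has a nonzero vector fixed by
  the stabilizer of the block word, and then these vectors form a line. So the multiplicity is the dimension of
  the space of fixed vectors of \<open>V\<close>.\<close>

theorem kronecker_coeff_two_row_pos: "0 < kronecker_coeff n lam mu two_row_partition"
proof -
  interpret two_row_shape n two_row_partition block_word
    using two_row_partition_partitions block_word_content
    by unfold_locales (auto simp: two_row_partition_def)
  obtain B where B: "finite B" "V \<subseteq> cfun.span B" using V_finite_dimensional by blast
  let ?F = "pairs.fixed_vectors H V"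
  have subV: "cfun.subspace V" using invariant_V by (rule pairs.invariant_subspaceD)
  have "kronecker_coeff n lam mu two_row_partition = cfun.dim ?F"
    unfolding kronecker_coeff_def
  proof (rule pairs.multiplicity_in_eqI[OF invariant_V B(2,1)])
    fix d W assume dec: "irreducible_decomposition (sym_perms n) pairs.rep V d W"
    let ?P = "\<lambda>i. isomorphic_reps (sym_perms n) tabl.rep S pairs.rep (W i)"
    show "card {i. i < d \<and> ?P i} = cfun.dim ?F"
    proof (rule pairs.card_summands_eq_dim_fixed[OF dec _ subV])
      show "H \<subseteq> sym_perms n" using word_stabilizer_sym_perms by blast
      show "\<exists>u. u \<noteq> 0 \<and> pairs.fixed_vectors H (W i) = cfun.span {u}" if "?P i" for i
        using fixed_vectors_isomorphic[OF pairs.perm_action_axioms that] .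
      show "pairs.fixed_vectors H (W i) \<subseteq> {0}" if i: "i < d" "\<not> ?P i" for i
      proof (rule ccontr)
        assume "\<not> pairs.fixed_vectors H (W i) \<subseteq> {0}"
        then obtain w where w: "w \<in> W i" "w \<noteq> 0" "\<And>h. h \<in> H \<Longrightarrow> pairs.rep h w = w"
          by (auto simp: pairs.fixed_vectors_def)
        have sub: "W i \<subseteq> V" using pairs.irreducible_decomposition_subset[OF dec i(1)] .
        have "?P i"
        proof (rule isomorphic_if_fixed_vector[OF pairs.perm_action_axioms _ _ _ _ w])
          show "irreducible_rep (sym_perms n) pairs.rep (W i)"
            using pairs.irreducible_decompositionD(1)[OF dec i(1)] .
          show "finite (tabloids n lam \<times> tabloids n mu)" by (simp add: finite_tabloids)
          show "f z = 0" if "f \<in> W i" "z \<notin> tabloids n lam \<times> tabloids n mu" for f z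
            using V_support that sub by blast
          show "pair_action tabloid_action tabloid_action \<sigma> z \<in> tabloids n lam \<times> tabloids n mu"
            if "\<sigma> \<in> sym_perms n" "z \<in> tabloids n lam \<times> tabloids n mu" for \<sigma> z
            using that tabloid_action_tabloids by (auto simp: pair_action_def)
          show "v = 0" if "A \<subseteq> {..<n}" "card A = Suc (nth_part two_row_partition 0)" "v \<in> W i"
            "\<And>\<sigma>. \<sigma> permutes A \<Longrightarrow> pairs.rep \<sigma> v = v" for A v
          proof (rule ccontr)
            assume "v \<noteq> 0"
            then have "card A \<le> l1 + m2"
              using symmetric_block_size[OF len_lam len_mu, of v A] that sub by blast
            then show False using that(2) nth_part_two_row(1) by (simp add: N_def)
          qed
        qed
        then show False using i(2) by blast
      qed
    qed
  qed
  moreover have "0 < cfun.dim ?F"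
  proof -
    obtain v where v: "v \<in> ?F" "v \<noteq> 0" by (rule ex_block_invariant_vector)
    have "0 \<in> ?F" using pairs.subspace_fixed_vectors[OF subV] by (rule cfun.subspace_0)
    then have "{0} \<subset> ?F" using v by blast
    moreover have "?F \<subseteq> cfun.span B" using B(2) by (auto simp: pairs.fixed_vectors_def)
    ultimately have "cfun.dim {0 :: (nat \<Rightarrow> nat set) \<times> (nat \<Rightarrow> nat set) \<Rightarrow> complex} < cfun.dim ?F"
      by (rule pairs.dim_psubset[OF cfun.subspace_single_0 _ _ B(1)])
    then show ?thesis by (rule le_less_trans[OF le0])
  qed
  ultimately show ?thesis by simp
qed

end


section \<open>Exponents of Schur functions\<close>

lemma finite_diagram: "finite (diagram p)"
proof (rule finite_subset)
  show "diagram p \<subseteq> (\<Union>r\<in>{..<length p}. {r} \<times> {..<p ! r})"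
    by (auto simp: diagram_def nth_part_def split: if_splits)
qed auto

lemma card_diagram: "p \<in> partitions n \<Longrightarrow> card (diagram p) = n"
  using ex_tableau[of p n] by (metis bij_betw_same_card card_lessThan tableau_def)

lemma schur_nonneg: "0 \<le> schur p \<alpha>"
  by (simp add: schur_def)

definition entry_count :: "nat list \<Rightarrow> (nat \<times> nat \<Rightarrow> nat) \<Rightarrow> nat \<Rightarrow> nat" where
  "entry_count p T i = card {b \<in> diagram p. T b = i}"

lemma sum_entry_count:
  assumes "finite K" "T ` diagram p \<subseteq> K"
  shows "(\<Sum>i\<in>K. entry_count p T i) = card (diagram p)"
  unfolding entry_count_def
proof -
  have "card (\<Union>i\<in>K. {b \<in> diagram p. T b = i}) = (\<Sum>i\<in>K. card {b \<in> diagram p. T b = i})"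
    using assms(1) finite_diagram by (intro card_UN_disjoint) auto
  moreover have "(\<Union>i\<in>K. {b \<in> diagram p. T b = i}) = diagram p" using assms(2) by auto
  ultimately show "(\<Sum>i\<in>K. card {b \<in> diagram p. T b = i}) = card (diagram p)" by simp
qed

lemma entries_in_keys:
  assumes "\<forall>i. entry_count p T i = Poly_Mapping.lookup \<alpha> i"
  shows "T ` diagram p \<subseteq> Poly_Mapping.keys \<alpha>"
proof (intro subsetI, elim imageE)
  fix i b assume b: "b \<in> diagram p" "i = T b"
  have "b \<in> {b \<in> diagram p. T b = i}" "finite {b \<in> diagram p. T b = i}"
    using b finite_diagram by auto
  then have "card {b \<in> diagram p. T b = i} \<noteq> 0" by (metis card_0_eq empty_iff)
  then show "i \<in> Poly_Mapping.keys \<alpha>" using assms by (simp add: in_keys_iff entry_count_def)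
qed

lemma schur_pos_iff:
  "0 < schur p \<alpha> \<longleftrightarrow> (\<exists>T. semistandard p T \<and> (\<forall>i. entry_count p T i = Poly_Mapping.lookup \<alpha> i))"
proof -
  let ?S = "{T. semistandard p T \<and> (\<forall>i. entry_count p T i = Poly_Mapping.lookup \<alpha> i)}"
  have "?S \<subseteq> PiE (diagram p) (\<lambda>_. Poly_Mapping.keys \<alpha>)"
    using entries_in_keys[of p _ \<alpha>] by (auto simp: semistandard_def PiE_def)
  moreover have "finite (PiE (diagram p) (\<lambda>_. Poly_Mapping.keys \<alpha>))"
    using finite_diagram by (intro finite_PiE) auto
  ultimately have "finite ?S" by (rule finite_subset)
  then have "0 < card ?S \<longleftrightarrow> ?S \<noteq> {}" by (simp add: card_gt_0_iff)
  moreover have "schur p \<alpha> = int (card ?S)" by (simp add: schur_def entry_count_def)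
  ultimately show ?thesis by auto
qed

text \<open>Columns of a semistandard tableau are strictly increasing, so an entry occurs at most once in each of the
  \<open>nth_part p 0\<close> columns.\<close>

lemma schur_pos_bounds:
  assumes p: "p \<in> partitions n" and pos: "0 < schur p \<alpha>"
  shows "(\<Sum>i\<in>Poly_Mapping.keys \<alpha>. Poly_Mapping.lookup \<alpha> i) = n"
    and "Poly_Mapping.lookup \<alpha> i \<le> nth_part p 0"
proof -
  obtain T where T: "semistandard p T" "\<forall>i. entry_count p T i = Poly_Mapping.lookup \<alpha> i"
    using pos schur_pos_iff by blast
  show "(\<Sum>i\<in>Poly_Mapping.keys \<alpha>. Poly_Mapping.lookup \<alpha> i) = n"
    using sum_entry_count[OF _ entries_in_keys[OF T(2)]] T(2) card_diagram[OF p] by simp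
  have "entry_count p T i \<le> card {..<nth_part p 0}"
    unfolding entry_count_def
  proof (rule card_inj_on_le[of snd])
    show "inj_on snd {b \<in> diagram p. T b = i}"
    proof (rule inj_onI)
      fix b b' assume b: "b \<in> {b \<in> diagram p. T b = i}" "b' \<in> {b \<in> diagram p. T b = i}" "snd b = snd b'"
      obtain r r' c where eq: "b = (r, c)" "b' = (r', c)" using b(3) by (metis prod.collapse)
      have strict: "T (r, c) < T (r', c)" if "(r', c) \<in> diagram p" "r < r'" for r r' c
        using T(1) that unfolding semistandard_def by blast
      have "r = r'" using strict[of r' c r] strict[of r c r'] b eq
        by (cases r r' rule: linorder_cases) auto
      then show "b = b'" using eq by simp
    qed
    show "snd ` {b \<in> diagram p. T b = i} \<subseteq> {..<nth_part p 0}"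
      using nth_part_antimono[OF p, of 0] by (force simp: diagram_def dest: less_le_trans)
  qed simp
  then show "Poly_Mapping.lookup \<alpha> i \<le> nth_part p 0" using T(2) by simp
qed

lemma ex_sorted_word:
  fixes \<alpha> :: exponent
  assumes "(\<Sum>i\<in>Poly_Mapping.keys \<alpha>. Poly_Mapping.lookup \<alpha> i) = n"
  obtains w where "length w = n" "sorted w" "\<And>i. card {q. q < n \<and> w ! q = i} = Poly_Mapping.lookup \<alpha> i"
proof -
  define M where "M = (\<Sum>i\<in>Poly_Mapping.keys \<alpha>. replicate_mset (Poly_Mapping.lookup \<alpha> i) i)"
  define w where "w = sorted_list_of_multiset M"
  have w: "mset w = M" "sorted w" by (simp_all add: w_def)
  have "size M = n" using assms by (simp add: M_def)
  then have len: "length w = n" using w(1) size_mset by metis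
  have "card {q. q < n \<and> w ! q = i} = Poly_Mapping.lookup \<alpha> i" for i
  proof -
    have "card {q. q < n \<and> w ! q = i} = count (mset w) i"
      unfolding count_mset count_list_eq_length_filter length_filter_conv_card len
      by (simp add: eq_commute)
    also have "\<dots> = (\<Sum>j\<in>Poly_Mapping.keys \<alpha>. if j = i then Poly_Mapping.lookup \<alpha> j else 0)"
      unfolding w(1) M_def count_sum by (intro sum.cong) auto
    also have "\<dots> = Poly_Mapping.lookup \<alpha> i" by (simp add: in_keys_iff)
    finally show ?thesis .
  qed
  then show ?thesis using that len w(2) by blast
qed

text \<open>Fill the two rows one after the other with the sorted word of content \<open>\<alpha>\<close>. The entries of a
  column are then letters at distance \<open>nth_part p 0\<close> in the word; they differ because no letter
  occurs more often than that.\<close>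

lemma schur_two_row_pos:
  assumes p: "p \<in> partitions n" "length p \<le> 2"
    and \<alpha>: "(\<Sum>i\<in>Poly_Mapping.keys \<alpha>. Poly_Mapping.lookup \<alpha> i) = n"
      "\<And>i. Poly_Mapping.lookup \<alpha> i \<le> nth_part p 0"
  shows "0 < schur p \<alpha>"
proof -
  let ?N = "nth_part p 0"
  obtain w where w: "length w = n" "sorted w"
    "\<And>i. card {q. q < n \<and> w ! q = i} = Poly_Mapping.lookup \<alpha> i"
    by (rule ex_sorted_word[OF \<alpha>(1)]) blast
  have "nth_part p 2 = 0" using p(2) by (simp add: nth_part_def)
  then have n: "?N + nth_part p 1 = n" using sum_nth_part[OF p(1)] p(2) by simp
  have le: "nth_part p 1 \<le> ?N" using nth_part_antimono[OF p(1)] by simp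
  have diagram: "(r, c) \<in> diagram p \<longleftrightarrow> r = 0 \<and> c < ?N \<or> r = 1 \<and> c < nth_part p 1" for r c
  proof -
    have "nth_part p r = 0" if "2 \<le> r" using p(2) that by (simp add: nth_part_def)
    then have "r \<in> {0, 1} \<or> nth_part p r = 0" by fastforce
    then show ?thesis by (auto simp: diagram_def)
  qed
  have mono: "w ! i \<le> w ! j" if "i \<le> j" "j < n" for i j
    using w(1,2) that by (simp add: sorted_nth_mono)
  have strict: "w ! c < w ! (?N + c)" if c: "?N + c < n" for c
  proof (rule ccontr)
    assume "\<not> w ! c < w ! (?N + c)"
    then have eq: "w ! c = w ! (?N + c)" using mono[of c "?N + c"] c by simp
    have "{c..?N + c} \<subseteq> {q. q < n \<and> w ! q = w ! c}"
    proof
      fix q assume q: "q \<in> {c..?N + c}"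
      then have "w ! c \<le> w ! q" "w ! q \<le> w ! (?N + c)" using mono c by auto
      then show "q \<in> {q. q < n \<and> w ! q = w ! c}" using q c eq by auto
    qed
    then have "card {c..?N + c} \<le> Poly_Mapping.lookup \<alpha> (w ! c)"
      unfolding w(3)[symmetric] by (intro card_mono) auto
    then show False using \<alpha>(2)[of "w ! c"] by simp
  qed
  define pos where "pos = (\<lambda>(r :: nat, c). if r = 0 then c else ?N + c)"
  define T where "T = restrict (\<lambda>b. w ! pos b) (diagram p)"
  have T: "T (r, c) = w ! pos (r, c)" if "(r, c) \<in> diagram p" for r c using that by (simp add: T_def)
  have bij: "bij_betw pos (diagram p) {..<n}"
  proof (rule bij_betw_imageI)
    show "inj_on pos (diagram p)" by (rule inj_onI) (auto simp: pos_def diagram split: if_splits)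
    show "pos ` diagram p = {..<n}"
    proof (intro equalityI subsetI)
      fix q assume "q \<in> {..<n}"
      then show "q \<in> pos ` diagram p" using n
        by (intro image_eqI[of _ _ "if q < ?N then (0, q) else (1, q - ?N)"]) (auto simp: pos_def diagram)
    qed (use n in \<open>auto simp: pos_def diagram\<close>)
  qed
  have "semistandard p T"
    unfolding semistandard_def
  proof (intro conjI allI impI)
    show "T \<in> extensional (diagram p)" by (simp add: T_def)
    fix r c c' assume d: "(r, c') \<in> diagram p \<and> c < c'"
    then have "(r, c) \<in> diagram p" by (auto simp: diagram)
    moreover have "pos (r, c') < n" using bij d bij_betwE by blast
    ultimately show "T (r, c) \<le> T (r, c')" using d T mono by (auto simp: pos_def)
  next
    fix r r' c assume d: "(r', c) \<in> diagram p \<and> r < r'"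
    then have "r = 0" "r' = 1" "c < nth_part p 1" by (auto simp: diagram)
    then show "T (r, c) < T (r', c)" using strict[of c] n le T[of 0 c] T[of 1 c]
      by (simp add: pos_def diagram)
  qed
  moreover have "entry_count p T i = Poly_Mapping.lookup \<alpha> i" for i
  proof -
    have inj: "inj_on pos {b \<in> diagram p. T b = i}"
      using bij by (auto simp: bij_betw_def intro: inj_on_subset)
    have "{b \<in> diagram p. T b = i} = {b \<in> diagram p. w ! pos b = i}" by (auto simp: T_def)
    then have "pos ` {b \<in> diagram p. T b = i} = {q. q < n \<and> w ! q = i}"
      using bij by (auto simp: bij_betw_def)
    then have "card {b \<in> diagram p. T b = i} = card {q. q < n \<and> w ! q = i}"
      using card_image[OF inj] by simp
    then show ?thesis using w(3) by (simp add: entry_count_def)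
  qed
  ultimately show ?thesis using schur_pos_iff by blast
qed

section \<open>The Newton polytope\<close>

context dominating_pair
begin

lemma kronecker_product_nonneg: "0 \<le> kronecker_product n lam mu \<alpha>"
  unfolding kronecker_product_def by (intro sum_nonneg mult_nonneg_nonneg schur_nonneg) simp

text \<open>Only partitions with first part at most \<open>N\<close> contribute, and \<open>(N, n - N)\<close> contributes
  all the monomials that their Schur functions can have.\<close>

lemma kronecker_product_pos_iff:
  "0 < kronecker_product n lam mu \<alpha> \<longleftrightarrow>
    (\<Sum>i\<in>Poly_Mapping.keys \<alpha>. Poly_Mapping.lookup \<alpha> i) = n \<and> (\<forall>i. Poly_Mapping.lookup \<alpha> i \<le> N)"
proof
  assume "0 < kronecker_product n lam mu \<alpha>"
  then obtain p where p: "p \<in> partitions n" "int (kronecker_coeff n lam mu p) * schur p \<alpha> \<noteq> 0"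
    unfolding kronecker_product_def
    by (elim sum.not_neutral_contains_not_neutral[OF less_imp_neq[THEN not_sym]]) blast
  have "nth_part p 0 \<le> N"
    using kronecker_coeff_eq_0[OF len_lam len_mu p(1)] p(2) unfolding N_def
    by (intro leI notI) simp
  have pos: "0 < schur p \<alpha>" using p(2) schur_nonneg[of p \<alpha>] by (cases "schur p \<alpha> = 0") auto
  show "(\<Sum>i\<in>Poly_Mapping.keys \<alpha>. Poly_Mapping.lookup \<alpha> i) = n \<and> (\<forall>i. Poly_Mapping.lookup \<alpha> i \<le> N)"
    using schur_pos_bounds[OF p(1) pos] le_trans[OF _ \<open>nth_part p 0 \<le> N\<close>] by simp
next
  assume \<alpha>: "(\<Sum>i\<in>Poly_Mapping.keys \<alpha>. Poly_Mapping.lookup \<alpha> i) = n \<and> (\<forall>i. Poly_Mapping.lookup \<alpha> i \<le> N)"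
  let ?s = two_row_partition
  have "length ?s \<le> 2" by (simp add: two_row_partition_def)
  then have "0 < schur ?s \<alpha>"
    using \<alpha> nth_part_two_row two_row_partition_partitions by (intro schur_two_row_pos) auto
  then have pos: "0 < int (kronecker_coeff n lam mu ?s) * schur ?s \<alpha>"
    using kronecker_coeff_two_row_pos by simp
  have fin: "finite (partitions n)"
  proof (rule finite_subset)
    show "partitions n \<subseteq> {xs. set xs \<subseteq> {..n} \<and> length xs \<le> n}"
    proof
      fix p assume p: "p \<in> partitions n"
      have "length q \<le> sum_list q" if "\<forall>x\<in>set q. 0 < x" for q :: "nat list"
        using that by (induction q) auto
      from this[of p] have "length p \<le> sum_list p" using p by (simp add: partitions_def)
      then show "p \<in> {xs. set xs \<subseteq> {..n} \<and> length xs \<le> n}"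
        using p member_le_sum_list by (auto simp: partitions_def)
    qed
  qed (rule finite_lists_length_le; simp)
  show "0 < kronecker_product n lam mu \<alpha>"
    unfolding kronecker_product_def
    using fin two_row_partition_partitions pos
    by (rule sum_pos2[where i = "?s"]) (simp add: schur_nonneg)
qed

lemma exponent_set_eq:
  "exponent_set k (specialize k (kronecker_product n lam mu)) =
    {v \<in> integer_points k. (\<Sum>i<k. Poly_Mapping.lookup v i) = real n \<and>
      (\<forall>i. 0 \<le> Poly_Mapping.lookup v i \<and> Poly_Mapping.lookup v i \<le> real N)}"
  (is "?L = ?R")
proof (intro equalityI subsetI)
  fix v assume "v \<in> ?L"
  then obtain \<alpha> where \<alpha>: "v = real_point \<alpha>" "Poly_Mapping.keys \<alpha> \<subseteq> {..<k}"
    "0 < kronecker_product n lam mu \<alpha>"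
    by (auto simp: exponent_set_def specialize_def)
  have lookup: "Poly_Mapping.lookup v i = real (Poly_Mapping.lookup \<alpha> i)" for i
    unfolding \<alpha>(1) real_point_def by (simp add: Poly_Mapping.map.rep_eq when_def)
  have "(\<Sum>i<k. Poly_Mapping.lookup \<alpha> i) = (\<Sum>i\<in>Poly_Mapping.keys \<alpha>. Poly_Mapping.lookup \<alpha> i)"
    using \<alpha>(2) by (intro sum.mono_neutral_right) (auto simp: in_keys_iff)
  then have sum: "(\<Sum>i<k. Poly_Mapping.lookup v i) = real n"
    using \<alpha>(3) unfolding kronecker_product_pos_iff lookup by (metis of_nat_sum)
  moreover have "Poly_Mapping.keys v \<subseteq> {..<k}"
    using \<alpha>(2) by (auto simp: in_keys_iff lookup subset_iff)
  ultimately show "v \<in> ?R"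
    using \<alpha>(3) by (auto simp: integer_points_def lookup kronecker_product_pos_iff)
next
  fix v assume v: "v \<in> ?R"
  define \<alpha> where "\<alpha> = Poly_Mapping.map (\<lambda>x. nat \<lfloor>x\<rfloor>) v"
  have lookup: "real (Poly_Mapping.lookup \<alpha> i) = Poly_Mapping.lookup v i" for i
  proof -
    have "Poly_Mapping.lookup v i \<in> \<int>" "0 \<le> Poly_Mapping.lookup v i"
      using v by (auto simp: integer_points_def)
    then show ?thesis unfolding \<alpha>_def by (auto simp: Poly_Mapping.map.rep_eq when_def elim!: Ints_cases)
  qed
  have "Poly_Mapping.lookup (real_point \<alpha>) i = real (Poly_Mapping.lookup \<alpha> i)" for i
    by (simp add: real_point_def Poly_Mapping.map.rep_eq when_def)
  then have "v = real_point \<alpha>" by (intro poly_mapping_eqI) (simp only: lookup)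
  moreover have keys: "Poly_Mapping.keys \<alpha> \<subseteq> {..<k}"
  proof -
    have "Poly_Mapping.keys v \<subseteq> {..<k}" using v by (simp add: integer_points_def)
    then show ?thesis by (auto simp: in_keys_iff subset_iff simp flip: lookup)
  qed
  moreover have "0 < kronecker_product n lam mu \<alpha>"
    unfolding kronecker_product_pos_iff
  proof
    have "(\<Sum>i\<in>Poly_Mapping.keys \<alpha>. Poly_Mapping.lookup \<alpha> i) = (\<Sum>i<k. Poly_Mapping.lookup \<alpha> i)"
      using keys by (intro sum.mono_neutral_left) (auto simp: in_keys_iff)
    moreover have "real (\<Sum>i<k. Poly_Mapping.lookup \<alpha> i) = real n"
      using v by (simp add: lookup)
    ultimately show "(\<Sum>i\<in>Poly_Mapping.keys \<alpha>. Poly_Mapping.lookup \<alpha> i) = n" by linarith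
    have "real (Poly_Mapping.lookup \<alpha> i) \<le> real N" for i using v by (simp add: lookup)
    then show "\<forall>i. Poly_Mapping.lookup \<alpha> i \<le> N" by simp
  qed
  ultimately show "v \<in> ?L" by (auto simp: exponent_set_def specialize_def)
qed

lemma kronecker_product_saturated: "saturated_newton_polytope k (specialize k (kronecker_product n lam mu))"
  unfolding saturated_newton_polytope_def
proof (intro conjI allI)
  show "0 \<le> specialize k (kronecker_product n lam mu) \<alpha>" for \<alpha>
    by (simp add: specialize_def kronecker_product_nonneg)
  let ?E = "exponent_set k (specialize k (kronecker_product n lam mu))"
  let ?C = "{v :: nat \<Rightarrow>\<^sub>0 real. (\<Sum>i<k. Poly_Mapping.lookup v i) = real n \<and>
      (\<forall>i. 0 \<le> Poly_Mapping.lookup v i \<and> Poly_Mapping.lookup v i \<le> real N)}"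
  have scale: "Poly_Mapping.lookup (u *\<^sub>R v) i = u * Poly_Mapping.lookup v i" for u i and v :: "nat \<Rightarrow>\<^sub>0 real"
    by (simp add: scaleR_poly_mapping_def)
  have "convex ?C"
  proof (rule convexI)
    fix v w :: "nat \<Rightarrow>\<^sub>0 real" and a b :: real
    assume vw: "v \<in> ?C" "w \<in> ?C" and ab: "0 \<le> a" "0 \<le> b" "a + b = 1"
    have "a * Poly_Mapping.lookup v i + b * Poly_Mapping.lookup w i \<le> real N" for i
      using vw ab by (intro convex_bound_le) auto
    moreover have "(\<Sum>i<k. a * Poly_Mapping.lookup v i + b * Poly_Mapping.lookup w i) = real n"
      using vw ab by (simp add: sum.distrib flip: sum_distrib_left distrib_right)
    ultimately show "a *\<^sub>R v + b *\<^sub>R w \<in> ?C"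
      using vw ab by (simp add: lookup_add scale)
  qed
  then have "convex hull ?E \<subseteq> ?C" by (intro hull_minimal) (auto simp: exponent_set_eq)
  then show "?E = convex hull ?E \<inter> integer_points k"
    using hull_subset[of ?E convex] by (auto simp: exponent_set_eq)
qed

end

theorem theorem1p4:
  fixes n :: nat and lam mu :: "nat list"
  assumes "lam \<in> partitions n" and "mu \<in> partitions n"
    and "length lam \<le> 2" and "length mu \<le> 3"
    and "nth_part mu 0 \<ge> nth_part lam 0"
  shows "\<forall>k. saturated_newton_polytope k (specialize k (kronecker_product n lam mu))"
proof -
  interpret dominating_pair n lam mu using assms by unfold_locales
  show ?thesis using kronecker_product_saturated by blast
qed

end
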